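(* Let $d\ge2$, $N_o,\tau,p>0$, let $\Lambda(dx)=dx$ be the Lebesgue measure on $\mathbb R^d$, let all powers be equal to the constant $p$ (i.e. $\mu=\delta_p$), and let $\ell$ be well-behaved with $\ell(0)>\tau N_o/p$. Then $\lambda_c^*=\lambda_c(r_B)$, where $r_B=\ell^{-1}(\tau N_o/p)$.
   Context: For $\lambda>0$, $X^\lambda=\{X_i\}_{i\in I}$ is a homogeneous Poisson point process on $\mathbb R^d$ with intensity $\lambda$. SINR graph. For $\gamma\ge0$, the SINR graph $G_\gamma(X^\lambda)$ (with constant powers $p$, SINR threshold $\tau$, noise $N_o$, path-loss function $\ell:[0,\infty)\to[0,\infty)$) has vertex set $X^\lambda$, and $X_i\ne X_j$ are joined by an edge iff $$p\,\ell(|X_i-X_j|)>\tau\Big(N_o+\gamma\sum_{k\in I\setminus\{i,j\}}p\,\ell(|X_k-X_j|)\Big)\ \text{ and }\ p\,\ell(|X_i-X_j|)>\tau\Big(N_o+\gamma\sum_{k\in I\setminus\{i,j\}}p\,\ell(|X_k-X_i|)\Big).$$ A graph with locally finite vertex set in $\mathbb R^d$ percolates if it has an unbounded connected component. Define $$\gamma(\lambda)=\sup\{\gamma>0:\mathbb P(G_\gamma(X^\lambda)\text{ percolates})>0\},\qquad \lambda_c^*=\inf\{\lambda>0:\gamma(\lambda')>0\ \forall\lambda'>\lambda\},$$ with $\sup\emptyset=0$ and $\inf\emptyset=\infty$. $\ell$ is well-behaved if it is continuous, constant on $[0,d_o]$ for some $d_o\ge0$, strictly decreasing on $[d_o,\infty)\cap\operatorname{supp}(\ell)$,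 and $\int_0^\infty r^{d-1}\ell(r)\,dr<\infty$. Under these conditions and $\ell(0)>\tau N_o/p$, $r_B=\ell^{-1}(\tau N_o/p)$ is the unique $r>0$ with $\ell(r)=\tau N_o/p$. Gilbert graph. For $r>0$, the Poisson–Gilbert graph $g_r(X^\lambda)$ has vertex set $X^\lambda$ and an edge between any two distinct points at distance less than $r$. $\lambda_c(r)\in(0,\infty)$ is its critical intensity: the unique value such that $g_r(X^\lambda)$ percolates with probability one for $\lambda>\lambda_c(r)$ and almost surely does not percolate for $\lambda<\lambda_c(r)$ (existence for $d\ge2$ is standard). *)

theory Defs
  imports "HOL-Probability.Probability"
begin

text \<open>
  A point process is represented by a random locally finite set of points of a Euclidean space.
  The counting law is written out instead of using \<open>poisson_pmf\<close>, which is only specified for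
  positive rates, whereas here the rate vanishes if \<open>B\<close> is a null set (note \<open>0 ^ 0 = 1\<close>).
  Counts are only considered on bounded sets, where they are finite.
\<close>

definition homogeneous_poisson_process ::
    "'w measure \<Rightarrow> real \<Rightarrow> ('w \<Rightarrow> 'a::euclidean_space set) \<Rightarrow> bool" where
  "homogeneous_poisson_process M lam X \<longleftrightarrow>
     prob_space M \<and>
     (\<forall>w\<in>space M. \<forall>B. bounded B \<longrightarrow> finite (X w \<inter> B)) \<and>
     (\<forall>B\<in>sets borel. bounded B \<longrightarrow>
        (\<lambda>w. card (X w \<inter> B)) \<in> measurable M (count_space UNIV) \<and>
        (\<forall>k. \<P>(w in M. card (X w \<inter> B) = k)
               = (lam * measure lborel B) ^ k / fact k * exp (- (lam * measure lborel B)))) \<and>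
     (\<forall>n (B :: nat \<Rightarrow> 'a set).
        (\<forall>i<n. B i \<in> sets borel \<and> bounded (B i)) \<and> disjoint_family_on B {..<n} \<longrightarrow>
        prob_space.indep_vars M (\<lambda>_. count_space UNIV) (\<lambda>i w. card (X w \<inter> B i)) {..<n})"

text \<open>
  A graph is given by its vertex set \<open>V\<close> and a symmetric edge relation \<open>E \<subseteq> V \<times> V\<close>, so that
  the connected component of \<open>x\<close> is the image of \<open>x\<close> under \<open>E\<^sup>*\<close>.
\<close>

definition graph_components :: "'a set \<Rightarrow> ('a \<times> 'a) set \<Rightarrow> 'a set set" where
  "graph_components V E = (\<lambda>x. E\<^sup>* `` {x}) ` V"

definition percolates :: "'a::metric_space set \<Rightarrow> ('a \<times> 'a) set \<Rightarrow> bool" where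
  "percolates V E \<longleftrightarrow> (\<exists>C\<in>graph_components V E. \<not> bounded C)"

definition gilbert_edges :: "real \<Rightarrow> 'a::metric_space set \<Rightarrow> ('a \<times> 'a) set" where
  "gilbert_edges r V = {(x, y). x \<in> V \<and> y \<in> V \<and> x \<noteq> y \<and> dist x y < r}"

text \<open>
  The interference at \<open>z\<close> of all points of \<open>V\<close> except the sender and the receiver.  It is a
  possibly divergent sum of nonnegative terms and therefore formed in the extended nonnegative
  reals.
\<close>

definition interference ::
    "real \<Rightarrow> (real \<Rightarrow> real) \<Rightarrow> 'a::metric_space set \<Rightarrow> 'a \<Rightarrow> 'a \<Rightarrow> 'a \<Rightarrow> ennreal" where
  "interference p l V x y z = (\<Sum>\<^sub>\<infinity>v\<in>V - {x, y}. ennreal (p * l (dist v z)))"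

definition sinr_edges ::
    "real \<Rightarrow> real \<Rightarrow> real \<Rightarrow> (real \<Rightarrow> real) \<Rightarrow> real \<Rightarrow> 'a::metric_space set \<Rightarrow> ('a \<times> 'a) set" where
  "sinr_edges p tau No l gam V = {(x, y). x \<in> V \<and> y \<in> V \<and> x \<noteq> y \<and>
     ennreal (p * l (dist x y)) >
       ennreal tau * (ennreal No + ennreal gam * interference p l V x y y) \<and>
     ennreal (p * l (dist x y)) >
       ennreal tau * (ennreal No + ennreal gam * interference p l V x y x)}"

text \<open>
  Path-loss functions live on \<open>[0, \<infinity>)\<close>; values at negative arguments are irrelevant.
  The support is the closure of the set where \<open>l\<close> does not vanish.
\<close>

definition path_loss_support :: "(real \<Rightarrow> real) \<Rightarrow> real set" where
  "path_loss_support l = closure {r \<in> {0..}. l r \<noteq> 0}"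

definition well_behaved :: "nat \<Rightarrow> (real \<Rightarrow> real) \<Rightarrow> bool" where
  "well_behaved d l \<longleftrightarrow>
     (\<forall>r\<ge>0. l r \<ge> 0) \<and>
     continuous_on {0..} l \<and>
     (\<exists>d0\<ge>0. l constant_on {0..d0} \<and> strict_antimono_on ({d0..} \<inter> path_loss_support l) l) \<and>
     (\<integral>\<^sup>+r\<in>{0..}. ennreal (r ^ (d - 1) * l r) \<partial>lborel) < \<infinity>"

definition r_B :: "real \<Rightarrow> real \<Rightarrow> real \<Rightarrow> (real \<Rightarrow> real) \<Rightarrow> real" where
  "r_B p tau No l = (THE r. r > 0 \<and> l r = tau * No / p)"

text \<open>
  In the following, \<open>X lam\<close> is a Poisson process of intensity \<open>lam\<close> on the probability space
  \<open>M lam\<close>, for every \<open>lam > 0\<close>.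
\<close>

definition lambda_c ::
    "(real \<Rightarrow> 'w measure) \<Rightarrow> (real \<Rightarrow> 'w \<Rightarrow> 'a::euclidean_space set) \<Rightarrow> real \<Rightarrow> real" where
  "lambda_c M X r = (THE c. c > 0 \<and>
     (\<forall>lam>c. AE w in M lam. percolates (X lam w) (gilbert_edges r (X lam w))) \<and>
     (\<forall>lam. 0 < lam \<and> lam < c \<longrightarrow>
        (AE w in M lam. \<not> percolates (X lam w) (gilbert_edges r (X lam w)))))"

text \<open>
  In \<open>ennreal\<close> the conventions \<open>sup \<emptyset> = 0\<close> and \<open>inf \<emptyset> = \<infinity>\<close> hold.
\<close>

definition gamma_crit ::
    "real \<Rightarrow> real \<Rightarrow> real \<Rightarrow> (real \<Rightarrow> real) \<Rightarrow>
     (real \<Rightarrow> 'w measure) \<Rightarrow> (real \<Rightarrow> 'w \<Rightarrow> 'a::euclidean_space set) \<Rightarrow> real \<Rightarrow> ennreal" where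
  "gamma_crit p tau No l M X lam = Sup {ennreal gam | gam. gam > 0 \<and>
     \<P>(w in M lam. percolates (X lam w) (sinr_edges p tau No l gam (X lam w))) > 0}"

definition lambda_c_star ::
    "real \<Rightarrow> real \<Rightarrow> real \<Rightarrow> (real \<Rightarrow> real) \<Rightarrow>
     (real \<Rightarrow> 'w measure) \<Rightarrow> (real \<Rightarrow> 'w \<Rightarrow> 'a::euclidean_space set) \<Rightarrow> ennreal" where
  "lambda_c_star p tau No l M X =
     Inf {ennreal lam | lam. lam > 0 \<and> (\<forall>lam'>lam. gamma_crit p tau No l M X lam' > 0)}"

end

theory Submission
  imports Defs "HOL-Library.Transitive_Closure_Table"
begin

text \<open>
  An edge of the SINR graph has length less than \<open>r_B\<close>, so nothing percolates below the critical
  intensity of the Gilbert graph.  Conversely, let \<open>lam1 < lam2\<close> and suppose that the Gilbert graph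
  of intensity \<open>lam1\<close> percolates.  After discretization to the cells of a fine lattice, the set of
  occupied cells is an independent site percolation of finite range.  Rescaling slightly gives a
  percolating independent site process whose density is still smaller than that of the occupied cells
  at intensity \<open>lam2\<close>, and whose edges correspond to points at distance less than some \<open>r1 < r_B\<close>.

  It remains to remove the cells of high interference at intensity \<open>lam2\<close> without losing more than
  this surplus of density.  Split the number of points of a cell into a part that is at most \<open>M\<close>
  and an excess.  A dyadic cube is crowded if its total excess is at least its volume, and all
  crowded cubes are deleted together with their neighbours.  Since \<open>l\<close> is integrable, the
  interference is bounded on the remaining cells.  A cube of volume \<open>n\<close> is crowded with probability
  at most \<open>b ^ n\<close>, where \<open>b\<close> is as small as we please, and this makes the deletions dominated by
  independent deletions of single cells with small probability.  Given the excesses, the occupation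
  of the cells without excess is independent, so that the remaining occupied cells dominate the
  percolating site process.  No property of supercritical percolation besides its existence
  is used, and the argument works in every dimension.
\<close>

section \<open>Reachability\<close>

text \<open>The obstacle is the cost of deleting a cube. A crowded cube of level \<open>k\<close>
  deletes about \<open>3 ^ d * n\<close> sites, where \<open>n = 2 ^ (k * d)\<close>, and
  independent closings with probability \<open>t\<close> close all of them only with probability
  \<open>t ^ (3 ^ d * n)\<close>. The closings of all levels must add up to a small total, so
  \<open>t\<close> tends to \<open>0\<close> with \<open>k\<close>, and no fixed \<open>b\<close>
  keeps \<open>b ^ n\<close> below that power. Therefore a background closing of every site with a
  fixed probability \<open>s\<close> is added: one site closed at rate \<open>t\<close> and the
  others closed by the background give \<open>t * s ^ (3 ^ d * n)\<close>, which does dominate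
  \<open>b ^ n\<close> for small \<open>b\<close>. The processes of different intensities are given
  without any relation to each other, so all comparisons are inequalities between expectations of
  decreasing functions in finite windows, with an interference bound that does not depend on the
  window. The 0-1 law is applied to the independent site process, and the comparison carries
  probability one over to the cells of low interference. The same comparison also yields the sharp
  threshold that the description \<open>lambda_c\<close> presupposes.\<close>

definition reach :: "'a::real_normed_vector set \<Rightarrow> ('a \<times> 'a) set \<Rightarrow> real \<Rightarrow> real \<Rightarrow> bool" where
  "reach V E m n \<longleftrightarrow> (\<exists>x\<in>V. \<exists>y. (x, y) \<in> E\<^sup>* \<and> norm x \<le> m \<and> n \<le> norm y)"

lemma reach_mono:
  assumes "reach V E m n" "V \<subseteq> V'" "E \<subseteq> E'" "m \<le> m'" "n' \<le> n"
  shows "reach V' E' m' n'"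
proof -
  obtain x y where "x \<in> V" "(x, y) \<in> E\<^sup>*" "norm x \<le> m" "n \<le> norm y"
    using assms(1) unfolding reach_def by blast
  then show ?thesis
    using assms rtrancl_mono[OF assms(3)] unfolding reach_def
    by (intro bexI[of _ x] exI[of _ y]) auto
qed

text \<open>Only finitely many vertices lie in the ball of radius \<open>m\<close>, so if each had a
  bounded component, one \<open>n\<close> would exceed all the bounds. Percolation becomes a
  countable combination of events \<open>reach\<close>, which for Gilbert graphs depend on a bounded
  part of the vertex set.\<close>

lemma percolates_iff_reach:
  fixes V :: "'a::real_normed_vector set"
  assumes fin: "\<And>r. finite (V \<inter> cball 0 r)"
  shows "percolates V E \<longleftrightarrow> (\<exists>m::nat. \<forall>n::nat. reach V E m n)"
proof
  assume "percolates V E"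
  then obtain x where x: "x \<in> V" "\<not> bounded (E\<^sup>* `` {x})"
    by (auto simp: percolates_def graph_components_def)
  obtain m :: nat where m: "norm x \<le> m" using real_arch_simple by blast
  have "\<exists>y. (x, y) \<in> E\<^sup>* \<and> r \<le> norm y" for r
  proof (rule ccontr)
    assume "\<not> ?thesis"
    then have "\<And>y. (x, y) \<in> E\<^sup>* \<Longrightarrow> norm y \<le> r" by force
    then show False using x(2) by (auto simp: bounded_iff)
  qed
  then have "\<forall>n::nat. reach V E m n" using x m unfolding reach_def by blast
  then show "\<exists>m::nat. \<forall>n::nat. reach V E m n" by blast
next
  assume "\<exists>m::nat. \<forall>n::nat. reach V E m n"
  then obtain m :: nat where m: "\<And>n::nat. reach V E m n" by blast
  let ?S = "V \<inter> cball 0 m"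
  let ?P = "\<lambda>x n. \<exists>y. (x, y) \<in> E\<^sup>* \<and> real n \<le> norm y"
  have "\<exists>x\<in>?S. \<forall>n. ?P x n"
  proof (rule ccontr)
    assume "\<not> ?thesis"
    then obtain k where k: "\<And>x. x \<in> ?S \<Longrightarrow> \<not> ?P x (k x)" by metis
    define n where "n = (\<Sum>x\<in>?S. k x)"
    obtain x y where xy: "x \<in> ?S" "(x, y) \<in> E\<^sup>*" "real n \<le> norm y"
      using m[of n] by (auto simp: reach_def)
    have "k x \<le> n" unfolding n_def using xy(1) fin by (intro member_le_sum) auto
    then show False using k[OF xy(1)] xy by force
  qed
  then obtain x where x: "x \<in> V" "\<And>n. ?P x n" by auto
  have "\<not> bounded (E\<^sup>* `` {x})"
  proof
    assume "bounded (E\<^sup>* `` {x})"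
    then obtain a where a: "\<And>y. (x, y) \<in> E\<^sup>* \<Longrightarrow> norm y \<le> a" by (auto simp: bounded_iff)
    obtain n :: nat where "a < n" using reals_Archimedean2 by blast
    then show False using x(2)[of n] a by force
  qed
  then show "percolates V E" using x(1) by (auto simp: percolates_def graph_components_def)
qed

lemma gilbert_edges_mono: "V \<subseteq> V' \<Longrightarrow> r \<le> r' \<Longrightarrow> gilbert_edges r V \<subseteq> gilbert_edges r' V'"
  by (auto simp: gilbert_edges_def)

lemma reach_gilbert_mono:
  "reach A (gilbert_edges r A) m n \<Longrightarrow> A \<subseteq> B \<Longrightarrow> reach B (gilbert_edges r B) m n"
  by (erule reach_mono) (auto intro: gilbert_edges_mono[THEN subsetD])

text \<open>A path can be cut at its first vertex of norm at least \<open>n\<close>. All earlier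
  vertices have norm at most \<open>max m n\<close>, so the cut path stays within one more edge
  length \<open>r\<close>.\<close>

lemma reach_gilbert_restrict:
  fixes A :: "'a::real_normed_vector set"
  assumes "0 \<le> r"
  shows "reach A (gilbert_edges r A) m n
     \<longleftrightarrow> reach (A \<inter> cball 0 (max m n + r)) (gilbert_edges r (A \<inter> cball 0 (max m n + r))) m n"
proof
  let ?A = "A \<inter> cball 0 (max m n + r)"
  let ?E = "gilbert_edges r ?A"
  assume "reach A (gilbert_edges r A) m n"
  then obtain x y where xy: "x \<in> A" "(x, y) \<in> (gilbert_edges r A)\<^sup>*" "norm x \<le> m" "n \<le> norm y"
    by (auto simp: reach_def)
  have "(x, y) \<in> ?E\<^sup>* \<or> (\<exists>y'. (x, y') \<in> ?E\<^sup>* \<and> n \<le> norm y')"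
    using xy(2)
  proof (induction rule: rtrancl_induct)
    case (step y z)
    show ?case
    proof (cases "\<exists>y'. (x, y') \<in> ?E\<^sup>* \<and> n \<le> norm y'")
      case False
      then have y: "(x, y) \<in> ?E\<^sup>*" "norm y < n" using step by force+
      have yz: "y \<in> A" "z \<in> A" "y \<noteq> z" "dist y z < r" using step(2) by (auto simp: gilbert_edges_def)
      have "norm z \<le> norm y + dist y z" by (metis dist_commute dist_norm norm_triangle_sub)
      then have "(y, z) \<in> ?E" using yz y(2) assms by (auto simp: gilbert_edges_def)
      then show ?thesis using y(1) by auto
    qed auto
  qed auto
  then show "reach ?A ?E m n" using xy assms by (auto simp: reach_def)
qed (auto elim!: reach_gilbert_mono)

text \<open>Behind its last vertex in \<open>F\<close>, a path continues from a vertex within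
  distance \<open>r\<close> of \<open>F\<close>; enlarging \<open>m\<close> to cover these vertices
  absorbs the deletion. This makes percolation a tail event.\<close>

lemma reach_gilbert_delete_finite:
  fixes A :: "'a::real_normed_vector set"
  assumes "0 \<le> r" "finite F" "\<And>n::nat. reach A (gilbert_edges r A) m n"
  shows "\<exists>m'::nat. \<forall>n::nat. reach (A - F) (gilbert_edges r (A - F)) m' n"
proof -
  let ?E = "gilbert_edges r (A - F)"
  obtain a where a: "\<And>f. f \<in> F \<Longrightarrow> norm f \<le> a"
    using finite_imp_bounded[OF assms(2)] by (auto simp: bounded_iff)
  obtain m' :: nat where m': "max m (a + r) \<le> m'" using real_arch_simple by blast
  have "reach (A - F) ?E m' n" for n :: nat
  proof -
    obtain k :: nat where k: "max n (a + 1) \<le> k" using real_arch_simple by blast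
    obtain x y where xy: "x \<in> A" "(x, y) \<in> (gilbert_edges r A)\<^sup>*" "norm x \<le> m" "k \<le> norm y"
      using assms(3)[of k] by (auto simp: reach_def)
    have "y \<notin> F \<longrightarrow> (\<exists>u\<in>A - F. norm u \<le> m' \<and> (u, y) \<in> ?E\<^sup>*)"
      using xy(2)
    proof (induction rule: rtrancl_induct)
      case base
      have "norm x \<le> m'" using xy(3) m' by simp
      then show ?case using xy(1) by blast
    next
      case (step y z)
      have yz: "y \<in> A" "z \<in> A" "y \<noteq> z" "dist y z < r" using step(2) by (auto simp: gilbert_edges_def)
      show ?case
      proof (cases "y \<in> F")
        case True
        have "norm z \<le> norm y + dist y z" by (metis dist_commute dist_norm norm_triangle_sub)
        then have "norm z \<le> m'" using a[OF True] yz m' by auto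
        then show ?thesis using yz by auto
      next
        case False
        show ?thesis
        proof
          assume "z \<notin> F"
          then have "(y, z) \<in> ?E" using yz False by (auto simp: gilbert_edges_def)
          then show "\<exists>u\<in>A - F. norm u \<le> m' \<and> (u, z) \<in> ?E\<^sup>*"
            using step(3) False by (meson rtrancl.rtrancl_into_rtrancl)
        qed
      qed
    qed
    moreover have "y \<notin> F" using a[of y] xy(4) k by auto
    ultimately show ?thesis using xy(4) k unfolding reach_def by fastforce
  qed
  then show ?thesis by blast
qed

text \<open>A map within bounded distance of the scaling by \<open>a\<close> preserves
  unboundedness. Edges may go to whole paths, in particular to the trivial path when two points
  share a cell.\<close>

lemma percolates_transfer:
  fixes A V :: "'a::real_normed_vector set"
  assumes fin: "\<And>r. finite (V \<inter> cball 0 r)" and reach: "\<And>n::nat. reach A E' m n"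
    and V: "\<And>z. z \<in> A \<Longrightarrow> f z \<in> V" and E: "\<And>z z'. (z, z') \<in> E' \<Longrightarrow> (f z, f z') \<in> E\<^sup>*"
    and sub: "E' \<subseteq> A \<times> A" and a: "a > 0"
    and bd: "\<And>z. z \<in> A \<Longrightarrow> norm (f z - a *\<^sub>R z) \<le> b"
  shows "percolates V E"
proof -
  obtain m' :: nat where m': "a * m + b \<le> m'" using real_arch_simple by blast
  have "reach V E m' n" for n :: nat
  proof -
    obtain k :: nat where k: "(n + b) / a \<le> k" using real_arch_simple by blast
    obtain x y where xy: "x \<in> A" "(x, y) \<in> E'\<^sup>*" "norm x \<le> m" "k \<le> norm y"
      using reach[of k] by (auto simp: reach_def)
    have "y \<in> A" using xy(2,1) sub by (induction rule: rtrancl_induct) auto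
    from xy(2) have "(f x, f y) \<in> E\<^sup>*"
      by (induction rule: rtrancl_induct) (auto intro: rtrancl_trans E)
    moreover have "norm (f x) \<le> m'"
    proof -
      have "norm (f x) \<le> a * norm x + norm (f x - a *\<^sub>R x)"
      using norm_triangle_sub[of "f x" "a *\<^sub>R x"] a by auto
    also have "\<dots> \<le> a * m + b" using xy a bd[of x] by (intro add_mono mult_left_mono) auto
      finally show ?thesis using m' by simp
    qed
    moreover have "n \<le> norm (f y)"
    proof -
      have "n + b \<le> a * k" using k a by (simp add: field_simps)
      also have "\<dots> \<le> a * norm y" using xy a by (intro mult_left_mono) auto
      also have "a * norm y \<le> norm (f y) + norm (f y - a *\<^sub>R y)"
        using norm_triangle_sub[of "a *\<^sub>R y" "f y"] a by (simp add: norm_minus_commute)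
      finally show ?thesis using bd[OF \<open>y \<in> A\<close>] by simp
    qed
    ultimately show ?thesis using V[OF xy(1)] unfolding reach_def by blast
  qed
  then show ?thesis using percolates_iff_reach[OF fin] by blast
qed

section \<open>Closing sites of an independent site percolation\<close>

text \<open>Sets collect closed sites. Composing these averaging operators gives the expectation
  over independent closings without a product space, and a site may be closed repeatedly.\<close>

definition close_site :: "'v \<Rightarrow> real \<Rightarrow> ('v set \<Rightarrow> real) \<Rightarrow> 'v set \<Rightarrow> real" where
  "close_site x a f F = (1 - a) * f F + a * f (insert x F)"

definition close_sites :: "('v \<times> real) list \<Rightarrow> ('v set \<Rightarrow> real) \<Rightarrow> 'v set \<Rightarrow> real" where
  "close_sites l f = foldr (\<lambda>(x, a). close_site x a) l f"

lemma close_sites_Nil [simp]: "close_sites [] f = f"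
  and close_sites_Cons [simp]: "close_sites ((x, a) # l) f = close_site x a (close_sites l f)"
  and close_sites_append: "close_sites (l @ l') f = close_sites l (close_sites l' f)"
  by (simp_all add: close_sites_def)

abbreviation prob_list :: "('v \<times> real) list \<Rightarrow> bool" where
  "prob_list l \<equiv> (\<forall>(x, a)\<in>set l. 0 \<le> a \<and> a \<le> 1)"

lemma close_site_antimono:
  assumes "antimono f" "0 \<le> a" "a \<le> 1"
  shows "antimono (close_site x a f)"
proof (rule antimonoI)
  fix F G :: "'a set" assume "F \<subseteq> G"
  then have "f G \<le> f F" "f (insert x G) \<le> f (insert x F)"
    using assms(1) by (auto intro!: antimonoD[of f])
  then show "close_site x a f G \<le> close_site x a f F"
    unfolding close_site_def using assms by (intro add_mono mult_left_mono) auto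
qed

lemma close_sites_antimono:
  "antimono f \<Longrightarrow> prob_list l \<Longrightarrow> antimono (close_sites l f)"
  by (induction l) (auto intro!: close_site_antimono)

lemma close_site_mono:
  assumes "\<And>F. f F \<le> g F" "0 \<le> a" "a \<le> 1"
  shows "close_site x a f F \<le> close_site x a g F"
  unfolding close_site_def using assms by (intro add_mono mult_left_mono) auto

lemma close_sites_mono:
  assumes "\<And>F. f F \<le> g F" "prob_list l"
  shows "close_sites l f F \<le> close_sites l g F"
  using assms(2) by (induction l arbitrary: F) (auto simp: assms(1) intro!: close_site_mono)

lemma close_site_mono_prob:
  assumes "antimono f" "a \<le> b"
  shows "close_site x b f F \<le> close_site x a f F"
proof -
  have "f (insert x F) \<le> f F"
    using assms(1) by (auto intro!: antimonoD[of f])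
  then have "(b - a) * f (insert x F) \<le> (b - a) * f F"
    using assms by (intro mult_left_mono) auto
  then show ?thesis
    unfolding close_site_def by (simp add: algebra_simps)
qed

lemma close_site_le: "antimono f \<Longrightarrow> 0 \<le> a \<Longrightarrow> close_site x a f F \<le> f F"
  using close_site_mono_prob[of f 0 a x F] by (simp add: close_site_def)

lemma close_sites_le:
  "antimono f \<Longrightarrow> prob_list l \<Longrightarrow> close_sites l f F \<le> f F"
proof (induction l arbitrary: F)
  case (Cons z l)
  obtain x a where z: "z = (x, a)" by force
  have "close_site x a (close_sites l f) F \<le> close_sites l f F"
    using Cons z by (intro close_site_le close_sites_antimono) auto
  also have "\<dots> \<le> f F" using Cons by auto
  finally show ?case using z by simp
qed simp

lemma close_sites_shift:
  "close_sites l (\<lambda>F. f (F \<union> D)) F = close_sites l f (F \<union> D)"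
proof (induction l arbitrary: F)
  case (Cons z l)
  obtain x a where z: "z = (x, a)" by force
  show ?case by (simp add: z close_site_def Cons)
qed simp

lemma close_sites_bounds:
  assumes "\<And>F. 0 \<le> f F \<and> f F \<le> (1::real)" "prob_list l"
  shows "0 \<le> close_sites l f F \<and> close_sites l f F \<le> 1"
proof -
  have c: "close_sites l (\<lambda>_. c) F = c" for c
    by (induction l arbitrary: F) (auto simp: close_site_def algebra_simps)
  show ?thesis
    using close_sites_mono[of "\<lambda>_. 0" f l F] close_sites_mono[of f "\<lambda>_. 1" l F] assms by (auto simp: c)
qed

lemma close_site_close_site:
  "close_site x a (close_site x b f) = close_site x (1 - (1 - a) * (1 - b)) f"
  by (auto simp: close_site_def fun_eq_iff algebra_simps)

lemma close_site_commute:
  "close_site x a (close_site y b f) = close_site y b (close_site x a f)"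
  by (auto simp: close_site_def fun_eq_iff algebra_simps insert_commute)

lemma close_site_merge:
  assumes "x \<in> set xs" "distinct xs"
  shows "close_site x a (close_sites (map (\<lambda>y. (y, u y)) xs) f)
       = close_sites (map (\<lambda>y. (y, (u(x := 1 - (1 - a) * (1 - u x))) y)) xs) f"
  using assms
proof (induction xs)
  case (Cons z xs)
  show ?case
  proof (cases "z = x")
    case True
    define v where "v = u(x := 1 - (1 - a) * (1 - u x))"
    have "map (\<lambda>y. (y, v y)) xs = map (\<lambda>y. (y, u y)) xs" "v x = 1 - (1 - a) * (1 - u x)"
      using Cons True by (auto simp: v_def)
    then show ?thesis using True
      unfolding v_def[symmetric] by (simp add: close_site_close_site cong: map_cong)
  next
    case False
    then show ?thesis using Cons by (simp add: close_site_commute[of x])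
  qed
qed simp

lemma close_site_0: "close_site x 0 f = f"
  by (simp add: close_site_def fun_eq_iff)

text \<open>The probability that \<open>x\<close> survives all closings in \<open>l\<close>,
  repetitions included.\<close>

definition open_prob :: "('v \<times> real) list \<Rightarrow> 'v \<Rightarrow> real" where
  "open_prob l x = (\<Prod>(y, a)\<leftarrow>l. if y = x then 1 - a else 1)"

text \<open>Closings commute, and two closings of one site merge by multiplying the survival
  probabilities. Sites of \<open>xs\<close> without an entry get closing probability
  \<open>0\<close>, which is the identity operator.\<close>

lemma close_sites_normal:
  assumes "distinct xs" "fst ` set l \<subseteq> set xs"
  shows "close_sites l f = close_sites (map (\<lambda>x. (x, 1 - open_prob l x)) xs) f"
  using assms(2)
proof (induction l)
  case Nil
  show ?case by (induction xs) (auto simp: open_prob_def close_site_0)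
next
  case (Cons z l)
  obtain x a where z: "z = (x, a)" by force
  have *: "(\<lambda>y. 1 - open_prob l y)(x := 1 - (1 - a) * (1 - (1 - open_prob l x)))
      = (\<lambda>y. 1 - open_prob (z # l) y)"
    by (auto simp: open_prob_def z fun_eq_iff)
  have "close_sites (z # l) f
      = close_site x a (close_sites (map (\<lambda>y. (y, (\<lambda>y. 1 - open_prob l y) y)) xs) f)"
    using Cons z by simp
  also have "\<dots> = close_sites (map (\<lambda>y. (y, ((\<lambda>y. 1 - open_prob l y)
      (x := 1 - (1 - a) * (1 - (1 - open_prob l x)))) y)) xs) f"
    by (rule close_site_merge) (use Cons z assms in auto)
  finally show ?case unfolding * .
qed

lemma close_sites_mono_prob:
  assumes "antimono f" "\<And>x. x \<in> set xs \<Longrightarrow> 0 \<le> u x \<and> u x \<le> v x \<and> v x \<le> 1"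
  shows "close_sites (map (\<lambda>x. (x, v x)) xs) f F \<le> close_sites (map (\<lambda>x. (x, u x)) xs) f F"
  using assms(2)
proof (induction xs arbitrary: F)
  case (Cons x xs)
  have "close_site x (v x) (close_sites (map (\<lambda>x. (x, v x)) xs) f) F
      \<le> close_site x (v x) (close_sites (map (\<lambda>x. (x, u x)) xs) f) F"
    using Cons by (intro close_site_mono) (auto intro: order_trans)
  also have "\<dots> \<le> close_site x (u x) (close_sites (map (\<lambda>x. (x, u x)) xs) f) F"
    using Cons by (intro close_site_mono_prob close_sites_antimono assms) (auto intro: order_trans)
  finally show ?case by simp
qed simp

text \<open>In normal form both sides close each site once, and a decreasing function prefers the
  smaller closing probability. So only survival probabilities matter, however the closings are
  spread over \<open>l\<close>.\<close>

lemma close_sites_compare: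
  assumes "antimono f" "distinct xs" "fst ` set l \<subseteq> set xs" "prob_list l"
    and "\<And>x. x \<in> set xs \<Longrightarrow> r \<le> open_prob l x" "0 \<le> r"
  shows "close_sites (map (\<lambda>x. (x, 1 - r)) xs) f F \<le> close_sites l f F"
proof -
  have "0 \<le> open_prob l x \<and> open_prob l x \<le> 1" for x
    using assms(4)
  proof (induction l)
    case (Cons z l)
    then show ?case
      by (cases z) (auto simp: open_prob_def intro!: mult_le_one)
  qed (simp add: open_prob_def)
  then show ?thesis
    using assms by (subst close_sites_normal[of xs l f]) (auto intro!: close_sites_mono_prob)
qed

text \<open>
  Holds if \<open>g\<close> averages over configurations in which \<open>y\<close> is independently closed with probability at
  least \<open>s\<close>: with that probability, closing \<open>x\<close> has the same effect as if \<open>y\<close> were closed.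
\<close>

definition influence :: "real \<Rightarrow> 'v \<Rightarrow> ('v set \<Rightarrow> real) \<Rightarrow> bool" where
  "influence s y g \<longleftrightarrow>
    (\<forall>F x. s * (g (insert y F) - g (insert x (insert y F))) \<le> g F - g (insert x F))"

text \<open>The defining inequality is linear in \<open>g\<close> and holds at every
  \<open>F\<close>, and closing \<open>x\<close> commutes with adding \<open>y\<close>, so averaging
  keeps it.\<close>

lemma influence_close_site:
  assumes "influence s y g" "0 \<le> a" "a \<le> 1"
  shows "influence s y (close_site x a g)"
  unfolding influence_def
proof (intro allI)
  fix F z
  have 1: "s * (g (insert y F) - g (insert z (insert y F))) \<le> g F - g (insert z F)" 
    using assms(1) by (auto simp: influence_def)
  have 2: "s * (g (insert y (insert x F)) - g (insert z (insert y (insert x F))))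
      \<le> g (insert x F) - g (insert z (insert x F))"
    using assms(1) unfolding influence_def by blast
  have "(1 - a) * (s * (g (insert y F) - g (insert z (insert y F)))) +
        a * (s * (g (insert y (insert x F)) - g (insert z (insert y (insert x F)))))
      \<le> (1 - a) * (g F - g (insert z F)) + a * (g (insert x F) - g (insert z (insert x F)))"
    using assms 1 2 by (intro add_mono mult_left_mono) auto
  then show "s * (close_site x a g (insert y F) - close_site x a g (insert z (insert y F)))
      \<le> close_site x a g F - close_site x a g (insert z F)"
    unfolding close_site_def by (simp add: algebra_simps insert_commute)
qed

text \<open>The closing of \<open>y\<close> provides the share \<open>s\<close> in which
  \<open>y\<close> is closed; the other share contributes a nonnegative amount since
  \<open>g\<close> is decreasing.\<close>

lemma influence_close_site_same:
  assumes "antimono g" "0 \<le> s" "s \<le> 1"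
  shows "influence s y (close_site y s g)"
  unfolding influence_def
proof (intro allI)
  fix F x
  have "0 \<le> (1 - s) * (g F - g (insert x F))"
    using assms by (auto intro!: mult_nonneg_nonneg antimonoD[of g])
  then show "s * (close_site y s g (insert y F) - close_site y s g (insert x (insert y F)))
      \<le> close_site y s g F - close_site y s g (insert x F)"
    unfolding close_site_def by (simp add: algebra_simps insert_commute)
qed

lemma influence_close_sites:
  assumes "antimono f" "prob_list l" "(y, s) \<in> set l"
  shows "influence s y (close_sites l f)"
  using assms(2,3)
proof (induction l)
  case (Cons z l)
  obtain x a where z: "z = (x, a)" by force
  show ?case
  proof (cases "(y, s) = (x, a)")
    case True
    then show ?thesis using Cons assms(1) z
      by (auto intro!: influence_close_site_same close_sites_antimono)
  next
    case False
    then show ?thesis using Cons z by (auto intro!: influence_close_site)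
  qed
qed simp

lemma influence_union:
  assumes inf: "\<And>y. y \<in> set B \<Longrightarrow> influence s y g" and s: "0 \<le> s"
  shows "s ^ length B * (g (F \<union> set B) - g (insert x (F \<union> set B))) \<le> g F - g (insert x F)"
  using inf
proof (induction B arbitrary: F)
  case (Cons y B)
  have "s ^ length B * (g (insert y F \<union> set B) - g (insert x (insert y F \<union> set B)))
      \<le> g (insert y F) - g (insert x (insert y F))"
    by (rule Cons.IH) (use Cons in auto)
  then have "s * (s ^ length B * (g (insert y F \<union> set B) - g (insert x (insert y F \<union> set B))))
      \<le> s * (g (insert y F) - g (insert x (insert y F)))"
    using s by (rule mult_left_mono)
  also have "\<dots> \<le> g F - g (insert x F)"
    using Cons(2)[of y] by (auto simp: influence_def)
  finally show ?case by (simp add: mult.assoc)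
qed simp

text \<open>The factor \<open>t\<close> pays for one site of \<open>B\<close>, and the randomness at
  rate \<open>s\<close> already averaged in \<open>g\<close>, recorded by \<open>influence\<close>,
  pays for the others. Independence of the closings at rate \<open>t\<close> alone would give only
  \<open>t ^ length B\<close>.\<close>

lemma close_block:
  assumes anti: "antimono g" and inf: "\<And>y. y \<in> set B \<Longrightarrow> influence s y g"
    and s: "0 \<le> s" "s \<le> 1" and t: "0 \<le> t" "t \<le> 1 - s"
    and q: "q \<le> t * s ^ length B"
  shows "close_sites (map (\<lambda>x. (x, t)) B) g F \<le> (1 - q) * g F + q * g (F \<union> set B)"
proof -
  \<comment> \<open>The loss from closing \<open>x # B\<close> telescopes into closing
    \<open>B\<close>, bounded by induction with \<open>1 - t\<close> at least \<open>s\<close>, and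
    closing \<open>x\<close> afterwards, bounded by \<open>influence_union\<close>.\<close>
  have *: "close_sites (map (\<lambda>x. (x, t)) B) g F
      \<le> g F - t * s ^ length B * (g F - g (F \<union> set B))"
    using inf
  proof (induction B arbitrary: F)
    case (Cons x B)
    let ?g = "close_sites (map (\<lambda>x. (x, t)) B) g"
    let ?n = "length B"
    have t1: "t \<le> 1" using t s by auto
    have pl: "prob_list (map (\<lambda>x. (x, t)) B)" using t t1 by auto
    have 1: "?g F \<le> g F - t * s ^ ?n * (g F - g (F \<union> set B))"
      using Cons by auto
    have 2: "?g (insert x F) \<le> g (insert x F)"
      by (rule close_sites_le[OF anti pl])
    have "(1 - t) * ?g F + t * ?g (insert x F)
        \<le> (1 - t) * (g F - t * s ^ ?n * (g F - g (F \<union> set B))) + t * g (insert x F)"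
      using 1 2 t t1 by (intro add_mono mult_left_mono) auto
    also have "\<dots> = g F - t * (g F - g (insert x F))
        - (1 - t) * (t * s ^ ?n * (g F - g (F \<union> set B)))"
      by (simp add: algebra_simps)
    finally have 3: "(1 - t) * ?g F + t * ?g (insert x F) \<le> \<dots>" .
    have 4: "t * s ^ ?n * (g (F \<union> set B) - g (insert x (F \<union> set B)))
        \<le> t * (g F - g (insert x F))"
      using influence_union[of B s g F x] Cons(2) s t by (auto simp: mult.assoc intro!: mult_left_mono)
    have 5: "s * (t * s ^ ?n * (g F - g (F \<union> set B)))
        \<le> (1 - t) * (t * s ^ ?n * (g F - g (F \<union> set B)))"
      using t s anti by (intro mult_right_mono mult_nonneg_nonneg) (auto intro!: antimonoD[of g])
    have 6: "s * (t * s ^ ?n * (g (F \<union> set B) - g (insert x (F \<union> set B))))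
        \<le> 1 * (t * s ^ ?n * (g (F \<union> set B) - g (insert x (F \<union> set B))))"
      using t s anti by (intro mult_right_mono mult_nonneg_nonneg) (auto intro!: antimonoD[of g])
    from 3 4 5 6 have "(1 - t) * ?g F + t * ?g (insert x F) \<le> g F
        - s * (t * s ^ ?n * (g (F \<union> set B) - g (insert x (F \<union> set B))))
        - s * (t * s ^ ?n * (g F - g (F \<union> set B)))" by linarith
    then show ?case by (simp add: close_site_def algebra_simps)
  qed simp
  have "q * (g F - g (F \<union> set B)) \<le> t * s ^ length B * (g F - g (F \<union> set B))"
    using anti q by (intro mult_right_mono) (auto intro!: antimonoD[of g])
  then show ?thesis using * by (simp add: algebra_simps)
qed

section \<open>Exploration of crowded blocks\<close>

lemma integrable_unit_pmf:
  fixes f :: "'b \<Rightarrow> real"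
  assumes "\<And>x. 0 \<le> f x \<and> f x \<le> 1"
  shows "integrable (measure_pmf p) f"
  by (rule measure_pmf.integrable_const_bound[where B = 1]) (use assms in \<open>auto intro!: AE_I2\<close>)

lemma expectation_unit:
  fixes f :: "'b \<Rightarrow> real"
  assumes "\<And>x. 0 \<le> f x \<and> f x \<le> 1"
  shows "0 \<le> measure_pmf.expectation p f \<and> measure_pmf.expectation p f \<le> 1"
proof -
  have "measure_pmf.expectation p f \<le> measure_pmf.expectation p (\<lambda>_. 1)"
    using assms by (intro integral_mono integrable_unit_pmf) auto
  then show ?thesis using assms by (auto intro!: integral_nonneg_AE)
qed

lemma expectation_mono_unit:
  fixes f g :: "'b \<Rightarrow> real"
  assumes "\<And>x. 0 \<le> f x \<and> f x \<le> 1" "\<And>x. 0 \<le> g x \<and> g x \<le> 1" 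
    and "\<And>x. x \<in> set_pmf p \<Longrightarrow> f x \<le> g x"
  shows "measure_pmf.expectation p f \<le> measure_pmf.expectation p g"
  by (intro integral_mono_AE integrable_unit_pmf assms) (auto simp: AE_measure_pmf_iff assms(3))

lemma expectation_pair_pmf_unit:
  fixes f :: "'b \<times> 'c \<Rightarrow> real"
  assumes f: "\<And>x. 0 \<le> f x \<and> f x \<le> 1"
  shows "measure_pmf.expectation (pair_pmf p q) f
       = measure_pmf.expectation p (\<lambda>x. measure_pmf.expectation q (\<lambda>y. f (x, y)))"
proof -
  have "ennreal (measure_pmf.expectation (pair_pmf p q) f) = (\<integral>\<^sup>+z. ennreal (f z) \<partial>pair_pmf p q)"
    by (rule nn_integral_eq_integral[symmetric]) (use f in \<open>auto intro!: integrable_unit_pmf\<close>)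
  also have "\<dots> = (\<integral>\<^sup>+x. \<integral>\<^sup>+y. ennreal (f (x, y)) \<partial>q \<partial>p)"
    by (rule nn_integral_pair_pmf')
  also have "\<dots> = (\<integral>\<^sup>+x. ennreal (measure_pmf.expectation q (\<lambda>y. f (x, y))) \<partial>p)"
    by (intro nn_integral_cong nn_integral_eq_integral) (use f in \<open>auto intro!: integrable_unit_pmf\<close>)
  also have "\<dots> = ennreal (measure_pmf.expectation p (\<lambda>x. measure_pmf.expectation q (\<lambda>y. f (x, y))))"
    by (rule nn_integral_eq_integral)
      (use f in \<open>auto intro!: integrable_unit_pmf simp: expectation_unit\<close>)
  finally show ?thesis
    using f by (subst (asm) ennreal_inj) (auto simp: expectation_unit)
qed

lemma expectation_Pi_pmf_union:
  fixes f :: "('v \<Rightarrow> 'c) \<Rightarrow> real"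
  assumes "\<And>x. 0 \<le> f x \<and> f x \<le> 1" "finite A" "finite B" "A \<inter> B = {}"
  shows "measure_pmf.expectation (Pi_pmf (A \<union> B) d p) f
       = measure_pmf.expectation (Pi_pmf A d p) (\<lambda>g. measure_pmf.expectation (Pi_pmf B d p)
           (\<lambda>h. f (\<lambda>x. if x \<in> A then g x else h x)))"
proof -
  have "Pi_pmf (A \<union> B) d p = map_pmf (\<lambda>z x. if x \<in> A then fst z x else snd z x)
      (pair_pmf (Pi_pmf A d p) (Pi_pmf B d p))"
    using assms by (simp add: Pi_pmf_union case_prod_beta')
  then have "measure_pmf.expectation (Pi_pmf (A \<union> B) d p) f
      = measure_pmf.expectation (pair_pmf (Pi_pmf A d p) (Pi_pmf B d p))
          (\<lambda>z. f (\<lambda>x. if x \<in> A then fst z x else snd z x))"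
    by simp
  also have "\<dots> = measure_pmf.expectation (Pi_pmf A d p) (\<lambda>g. measure_pmf.expectation (Pi_pmf B d p)
      (\<lambda>h. f (\<lambda>x. if x \<in> A then fst (g, h) x else snd (g, h) x)))"
    by (rule expectation_pair_pmf_unit) (use assms in auto)
  finally show ?thesis unfolding fst_conv snd_conv .
qed

lemma expectation_Pi_pmf_insert:
  fixes f :: "('v \<Rightarrow> 'c) \<Rightarrow> real"
  assumes "\<And>x. 0 \<le> f x \<and> f x \<le> 1" "finite A" "x \<notin> A"
  shows "measure_pmf.expectation (Pi_pmf (insert x A) d p) f
       = measure_pmf.expectation (p x) (\<lambda>k. measure_pmf.expectation (Pi_pmf A d p)
           (\<lambda>h. f (h(x := k))))"
  using assms by (simp add: Pi_pmf_insert expectation_pair_pmf_unit case_prod_beta)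

text \<open>Chebyshev's association inequality. With \<open>m\<close> the mean of \<open>f\<close>
  and a level \<open>c\<close> of \<open>g\<close> that separates \<open>f < m\<close> from
  \<open>f > m\<close>, the product of \<open>f - m\<close> and \<open>g - c\<close> is never
  positive, and its expectation is the difference of the two sides.\<close>

lemma chebyshev_pmf:
  fixes f g :: "'b::linorder \<Rightarrow> real"
  assumes f: "mono f" and g: "antimono g"
    and f01: "\<And>x. 0 \<le> f x \<and> f x \<le> 1" and g01: "\<And>x. 0 \<le> g x \<and> g x \<le> 1"
  shows "measure_pmf.expectation p (\<lambda>x. f x * g x)
      \<le> measure_pmf.expectation p f * measure_pmf.expectation p g"
proof -
  let ?E = "measure_pmf.expectation p"
  define m where "m = ?E f"
  \<comment> \<open>Inserting \<open>0\<close>, a lower bound of \<open>g\<close>, keeps the set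
    nonempty when \<open>f\<close> never exceeds its mean.\<close>
  define c where "c = Sup (insert 0 (g ` {y. f y > m}))"
  have bdd: "bdd_above (insert 0 (g ` {y. f y > m}))"
    by (rule bdd_aboveI[of _ 1]) (use g01 in auto)
  have le: "(f x - m) * (g x - c) \<le> 0" for x
  proof (cases "f x" m rule: linorder_cases)
    case less
    have "c \<le> g x"
      unfolding c_def
    proof (rule cSup_least)
      fix v assume "v \<in> insert 0 (g ` {y. m < f y})"
      then consider "v = 0" | y where "v = g y" "m < f y" by auto
      then show "v \<le> g x"
      proof cases
        case 2
        then have "\<not> y \<le> x" using less f by (auto dest: monoD)
        then show ?thesis using 2 g by (auto intro: antimonoD)
      qed (use g01 in auto)
    qed auto
    then show ?thesis using less by (auto intro!: mult_nonpos_nonneg)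
  next
    case greater
    then have "g x \<le> c" unfolding c_def by (intro cSup_upper bdd) auto
    then show ?thesis using greater by (auto intro!: mult_nonneg_nonpos)
  qed simp
  have int: "integrable p f" "integrable p g" "integrable p (\<lambda>x. f x * g x)"
    by (auto intro!: integrable_unit_pmf f01 g01 mult_le_one simp: f01 g01)
  have "?E (\<lambda>x. f x * g x - c * f x - m * g x + m * c) \<le> ?E (\<lambda>_. 0)"
    by (intro integral_mono) (use le int in \<open>auto simp: algebra_simps\<close>)
  also have "?E (\<lambda>x. f x * g x - c * f x - m * g x + m * c)
      = ?E (\<lambda>x. f x * g x) - c * m - m * ?E g + m * c"
    using int by (simp add: m_def)
  finally show ?thesis by (simp add: m_def algebra_simps)
qed

text \<open>Induction on the coordinates: given the value at \<open>x\<close> the induction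
  hypothesis applies, and the two conditional expectations are monotone and antitone in that value,
  so that \<open>chebyshev_pmf\<close> finishes.\<close>

lemma harris_Pi_pmf:
  fixes f g :: "('v \<Rightarrow> 'b::linorder) \<Rightarrow> real"
  assumes "finite A" "mono f" "antimono g"
    and "\<And>x. 0 \<le> f x \<and> f x \<le> 1" "\<And>x. 0 \<le> g x \<and> g x \<le> 1"
  shows "measure_pmf.expectation (Pi_pmf A d p) (\<lambda>x. f x * g x)
      \<le> measure_pmf.expectation (Pi_pmf A d p) f * measure_pmf.expectation (Pi_pmf A d p) g"
  using assms
proof (induction A arbitrary: f g rule: finite_induct)
  case (insert x A)
  let ?E = "measure_pmf.expectation (Pi_pmf A d p)"
  have upd: "h(x := j) \<le> h(x := k)" if "j \<le> k" for h :: "'v \<Rightarrow> 'b" and j k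
    using that by (auto simp: le_fun_def)
  have upd': "h(x := k) \<le> h'(x := k)" if "h \<le> h'" for h h' :: "'v \<Rightarrow> 'b" and k
    using that by (auto simp: le_fun_def)
  have fg: "0 \<le> f x * g x \<and> f x * g x \<le> 1" for x
    using insert.prems by (auto intro!: mult_le_one)
  have "measure_pmf.expectation (Pi_pmf (insert x A) d p) (\<lambda>x. f x * g x)
      = measure_pmf.expectation (p x) (\<lambda>k. ?E (\<lambda>h. f (h(x := k)) * g (h(x := k))))"
    by (rule expectation_Pi_pmf_insert) (use fg insert in auto)
  also have "\<dots> \<le> measure_pmf.expectation (p x) (\<lambda>k. ?E (\<lambda>h. f (h(x := k))) * ?E (\<lambda>h. g (h(x := k))))"
  proof (rule expectation_mono_unit)
    fix k
    show "?E (\<lambda>h. f (h(x := k)) * g (h(x := k))) \<le> ?E (\<lambda>h. f (h(x := k))) * ?E (\<lambda>h. g (h(x := k)))"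
      using insert.prems
      by (intro insert.IH) (auto intro!: monoI antimonoI elim!: monoD antimonoD simp: upd' simp del: fun_upd_apply)
    show "0 \<le> ?E (\<lambda>h. f (h(x := k)) * g (h(x := k))) \<and> ?E (\<lambda>h. f (h(x := k)) * g (h(x := k))) \<le> 1"
      by (rule expectation_unit) (use fg in auto)
    show "0 \<le> ?E (\<lambda>h. f (h(x := k))) * ?E (\<lambda>h. g (h(x := k)))
        \<and> ?E (\<lambda>h. f (h(x := k))) * ?E (\<lambda>h. g (h(x := k))) \<le> 1"
      using insert.prems by (auto intro!: mult_le_one simp: expectation_unit)
  qed
  also have "\<dots> \<le> measure_pmf.expectation (p x) (\<lambda>k. ?E (\<lambda>h. f (h(x := k))))
                 * measure_pmf.expectation (p x) (\<lambda>k. ?E (\<lambda>h. g (h(x := k))))"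
    using insert.prems upd
    by (intro chebyshev_pmf monoI antimonoI expectation_unit expectation_mono_unit)
      (auto elim!: monoD antimonoD simp del: fun_upd_apply)
  also have "\<dots> = measure_pmf.expectation (Pi_pmf (insert x A) d p) f
                * measure_pmf.expectation (Pi_pmf (insert x A) d p) g"
    using insert by (simp add: expectation_Pi_pmf_insert)
  finally show ?case .
qed simp

section \<open>Crowded blocks and the sites they delete\<close>

definition crowded :: "'v set \<Rightarrow> ('v \<Rightarrow> nat) \<Rightarrow> bool" where
  "crowded Q e \<longleftrightarrow> card Q \<le> sum e Q"

text \<open>In a triple \<open>(Q, B, t)\<close>, \<open>Q\<close> is the block whose excess is
  tested, \<open>B\<close> lists the sites removed when it is crowded, and \<open>t\<close> is the
  rate at which \<open>block_sites\<close> closes each site of \<open>B\<close> to pay for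
  this.\<close>

definition deleted :: "('v set \<times> 'v list \<times> real) list \<Rightarrow> ('v \<Rightarrow> nat) \<Rightarrow> 'v set" where
  "deleted l e = (\<Union>(Q, B, t)\<in>{(Q, B, t)\<in>set l. crowded Q e}. set B)"

lemma deleted_Nil [simp]: "deleted [] e = {}"
  and deleted_Cons: "deleted ((Q, B, t) # l) e = (if crowded Q e then set B else {}) \<union> deleted l e"
  by (auto simp: deleted_def)

definition block_sites :: "('v set \<times> 'v list \<times> real) list \<Rightarrow> ('v \<times> real) list" where
  "block_sites l = concat (map (\<lambda>(Q, B, t). map (\<lambda>x. (x, t)) B) l)"

lemma prob_crowded_Pi_pmf_superset:
  assumes "finite R" "Q \<subseteq> R"
  shows "measure_pmf.prob (Pi_pmf R 0 p) {e. crowded Q e} = measure_pmf.prob (Pi_pmf Q 0 p) {e. crowded Q e}"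
proof -
  have "crowded Q (\<lambda>x. if x \<in> Q then e x else 0) = crowded Q e" for e
    unfolding crowded_def by (simp cong: sum.cong)
  then show ?thesis
    using assms by (subst (2) Pi_pmf_subset[of R]) (auto simp: vimage_def)
qed

lemma deleted_subset:
  assumes "\<And>Q B t. (Q, B, t) \<in> set l \<Longrightarrow> crowded Q e \<Longrightarrow> crowded Q e' \<or> set B \<subseteq> A"
  shows "A \<union> deleted l e \<subseteq> A \<union> deleted l e'"
proof
  fix x assume x: "x \<in> A \<union> deleted l e"
  show "x \<in> A \<union> deleted l e'"
  proof (cases "x \<in> A")
    case False
    then obtain Q B t where "(Q, B, t) \<in> set l" "crowded Q e" "x \<in> set B"
      using x by (auto simp: deleted_def)
    then show ?thesis using assms[of Q B t] by (auto simp: deleted_def)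
  qed simp
qed

text \<open>
  The blocks are explored from large to small.  As long as a block is not crowded, only a decreasing
  event is revealed, which by Harris' inequality makes later blocks less likely to be crowded; if it
  is crowded, all its sites are revealed, and the later blocks inside of it do not matter any more.
\<close>

lemma deleted_dominated:
  fixes \<phi> :: "'v set \<Rightarrow> real" and p :: "'v \<Rightarrow> nat pmf"
  assumes phi: "antimono \<phi>" "\<And>F. 0 \<le> \<phi> F \<and> \<phi> F \<le> 1" and s: "0 \<le> s" "s \<le> 1"
    and R: "finite R"
    and l: "\<And>Q B t. (Q, B, t) \<in> set l \<Longrightarrow> Q \<noteq> {} \<and> (Q \<subseteq> R \<or> Q \<inter> R = {}) \<and> set B \<subseteq> set xs
        \<and> 0 \<le> t \<and> t \<le> 1 - s \<and> measure_pmf.prob (Pi_pmf Q 0 p) {e. crowded Q e} \<le> t * s ^ length B"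
    and fin: "\<And>Q B t. (Q, B, t) \<in> set l \<Longrightarrow> finite Q"
    and sorted: "sorted_wrt (\<lambda>(Q, B, t) (Q', B', t'). Q \<inter> Q' = {} \<or> Q' \<subseteq> Q \<and> set B' \<subseteq> set B) l"
    and H: "\<And>e e'. e \<in> H \<Longrightarrow> e' \<le> e \<Longrightarrow> e' \<in> H"
  shows "measure_pmf.prob (Pi_pmf R 0 p) H
        * close_sites (block_sites l @ map (\<lambda>x. (x, s)) xs) \<phi> D
      \<le> measure_pmf.expectation (Pi_pmf R 0 p) (\<lambda>e. indicator H e * \<phi> (D \<union> deleted l e))"
  using R l fin sorted H
proof (induction l arbitrary: R H D)
  case Nil
  have "close_sites (map (\<lambda>x. (x, s)) xs) \<phi> D \<le> \<phi> D"
    by (rule close_sites_le) (use phi s in auto)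
  then show ?case
    by (auto simp: block_sites_def intro!: mult_left_mono)
next
  case (Cons z l)
  obtain Q B t where z: "z = (Q, B, t)" by (cases z) auto
  let ?E = "\<lambda>R. measure_pmf.expectation (Pi_pmf R 0 p)" and ?P = "\<lambda>R. measure_pmf.prob (Pi_pmf R 0 p)"
  let ?G = "close_sites (block_sites l @ map (\<lambda>x. (x, s)) xs) \<phi>"
  have pl: "prob_list (block_sites l @ map (\<lambda>x. (x, s)) xs)"
    using Cons.prems(2) s by (fastforce simp: block_sites_def)
  have antiG: "antimono ?G" by (rule close_sites_antimono[OF phi(1) pl])
  have step: "close_sites (block_sites (z # l) @ map (\<lambda>x. (x, s)) xs) \<phi> D
      = close_sites (map (\<lambda>x. (x, t)) B) ?G D"
    by (simp add: z block_sites_def close_sites_append)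
  have QB: "Q \<noteq> {}" "Q \<subseteq> R \<or> Q \<inter> R = {}" "set B \<subseteq> set xs" "0 \<le> t" "t \<le> 1 - s"
    "?P Q {e. crowded Q e} \<le> t * s ^ length B" "finite Q"
    using Cons.prems(2,3)[of Q B t] z by auto
  have lprems: "Q' \<noteq> {} \<and> (Q' \<subseteq> R \<or> Q' \<inter> R = {}) \<and> set B' \<subseteq> set xs \<and> 0 \<le> t' \<and> t' \<le> 1 - s
      \<and> ?P Q' {e. crowded Q' e} \<le> t' * s ^ length B'" "finite Q'" if "(Q', B', t') \<in> set l" for Q' B' t'
    using Cons.prems(2,3)[of Q' B' t'] that by auto
  have sl: "sorted_wrt (\<lambda>(Q, B, t) (Q', B', t'). Q \<inter> Q' = {} \<or> Q' \<subseteq> Q \<and> set B' \<subseteq> set B) l"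
    using Cons.prems(4) by simp
  have l': "\<And>Q' B' t'. (Q', B', t') \<in> set l \<Longrightarrow> Q \<inter> Q' = {} \<or> Q' \<subseteq> Q \<and> set B' \<subseteq> set B"
    using Cons.prems(4) z by fastforce
  have phi01: "0 \<le> indicator H' e * \<phi> F \<and> indicator H' e * \<phi> F \<le> 1" for H' :: "('v \<Rightarrow> nat) set" and F e
    using phi(2) by (auto simp: indicator_def)
  show ?case
  proof (cases "Q \<subseteq> R")
    case False
    then have QR: "Q \<inter> R = {}" using QB by auto
    \<comment> \<open>\<open>Pi_pmf R\<close> puts the default \<open>0\<close> outside of
      \<open>R\<close>, and a nonempty block needs positive excess to be crowded.\<close>
    have nc: "\<not> crowded Q e" if "e \<in> set_pmf (Pi_pmf R 0 p)" for e
    proof -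
      have "e x = 0" if "x \<in> Q" for x
        using set_Pi_pmf_subset[OF Cons.prems(1), of 0 p] \<open>e \<in> _\<close> that QR by auto
      then have "sum e Q = 0" by simp
      then show ?thesis using QB by (simp add: crowded_def card_gt_0_iff)
    qed
    have "?P R H * close_sites (map (\<lambda>x. (x, t)) B) ?G D \<le> ?P R H * ?G D"
      using QB s by (intro mult_left_mono close_sites_le antiG) auto
    also have "\<dots> \<le> ?E R (\<lambda>e. indicator H e * \<phi> (D \<union> deleted l e))"
      by (rule Cons.IH[OF Cons.prems(1) lprems sl Cons.prems(5)])
    also have "\<dots> = ?E R (\<lambda>e. indicator H e * \<phi> (D \<union> deleted (z # l) e))"
      by (intro integral_cong_AE) (auto simp: AE_measure_pmf_iff z deleted_Cons nc)
    finally show ?thesis unfolding step .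
  next
    case True
    define C where "C = {e. crowded Q e}"
    have C_up: "e' \<in> C" if "e \<in> C" "e \<le> e'" for e e'
      using that sum_mono[of Q e e'] unfolding C_def crowded_def by (auto simp: le_fun_def)
    let ?f1 = "\<lambda>e. indicator (H - C) e * \<phi> (D \<union> deleted l e)"
    let ?f2 = "\<lambda>e. indicator (H \<inter> C) e * \<phi> (D \<union> set B \<union> deleted l e)"
    \<comment> \<open>Off \<open>C\<close> the block is not crowded and \<open>H - C\<close> is
      still decreasing; on \<open>C\<close> the sites of \<open>B\<close> are deleted
      outright.\<close>
    have split: "?E R (\<lambda>e. indicator H e * \<phi> (D \<union> deleted (z # l) e)) = ?E R ?f1 + ?E R ?f2"
    proof -
      have "(\<lambda>e. indicator H e * \<phi> (D \<union> deleted (z # l) e)) = (\<lambda>e. ?f1 e + ?f2 e)"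
        by (auto simp: fun_eq_iff indicator_def z deleted_Cons C_def Un_assoc)
      then show ?thesis
        by (simp only:) (intro Bochner_Integration.integral_add integrable_unit_pmf phi01)
    qed
    have 1: "?P R (H - C) * ?G D \<le> ?E R ?f1"
      by (rule Cons.IH[OF Cons.prems(1) lprems sl]) (use Cons.prems(5) C_up in auto)
    have 2: "?P R (H \<inter> C) * ?G (D \<union> set B) \<le> ?E R ?f2"
    proof -
      let ?c = "\<lambda>g h x. if x \<in> Q then g x else h x"
      have R: "R = Q \<union> (R - Q)" "finite (R - Q)" "Q \<inter> (R - Q) = {}"
        using True Cons.prems(1) by auto
      have cC: "?c g h \<in> C \<longleftrightarrow> g \<in> C" for g h
        by (simp add: C_def crowded_def)
      \<comment> \<open>Blocks disjoint from \<open>Q\<close> do not see \<open>g\<close>; the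
        remaining ones lie inside \<open>Q\<close> and delete only sites of \<open>B\<close>, which
        are deleted anyway.\<close>
      have del: "set B \<union> deleted l (?c g h) = set B \<union> deleted l h" for g h
      proof -
        have "crowded Q' (?c g h) = crowded Q' h" if "Q \<inter> Q' = {}" for Q'
        proof -
          have "sum (?c g h) Q' = sum h Q'" using that by (intro sum.cong) auto
          then show ?thesis by (simp add: crowded_def)
        qed
        then have "crowded Q' (?c g h) = crowded Q' h \<or> set B' \<subseteq> set B" if "(Q', B', t') \<in> set l" for Q' B' t'
          using l'[OF that] by blast
        then show ?thesis
          by (intro equalityI deleted_subset) blast+
      qed
      have "?P R (H \<inter> C) = ?E R (indicator (H \<inter> C))" by simp
      also have "\<dots> = ?E Q (\<lambda>g. ?E (R - Q) (\<lambda>h. indicator (H \<inter> C) (?c g h)))"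
        by (subst R(1), rule expectation_Pi_pmf_union) (use QB R(2,3) in \<open>auto simp: indicator_def\<close>)
      also have "\<dots> = ?E Q (\<lambda>g. indicator C g * ?P (R - Q) {h. ?c g h \<in> H})"
      proof -
        have "?E (R - Q) (\<lambda>h. indicator (H \<inter> C) (?c g h)) = indicator C g * ?P (R - Q) {h. ?c g h \<in> H}" for g
        proof -
          have "(\<lambda>h. indicator (H \<inter> C) (?c g h)) = (\<lambda>h. indicator C g * indicator {h. ?c g h \<in> H} h :: real)"
            by (auto simp: fun_eq_iff indicator_def cC)
          then show ?thesis by (simp only:) simp
        qed
        then show ?thesis by simp
      qed
      finally have P: "?P R (H \<inter> C) = ?E Q (\<lambda>g. indicator C g * ?P (R - Q) {h. ?c g h \<in> H})" .
      have G01: "0 \<le> ?G F \<and> ?G F \<le> 1" for F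
        by (rule close_sites_bounds[OF phi(2) pl])
      have "?P R (H \<inter> C) * ?G (D \<union> set B)
          = ?E Q (\<lambda>g. indicator C g * (?P (R - Q) {h. ?c g h \<in> H} * ?G (D \<union> set B)))"
        unfolding P by (subst Bochner_Integration.integral_mult_left_zero[symmetric]) (simp add: mult.assoc)
      also have "\<dots> \<le> ?E Q (\<lambda>g. indicator C g * ?E (R - Q)
          (\<lambda>h. indicator {h. ?c g h \<in> H} h * \<phi> (D \<union> set B \<union> deleted l h)))"
      proof (rule expectation_mono_unit)
        fix g
        \<comment> \<open>Once \<open>g\<close> is fixed on \<open>Q\<close>, what is left of
          \<open>H\<close> is a decreasing event for the values on \<open>R - Q\<close>, so the
          induction hypothesis applies with \<open>D \<union> set B\<close> as closed set.\<close>
        have "?P (R - Q) {h. ?c g h \<in> H} * ?G (D \<union> set B) \<le> ?E (R - Q)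
          (\<lambda>h. indicator {h. ?c g h \<in> H} h * \<phi> (D \<union> set B \<union> deleted l h))"
        proof (rule Cons.IH)
          show "Q' \<noteq> {} \<and> (Q' \<subseteq> R - Q \<or> Q' \<inter> (R - Q) = {}) \<and> set B' \<subseteq> set xs \<and> 0 \<le> t' \<and> t' \<le> 1 - s
            \<and> ?P Q' {e. crowded Q' e} \<le> t' * s ^ length B'" if "(Q', B', t') \<in> set l" for Q' B' t'
            using that lprems(1)[of Q' B' t'] l'[of Q' B' t'] by auto
          show "e' \<in> {h. ?c g h \<in> H}" if "e \<in> {h. ?c g h \<in> H}" "e' \<le> e" for e e'
            using that Cons.prems(5)[of "?c g e" "?c g e'"] by (auto simp: le_fun_def)
        qed (use lprems(2) sl R(2) in blast)+
        then show "indicator C g * (?P (R - Q) {h. ?c g h \<in> H} * ?G (D \<union> set B))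
          \<le> indicator C g * ?E (R - Q) (\<lambda>h. indicator {h. ?c g h \<in> H} h * \<phi> (D \<union> set B \<union> deleted l h))"
          by (rule mult_left_mono) simp
        show "0 \<le> indicator C g * (?P (R - Q) {h. ?c g h \<in> H} * ?G (D \<union> set B)) \<and>
            indicator C g * (?P (R - Q) {h. ?c g h \<in> H} * ?G (D \<union> set B)) \<le> 1"
          using G01 by (auto simp: indicator_def intro!: mult_le_one)
        show "0 \<le> indicator C g * ?E (R - Q) (\<lambda>h. indicator {h. ?c g h \<in> H} h * \<phi> (D \<union> set B \<union> deleted l h)) \<and>
            indicator C g * ?E (R - Q) (\<lambda>h. indicator {h. ?c g h \<in> H} h * \<phi> (D \<union> set B \<union> deleted l h)) \<le> 1"
          using expectation_unit[of "\<lambda>h. indicator {h. ?c g h \<in> H} h * \<phi> (D \<union> set B \<union> deleted l h)"] phi01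
          by (auto simp: indicator_def)
      qed
      also have "\<dots> = ?E Q (\<lambda>g. ?E (R - Q) (\<lambda>h. ?f2 (?c g h)))"
      proof -
        have "indicator C g * (indicator {h. ?c g h \<in> H} h * \<phi> (D \<union> set B \<union> deleted l h)) = ?f2 (?c g h)" for g h
          using del[of g h] by (auto simp: indicator_def cC Un_assoc)
        then show ?thesis
          by (simp flip: Bochner_Integration.integral_mult_right_zero)
      qed
      also have "\<dots> = ?E R ?f2"
        by (subst (2) R(1), rule expectation_Pi_pmf_union[symmetric]) (use QB R(2,3) phi01 in auto)
      finally show ?thesis .
    qed
    have "?P R (H \<inter> C) = ?E R (\<lambda>e. indicator C e * indicator H e)"
      by (simp add: indicator_inter_arith[symmetric] Int_commute)
    also have "\<dots> \<le> ?E R (indicator C) * ?E R (indicator H)"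
      using C_up Cons.prems(1,5)
      by (intro harris_Pi_pmf monoI antimonoI) (auto simp: indicator_def)
    also have "\<dots> = ?P R H * ?P Q C"
      using prob_crowded_Pi_pmf_superset[OF Cons.prems(1) True] by (simp add: C_def)
    finally have 3: "?P R (H \<inter> C) \<le> ?P R H * ?P Q C" .
    have 4: "?P R (H - C) = ?P R H - ?P R (H \<inter> C)"
      by (simp add: measure_pmf.finite_measure_Diff')
    have 5: "?G (D \<union> set B) \<le> ?G D" using antiG by (auto intro: antimonoD)
    \<comment> \<open>The independent closings of \<open>B\<close> are traded for one closing of the
      whole block with its crowding probability; the background closings at rate \<open>s\<close>
      inside \<open>?G\<close> supply the influence.\<close>
    have "?P R H * close_sites (map (\<lambda>x. (x, t)) B) ?G D
       \<le> ?P R H * ((1 - ?P Q C) * ?G D + ?P Q C * ?G (D \<union> set B))"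
    proof (intro mult_left_mono close_block[where s = s] antiG)
      show "influence s y ?G" if "y \<in> set B" for y
        using that QB s pl by (intro influence_close_sites phi) auto
    qed (use QB s in \<open>auto simp: C_def\<close>)
    also have "\<dots> = ?P R H * ?G D - ?P R H * ?P Q C * (?G D - ?G (D \<union> set B))"
      by (simp add: algebra_simps)
    also have "\<dots> \<le> ?P R H * ?G D - ?P R (H \<inter> C) * (?G D - ?G (D \<union> set B))"
      using 3 5 by (intro diff_left_mono mult_right_mono) auto
    also have "\<dots> = ?P R (H - C) * ?G D + ?P R (H \<inter> C) * ?G (D \<union> set B)"
      unfolding 4 by (simp add: algebra_simps)
    also have "\<dots> \<le> ?E R (\<lambda>e. indicator H e * \<phi> (D \<union> deleted (z # l) e))"
      unfolding split using 1 2 by (rule add_mono)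
    finally show ?thesis unfolding step .
  qed
qed

text \<open>\<open>c\<close> is the conditional probability of \<open>N y = 0\<close> given that the
  excess vanishes. A site with positive excess is not empty, and closing it does not change
  \<open>H\<close>, so the closing at rate \<open>c\<close> may be applied to all sites regardless
  of the excesses.\<close>

lemma decouple_closed:
  fixes \<nu> :: "nat pmf" and H :: "'v set \<Rightarrow> ('v \<Rightarrow> nat) \<Rightarrow> real"
  assumes "distinct xs" and H01: "\<And>F e. 0 \<le> H F e \<and> H F e \<le> 1"
    and ex: "ex 0 = (0::nat)" and c: "0 \<le> c" "c \<le> 1" "c * measure_pmf.prob \<nu> {k. ex k = 0} = pmf \<nu> 0"
    and H: "\<And>F e y. y \<in> set xs \<Longrightarrow> e y > 0 \<Longrightarrow> e y \<in> range ex \<Longrightarrow> H (insert y F) e = H F e"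
  shows "measure_pmf.expectation (Pi_pmf (set xs) 0 (\<lambda>_. \<nu>))
           (\<lambda>N. H (F \<union> {y\<in>set xs. N y = 0}) (\<lambda>y. ex (N y)))
       = measure_pmf.expectation (Pi_pmf (set xs) 0 (\<lambda>_. map_pmf ex \<nu>))
           (\<lambda>e. close_sites (map (\<lambda>y. (y, c)) xs) (\<lambda>F. H F e) F)"
  using assms(1,2) H
proof (induction xs arbitrary: H F)
  case Nil
  show ?case by (simp add: ex)
next
  case (Cons x xs)
  let ?l = "map (\<lambda>y. (y, c)) xs"
  let ?E = "measure_pmf.expectation (Pi_pmf (set xs) 0 (\<lambda>_. \<nu>))"
  let ?E' = "measure_pmf.expectation (Pi_pmf (set xs) 0 (\<lambda>_. map_pmf ex \<nu>))"
  have x: "x \<notin> set xs" "distinct xs" using Cons.prems by auto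
  define \<Psi> where "\<Psi> G j = ?E' (\<lambda>e. close_sites ?l (\<lambda>F. H F (e(x := j))) G)" for G j
  have cl01: "0 \<le> close_sites ?l (\<lambda>F. H F e) G \<and> close_sites ?l (\<lambda>F. H F e) G \<le> 1" for e G
    using c Cons.prems(2) by (intro close_sites_bounds) auto
  have Psi01: "0 \<le> \<Psi> G j \<and> \<Psi> G j \<le> 1" for G j
    unfolding \<Psi>_def by (rule expectation_unit) (rule cl01)
  have Psi_pos: "\<Psi> (insert x G) j = \<Psi> G j" if "j > 0" "j \<in> range ex" for G j
  proof -
    have "close_sites ?l (\<lambda>F. H F e) (insert x G) = close_sites ?l (\<lambda>F. H F e) G" if "e x > 0" "e x \<in> range ex" for e
      using close_sites_shift[of ?l "\<lambda>F. H F e" "{x}" G] Cons.prems(3)[of x e] that by simp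
    then show ?thesis unfolding \<Psi>_def using that by simp
  qed
  define \<Delta> where "\<Delta> = \<Psi> (insert x F) 0 - \<Psi> F 0"
  have int: "integrable (measure_pmf \<nu>) (\<lambda>k. \<Psi> F (ex k))"
    by (rule integrable_unit_pmf) (rule Psi01)
  have "measure_pmf.expectation (Pi_pmf (set (x # xs)) 0 (\<lambda>_. \<nu>))
           (\<lambda>N. H (F \<union> {y\<in>set (x # xs). N y = 0}) (\<lambda>y. ex (N y)))
      = measure_pmf.expectation \<nu> (\<lambda>k. ?E (\<lambda>N. H (F \<union> {y\<in>set (x # xs). (N(x := k)) y = 0})
            (\<lambda>y. ex ((N(x := k)) y))))"
    unfolding list.set by (rule expectation_Pi_pmf_insert) (use x Cons.prems(2) in auto)
  also have "\<dots> = measure_pmf.expectation \<nu> (\<lambda>k. \<Psi> (if k = 0 then insert x F else F) (ex k))"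
  proof (rule Bochner_Integration.integral_cong[OF refl])
    fix k
    have "?E (\<lambda>N. H (F \<union> {y\<in>set (x # xs). (N(x := k)) y = 0}) (\<lambda>y. ex ((N(x := k)) y)))
        = ?E (\<lambda>N. H ((if k = 0 then insert x F else F) \<union> {y\<in>set xs. N y = 0}) ((\<lambda>y. ex (N y))(x := ex k)))"
    proof -
      have "F \<union> {y\<in>set (x # xs). (N(x := k)) y = 0} = (if k = 0 then insert x F else F) \<union> {y\<in>set xs. N y = 0}"
        "(\<lambda>y. ex ((N(x := k)) y)) = (\<lambda>y. ex (N y))(x := ex k)" for N
        using x by (auto simp: fun_eq_iff)
      then show ?thesis by simp
    qed
    also have "\<dots> = \<Psi> (if k = 0 then insert x F else F) (ex k)"
      unfolding \<Psi>_def
    proof (rule Cons.IH[of "\<lambda>F e. H F (e(x := ex k))"])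
      show "H (insert y G) (e(x := ex k)) = H G (e(x := ex k))"
        if "y \<in> set xs" "e y > 0" "e y \<in> range ex" for G e y
        using that x by (intro Cons.prems(3)) auto
    qed (use x Cons.prems(2) in auto)
    finally show "?E (\<lambda>N. H (F \<union> {y\<in>set (x # xs). (N(x := k)) y = 0}) (\<lambda>y. ex ((N(x := k)) y)))
      = \<Psi> (if k = 0 then insert x F else F) (ex k)" .
  qed
  \<comment> \<open>Closing \<open>x\<close> occurs only for \<open>k = 0\<close>, so its effect is
    \<open>\<Delta>\<close> with weight \<open>pmf \<nu> 0\<close>; the choice of \<open>c\<close>
    spreads this weight over all \<open>k\<close> with \<open>ex k = 0\<close>.\<close>
  also have "(\<lambda>k. \<Psi> (if k = 0 then insert x F else F) (ex k)) = (\<lambda>k. \<Psi> F (ex k) + indicator {0} k * \<Delta>)"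
    by (auto simp: fun_eq_iff \<Delta>_def ex)
  also have "measure_pmf.expectation \<nu> (\<lambda>k. \<Psi> F (ex k) + indicator {0} k * \<Delta>)
      = measure_pmf.expectation \<nu> (\<lambda>k. \<Psi> F (ex k)) + pmf \<nu> 0 * \<Delta>"
    using int integrable_unit_pmf[of "indicator {0}" \<nu>] by (subst Bochner_Integration.integral_add) (auto simp: pmf.rep_eq)
  also have "\<dots> = measure_pmf.expectation \<nu> (\<lambda>k. \<Psi> F (ex k)) + measure_pmf.prob \<nu> {k. ex k = 0} * (c * \<Delta>)"
    unfolding c(3)[symmetric] by simp
  also have "\<dots> = measure_pmf.expectation \<nu> (\<lambda>k. \<Psi> F (ex k) + indicator {k. ex k = 0} k * (c * \<Delta>))"
    using int integrable_unit_pmf[of "indicator {k. ex k = 0}" \<nu>] by (subst Bochner_Integration.integral_add) auto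
  also have "(\<lambda>k. \<Psi> F (ex k) + indicator {k. ex k = 0} k * (c * \<Delta>))
      = (\<lambda>k. (1 - c) * \<Psi> F (ex k) + c * \<Psi> (insert x F) (ex k))"
    using Psi_pos by (auto simp: fun_eq_iff \<Delta>_def indicator_def algebra_simps)
  also have "measure_pmf.expectation \<nu> (\<lambda>k. (1 - c) * \<Psi> F (ex k) + c * \<Psi> (insert x F) (ex k))
      = measure_pmf.expectation (map_pmf ex \<nu>) (\<lambda>j. (1 - c) * \<Psi> F j + c * \<Psi> (insert x F) j)"
    by simp
  also have "\<dots> = measure_pmf.expectation (map_pmf ex \<nu>)
      (\<lambda>j. ?E' (\<lambda>e. close_sites (map (\<lambda>y. (y, c)) (x # xs)) (\<lambda>F. H F (e(x := j))) F))"
    unfolding \<Psi>_def using cl01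
    by (simp add: close_site_def integrable_unit_pmf)
  also have "\<dots> = measure_pmf.expectation (Pi_pmf (set (x # xs)) 0 (\<lambda>_. map_pmf ex \<nu>))
           (\<lambda>e. close_sites (map (\<lambda>y. (y, c)) (x # xs)) (\<lambda>F. H F e) F)"
    unfolding list.set
    by (rule expectation_Pi_pmf_insert[symmetric]) (use x Cons.prems(2) c in \<open>auto intro!: close_sites_bounds
        simp del: list.map close_sites_Cons\<close>)
  finally show ?case .
qed

lemma open_prob_append: "open_prob (l @ l') x = open_prob l x * open_prob l' x"
  by (simp add: open_prob_def)

lemma open_prob_map: "distinct xs \<Longrightarrow> open_prob (map (\<lambda>y. (y, c)) xs) x = (if x \<in> set xs then 1 - c else 1)"
  by (induction xs) (auto simp: open_prob_def)

text \<open>Three independent sources of closings bound the right-hand side from below: the blocks,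
  the background at rate \<open>s\<close>, and emptiness given the excess at rate \<open>c\<close>.
  Condition \<open>r\<close> says that a site survives all three at least as often as it is occupied
  under \<open>\<nu>'\<close>.\<close>

lemma closed_dominated:
  fixes \<phi> :: "'v set \<Rightarrow> real" and \<nu> \<nu>' :: "nat pmf"
  assumes xs: "distinct xs" and phi: "antimono \<phi>" "\<And>F. 0 \<le> \<phi> F \<and> \<phi> F \<le> 1"
    and s: "0 \<le> s" "s \<le> 1" and ex: "ex 0 = (0::nat)"
    and c: "0 \<le> c" "c \<le> 1" "c * measure_pmf.prob \<nu> {k. ex k = 0} = pmf \<nu> 0"
    and l: "\<And>Q B t. (Q, B, t) \<in> set l \<Longrightarrow> Q \<noteq> {} \<and> Q \<subseteq> set xs \<and> set B \<subseteq> set xs \<and> 0 \<le> t \<and> t \<le> 1 - s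
        \<and> measure_pmf.prob (Pi_pmf Q 0 (\<lambda>_. map_pmf ex \<nu>)) {e. crowded Q e} \<le> t * s ^ length B"
    and sorted: "sorted_wrt (\<lambda>(Q, B, t) (Q', B', t'). Q \<inter> Q' = {} \<or> Q' \<subseteq> Q \<and> set B' \<subseteq> set B) l"
    and single: "\<And>y. y \<in> set xs \<Longrightarrow> \<exists>B t. ({y}, B, t) \<in> set l \<and> y \<in> set B"
    and r: "\<And>x. x \<in> set xs \<Longrightarrow> 1 - pmf \<nu>' 0 \<le> open_prob (block_sites l) x * ((1 - s) * (1 - c))"
  shows "measure_pmf.expectation (Pi_pmf (set xs) 0 (\<lambda>_. \<nu>')) (\<lambda>N. \<phi> {y\<in>set xs. N y = 0})
      \<le> measure_pmf.expectation (Pi_pmf (set xs) 0 (\<lambda>_. \<nu>))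
          (\<lambda>N. \<phi> ({y\<in>set xs. N y = 0} \<union> deleted l (\<lambda>y. ex (N y))))"
proof -
  let ?c = "map (\<lambda>y. (y, c)) xs" and ?s = "map (\<lambda>y. (y, s)) xs"
  let ?E = "measure_pmf.expectation (Pi_pmf (set xs) 0 (\<lambda>_. map_pmf ex \<nu>))"
  have pl: "prob_list (block_sites l @ ?s @ ?c)"
    using l s c by (fastforce simp: block_sites_def)
  \<comment> \<open>With the excess identically \<open>0\<close>, \<open>decouple_closed\<close> is
    the plain representation of independent sites by \<open>close_sites\<close>.\<close>
  have "measure_pmf.expectation (Pi_pmf (set xs) 0 (\<lambda>_. \<nu>')) (\<lambda>N. \<phi> {y\<in>set xs. N y = 0})
      = close_sites (map (\<lambda>y. (y, pmf \<nu>' 0)) xs) \<phi> {}"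
    using decouple_closed[of xs "\<lambda>F e. \<phi> F" "\<lambda>_. 0" "pmf \<nu>' 0" \<nu>' "{}"]
    using xs phi(2) by (auto simp: pmf_le_1)
  also have "\<dots> \<le> close_sites (block_sites l @ ?s @ ?c) \<phi> {}"
  proof -
    have "close_sites (map (\<lambda>y. (y, 1 - (1 - pmf \<nu>' 0))) xs) \<phi> {} \<le> close_sites (block_sites l @ ?s @ ?c) \<phi> {}"
    proof (rule close_sites_compare[OF phi(1) xs _ pl])
      show "fst ` set (block_sites l @ ?s @ ?c) \<subseteq> set xs"
        using l by (fastforce simp: block_sites_def)
      show "1 - pmf \<nu>' 0 \<le> open_prob (block_sites l @ ?s @ ?c) x" if "x \<in> set xs" for x
        using r[OF that] xs that by (simp add: open_prob_append open_prob_map)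
    qed (simp add: pmf_le_1)
    then show ?thesis by simp
  qed
  also have "\<dots> = close_sites (block_sites l @ ?s) (close_sites ?c \<phi>) {}"
    by (simp add: close_sites_append)
  also have "\<dots> \<le> ?E (\<lambda>e. close_sites ?c \<phi> (deleted l e))"
  proof -
    have "measure_pmf.prob (Pi_pmf (set xs) 0 (\<lambda>_. map_pmf ex \<nu>)) UNIV
          * close_sites (block_sites l @ ?s) (close_sites ?c \<phi>) {}
        \<le> ?E (\<lambda>e. indicator UNIV e * close_sites ?c \<phi> ({} \<union> deleted l e))"
    proof (rule deleted_dominated[OF _ _ s _ _ _ sorted])
      show "antimono (close_sites ?c \<phi>)" using c by (auto intro!: close_sites_antimono phi)
      show "0 \<le> close_sites ?c \<phi> F \<and> close_sites ?c \<phi> F \<le> 1" for F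
        using c phi by (auto intro!: close_sites_bounds)
      show "finite Q" if "(Q, B, t) \<in> set l" for Q B t
        using l[OF that] by (auto intro: finite_subset)
    qed (use l in auto)
    then show ?thesis by simp
  qed
  also have "\<dots> = ?E (\<lambda>e. close_sites ?c (\<lambda>F. \<phi> (F \<union> deleted l e)) {})"
    by (simp add: close_sites_shift)
  also have "\<dots> = measure_pmf.expectation (Pi_pmf (set xs) 0 (\<lambda>_. \<nu>))
          (\<lambda>N. \<phi> (({} \<union> {y\<in>set xs. N y = 0}) \<union> deleted l (\<lambda>y. ex (N y))))"
  proof (rule decouple_closed[OF xs _ ex c, symmetric])
    show "\<phi> (insert y F \<union> deleted l e) = \<phi> (F \<union> deleted l e)" if "y \<in> set xs" "e y > 0" for y F e
    proof -
      \<comment> \<open>A single site is crowded as soon as its excess is positive, and then deletes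
        itself; hence closing it in addition changes nothing.\<close>
      obtain B t where "({y}, B, t) \<in> set l" "y \<in> set B" using single[OF \<open>y \<in> set xs\<close>] by blast
      moreover have "crowded {y} e" using \<open>e y > 0\<close> by (simp add: crowded_def)
      ultimately have "y \<in> deleted l e" by (auto simp: deleted_def)
      then show ?thesis by (simp add: insert_absorb)
    qed
  qed (use phi in auto)
  finally show ?thesis by simp
qed

section \<open>Cells of the integer lattice and dyadic cubes\<close>

definition lattice :: "'a::euclidean_space set" where
  "lattice = {z. \<forall>b\<in>Basis. z \<bullet> b \<in> \<int>}"

text \<open>The index, in the integer lattice, of the half-open cell of side \<open>s\<close> that
  contains \<open>x\<close>. For \<open>s = 2 ^ k\<close> and a lattice point \<open>x\<close> it is
  the index of a dyadic cube of level \<open>k\<close>.\<close>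

definition site :: "real \<Rightarrow> 'a::euclidean_space \<Rightarrow> 'a" where
  "site s x = (\<Sum>b\<in>Basis. real_of_int \<lfloor>x \<bullet> b / s\<rfloor> *\<^sub>R b)"

definition cell :: "real \<Rightarrow> 'a::euclidean_space \<Rightarrow> 'a set" where
  "cell s z = {x. site s x = z}"

lemma site_inner: "b \<in> Basis \<Longrightarrow> site s x \<bullet> b = real_of_int \<lfloor>x \<bullet> b / s\<rfloor>"
  by (simp add: site_def)

lemma site_in_lattice [simp]: "site s x \<in> lattice"
  by (simp add: lattice_def site_inner)

lemma mem_cell: "x \<in> cell s z \<longleftrightarrow> site s x = z"
  by (simp add: cell_def)

lemma lattice_inner: "z \<in> lattice \<Longrightarrow> b \<in> Basis \<Longrightarrow> real_of_int \<lfloor>z \<bullet> b\<rfloor> = z \<bullet> b"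
proof -
  assume "z \<in> lattice" "b \<in> Basis"
  then have "z \<bullet> b \<in> \<int>" by (simp add: lattice_def)
  then obtain i where i: "z \<bullet> b = of_int i" by (rule Ints_cases)
  show ?thesis unfolding i by (simp only: floor_of_int)
qed

lemma lattice_eqI:
  assumes "\<And>b. b \<in> Basis \<Longrightarrow> \<lfloor>x \<bullet> b\<rfloor> = \<lfloor>y \<bullet> b\<rfloor>" "x \<in> lattice" "y \<in> lattice"
  shows "x = (y :: 'a::euclidean_space)"
proof (rule euclidean_eqI)
  fix b :: 'a assume b: "b \<in> Basis"
  have "real_of_int \<lfloor>x \<bullet> b\<rfloor> = real_of_int \<lfloor>y \<bullet> b\<rfloor>"
    using assms(1)[OF b] by (rule arg_cong)
  then show "x \<bullet> b = y \<bullet> b"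
    unfolding lattice_inner[OF assms(2) b] lattice_inner[OF assms(3) b] .
qed

lemma cell_eq:
  assumes "s > 0" "z \<in> lattice"
  shows "cell s z = {x. \<forall>b\<in>Basis. s * (z \<bullet> b) \<le> x \<bullet> b \<and> x \<bullet> b < s * (z \<bullet> b) + s}"
proof -
  have "site s x \<bullet> b = z \<bullet> b \<longleftrightarrow> s * (z \<bullet> b) \<le> x \<bullet> b \<and> x \<bullet> b < s * (z \<bullet> b) + s" if b: "b \<in> Basis" for x b
  proof -
    obtain i where i: "z \<bullet> b = of_int i" using assms b by (auto simp: lattice_def Ints_def)
    show ?thesis using assms b unfolding i site_inner[OF b]
      by (auto simp: floor_eq_iff field_simps)
  qed
  then show ?thesis by (auto simp: cell_def euclidean_eq_iff[where 'a = 'a])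
qed

lemma cell_bounds:
  assumes "s > 0" "z \<in> lattice"
  shows "box (s *\<^sub>R z) (s *\<^sub>R z + s *\<^sub>R One) \<subseteq> cell s z" "cell s z \<subseteq> cbox (s *\<^sub>R z) (s *\<^sub>R z + s *\<^sub>R One)"
proof -
  have *: "(s *\<^sub>R z + s *\<^sub>R One) \<bullet> b = s * (z \<bullet> b) + s" if "b \<in> Basis" for b
    using that by (simp add: inner_add_left)
  show "box (s *\<^sub>R z) (s *\<^sub>R z + s *\<^sub>R One) \<subseteq> cell s z"
  proof
    fix x assume "x \<in> box (s *\<^sub>R z) (s *\<^sub>R z + s *\<^sub>R One)"
    then have "s * (z \<bullet> b) < x \<bullet> b \<and> x \<bullet> b < s * (z \<bullet> b) + s" if "b \<in> Basis" for b
      using that *[OF that] unfolding mem_box by (metis inner_scaleR_left)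
    then show "x \<in> cell s z" unfolding cell_eq[OF assms] by (simp add: less_imp_le)
  qed
  show "cell s z \<subseteq> cbox (s *\<^sub>R z) (s *\<^sub>R z + s *\<^sub>R One)"
  proof
    fix x assume "x \<in> cell s z"
    then have "s * (z \<bullet> b) \<le> x \<bullet> b \<and> x \<bullet> b \<le> s * (z \<bullet> b) + s" if "b \<in> Basis" for b
      using that unfolding cell_eq[OF assms] by (simp add: less_imp_le)
    then show "x \<in> cbox (s *\<^sub>R z) (s *\<^sub>R z + s *\<^sub>R One)"
      unfolding mem_box using * by simp
  qed
qed

lemma bounded_cell: "s > 0 \<Longrightarrow> z \<in> lattice \<Longrightarrow> bounded (cell s z)"
  by (rule bounded_subset[OF bounded_cbox cell_bounds(2)])

lemma borel_cell [measurable]: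
  assumes "s > 0" "z \<in> lattice"
  shows "cell s z \<in> sets borel"
proof -
  have "cell s z = (\<Inter>b\<in>Basis. {x. s * (z \<bullet> b) \<le> x \<bullet> b} \<inter> {x. x \<bullet> b < s * (z \<bullet> b) + s})"
    unfolding cell_eq[OF assms] by auto
  also have "\<dots> \<in> sets borel"
    by (intro sets.countable_INT' countable_finite) auto
  finally show ?thesis .
qed

lemma measure_cell:
  fixes z :: "'a::euclidean_space"
  assumes "s > 0" "z \<in> lattice"
  shows "measure lborel (cell s z) = s ^ DIM('a)"
proof -
  let ?a = "s *\<^sub>R z" and ?b = "s *\<^sub>R z + s *\<^sub>R One"
  have ab: "?a \<bullet> i \<le> ?b \<bullet> i" "(?b - ?a) \<bullet> i = s" if "i \<in> Basis" for i
    using that assms by (auto simp: inner_add_left)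
  have 1: "measure lborel (box ?a ?b) = s ^ DIM('a)" "measure lborel (cbox ?a ?b) = s ^ DIM('a)"
    using ab by (simp_all add: measure_lborel_box_eq measure_lborel_cbox_eq)
  have fm: "cbox ?a ?b \<in> fmeasurable lborel"
    using emeasure_lborel_cbox_finite[of ?a ?b] by (intro fmeasurableI) auto
  then have fm': "cell s z \<in> fmeasurable lborel"
    by (rule fmeasurableI2[OF _ cell_bounds(2)[OF assms]]) (use assms in simp)
  have "measure lborel (box ?a ?b) \<le> measure lborel (cell s z)"
    by (rule measure_mono_fmeasurable[OF cell_bounds(1)[OF assms] _ fm']) simp
  moreover have "measure lborel (cell s z) \<le> measure lborel (cbox ?a ?b)"
    by (rule measure_mono_fmeasurable[OF cell_bounds(2)[OF assms] _ fm]) (use assms in simp)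
  ultimately show ?thesis using 1 by simp
qed

lemma norm_site: 
  fixes x :: "'a::euclidean_space"
  assumes "s > 0"
  shows "norm (x - s *\<^sub>R site s x) \<le> s * DIM('a)"
proof -
  have "norm (x - s *\<^sub>R site s x) \<le> (\<Sum>b\<in>Basis. \<bar>(x - s *\<^sub>R site s x) \<bullet> b\<bar>)"
    by (rule norm_le_l1)
  also have "\<dots> \<le> (\<Sum>b\<in>(Basis :: 'a set). s)"
  proof (rule sum_mono)
    fix b :: 'a assume b: "b \<in> Basis"
    have "s * of_int \<lfloor>x \<bullet> b / s\<rfloor> \<le> s * (x \<bullet> b / s)" "s * (x \<bullet> b / s) \<le> s * (of_int \<lfloor>x \<bullet> b / s\<rfloor> + 1)"
      using assms by (intro mult_left_mono; linarith)+
    then show "\<bar>(x - s *\<^sub>R site s x) \<bullet> b\<bar> \<le> s"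
      using assms b by (simp add: inner_diff_left site_inner algebra_simps abs_le_iff)
  qed
  finally show ?thesis by (simp add: mult.commute)
qed

text \<open>Identifies lattice boxes with products of sets of integers; the sizes of cubes and
  neighbourhoods and the finiteness of windows come from it.\<close>

lemma lattice_image_PiE:
  "bij_betw (\<lambda>z b. if b \<in> Basis then \<lfloor>z \<bullet> b\<rfloor> else undefined)
     {z \<in> lattice. \<forall>b\<in>Basis. \<lfloor>z \<bullet> b\<rfloor> \<in> S b} (PiE (Basis :: 'a::euclidean_space set) S)"
proof (rule bij_betwI[where g = "\<lambda>f. \<Sum>b\<in>Basis. real_of_int (f b) *\<^sub>R b"])
  show "(\<lambda>z b. if b \<in> Basis then \<lfloor>z \<bullet> b\<rfloor> else undefined)
     \<in> {z \<in> lattice. \<forall>b\<in>Basis. \<lfloor>z \<bullet> b\<rfloor> \<in> S b} \<rightarrow> PiE (Basis :: 'a set) S"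
    by auto
  show "(\<lambda>f. \<Sum>b\<in>Basis. real_of_int (f b) *\<^sub>R b)
     \<in> PiE (Basis :: 'a set) S \<rightarrow> {z \<in> lattice. \<forall>b\<in>Basis. \<lfloor>z \<bullet> b\<rfloor> \<in> S b}"
    by (auto simp: lattice_def)
  show "(\<Sum>b\<in>Basis. real_of_int (if b \<in> Basis then \<lfloor>z \<bullet> b\<rfloor> else undefined) *\<^sub>R b) = z"
    if "z \<in> {z \<in> lattice. \<forall>b\<in>Basis. \<lfloor>z \<bullet> b\<rfloor> \<in> S b}" for z :: 'a
    using that by (intro lattice_eqI) (auto simp: lattice_def)
  show "(\<lambda>b. if b \<in> Basis then \<lfloor>(\<Sum>b\<in>Basis. real_of_int (f b) *\<^sub>R b) \<bullet> b\<rfloor> else undefined) = f"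
    if "f \<in> PiE (Basis :: 'a set) S" for f
    using that by (auto simp: fun_eq_iff PiE_def extensional_def)
qed

lemma card_lattice_PiE:
  "card {z \<in> lattice. \<forall>b\<in>Basis. \<lfloor>z \<bullet> b\<rfloor> \<in> S b} = (\<Prod>b\<in>(Basis :: 'a::euclidean_space set). card (S b))"
  using bij_betw_same_card[OF lattice_image_PiE[where 'a = 'a and S = S]] by (simp add: card_PiE)

lemma finite_lattice_PiE:
  assumes "\<And>b. b \<in> Basis \<Longrightarrow> finite (S b)"
  shows "finite {z \<in> lattice. \<forall>b\<in>(Basis :: 'a::euclidean_space set). \<lfloor>z \<bullet> b\<rfloor> \<in> S b}"
  using bij_betw_finite[OF lattice_image_PiE[where 'a = 'a and S = S]] assms by (simp add: finite_PiE)

lemma finite_lattice_cball: "finite (lattice \<inter> cball (0::'a::euclidean_space) r)"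
proof (rule finite_subset)
  show "finite {z \<in> lattice. \<forall>b\<in>(Basis :: 'a set). \<lfloor>z \<bullet> b\<rfloor> \<in> {\<lfloor>-r\<rfloor>..\<lfloor>r\<rfloor>}}"
    by (rule finite_lattice_PiE) auto
  show "lattice \<inter> cball 0 r \<subseteq> {z \<in> lattice. \<forall>b\<in>(Basis :: 'a set). \<lfloor>z \<bullet> b\<rfloor> \<in> {\<lfloor>-r\<rfloor>..\<lfloor>r\<rfloor>}}"
  proof safe
    fix z b :: 'a assume "z \<in> cball 0 r" "b \<in> Basis"
    then have "\<bar>z \<bullet> b\<bar> \<le> r" using Basis_le_norm[of b z] by auto
    then show "\<lfloor>z \<bullet> b\<rfloor> \<in> {\<lfloor>-r\<rfloor>..\<lfloor>r\<rfloor>}" by (auto intro!: floor_mono)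
  qed
qed

lemma countable_lattice: "countable (lattice :: 'a::euclidean_space set)"
proof -
  have "lattice \<subseteq> (\<Union>n::nat. lattice \<inter> cball (0::'a) n)"
    using real_arch_simple by auto
  moreover have "countable (\<Union>n::nat. lattice \<inter> cball (0::'a) n)"
    by (rule countable_UN[OF _ countable_finite[OF finite_lattice_cball]]) simp
  ultimately show ?thesis by (rule countable_subset)
qed

lemma le_div_power2_iff: "(j::int) \<le> i div 2 ^ k \<longleftrightarrow> 2 ^ k * j \<le> i"
proof
  assume "j \<le> i div 2 ^ k"
  then have "2 ^ k * j \<le> 2 ^ k * (i div 2 ^ k)" by simp
  also have "\<dots> \<le> i"
  proof -
    have "0 \<le> i mod 2 ^ k" by simp
    then show ?thesis using mult_div_mod_eq[of "2 ^ k" i] by linarith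
  qed
  finally show "2 ^ k * j \<le> i" .
next
  assume "2 ^ k * j \<le> i"
  then have "2 ^ k * j div 2 ^ k \<le> i div 2 ^ k" by (rule zdiv_mono1) simp
  then show "j \<le> i div 2 ^ k" by simp
qed

lemma div_power2_less_iff: "i div 2 ^ k < (j::int) \<longleftrightarrow> i < 2 ^ k * j"
  unfolding not_le[symmetric] le_div_power2_iff ..

lemma floor_site: "b \<in> Basis \<Longrightarrow> \<lfloor>site (2 ^ k) z \<bullet> b\<rfloor> = \<lfloor>z \<bullet> b\<rfloor> div 2 ^ k"
  using floor_divide_real_eq_div[of "2 ^ k" "z \<bullet> b"] by (simp add: site_inner)

section \<open>Dyadic cubes, neighbourhoods and windows\<close>

definition cube :: "nat \<Rightarrow> 'a::euclidean_space \<Rightarrow> 'a set" where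
  "cube k w = {z \<in> lattice. site (2 ^ k) z = w}"

definition nbhd :: "nat \<Rightarrow> 'a::euclidean_space \<Rightarrow> 'a set" where
  "nbhd k w = {z \<in> lattice. \<forall>b\<in>Basis. \<bar>\<lfloor>site (2 ^ k) z \<bullet> b\<rfloor> - \<lfloor>w \<bullet> b\<rfloor>\<bar> \<le> 1}"

lemma cube_eq: "w \<in> lattice \<Longrightarrow>
    cube k w = {z \<in> lattice. \<forall>b\<in>Basis. \<lfloor>z \<bullet> b\<rfloor> \<in> {2 ^ k * \<lfloor>w \<bullet> b\<rfloor> ..< 2 ^ k * \<lfloor>w \<bullet> b\<rfloor> + 2 ^ k}}"
proof -
  assume w: "w \<in> lattice"
  have "site (2 ^ k) z = w \<longleftrightarrow> (\<forall>b\<in>Basis. \<lfloor>z \<bullet> b\<rfloor> div 2 ^ k = \<lfloor>w \<bullet> b\<rfloor>)" for z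
    using lattice_eqI[OF _ site_in_lattice w, of "2 ^ k" z] by (auto simp: floor_site)
  moreover have "i div 2 ^ k = j \<longleftrightarrow> i \<in> {2 ^ k * j ..< 2 ^ k * j + 2 ^ k}" for i j :: int
    using le_div_power2_iff[of j i k] div_power2_less_iff[of i k "j + 1"]
    by (auto simp: algebra_simps)
  ultimately show ?thesis unfolding cube_def by auto
qed

lemma card_cube: "w \<in> lattice \<Longrightarrow> card (cube k (w :: 'a::euclidean_space)) = 2 ^ (k * DIM('a))"
  unfolding cube_eq card_lattice_PiE by (simp add: nat_power_eq power_mult)

lemma finite_cube: "w \<in> lattice \<Longrightarrow> finite (cube k w)"
  unfolding cube_eq by (rule finite_lattice_PiE) simp

lemma nbhd_eq: "nbhd k w = {z \<in> lattice. \<forall>b\<in>Basis. \<lfloor>z \<bullet> b\<rfloor> \<in> {2 ^ k * (\<lfloor>w \<bullet> b\<rfloor> - 1) ..< 2 ^ k * (\<lfloor>w \<bullet> b\<rfloor> + 2)}}"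
proof -
  have "\<bar>i div 2 ^ k - j\<bar> \<le> 1 \<longleftrightarrow> i \<in> {2 ^ k * (j - 1) ..< 2 ^ k * (j + 2)}" for i j :: int
  proof -
    have "\<bar>i div 2 ^ k - j\<bar> \<le> 1 \<longleftrightarrow> j - 1 \<le> i div 2 ^ k \<and> i div 2 ^ k < j + 2" by auto
    then show ?thesis by (simp add: le_div_power2_iff div_power2_less_iff)
  qed
  then show ?thesis unfolding nbhd_def by (auto simp: floor_site)
qed

lemma card_nbhd: "card (nbhd k (w :: 'a::euclidean_space)) = 3 ^ DIM('a) * 2 ^ (k * DIM('a))"
proof -
  have "nat (2 ^ k * (j + 2) - 2 ^ k * (j - 1)) = 3 * 2 ^ k" for j :: int
    by (simp add: algebra_simps nat_mult_distrib nat_power_eq)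
  then show ?thesis
    unfolding nbhd_eq card_lattice_PiE by (simp add: power_mult_distrib power_mult)
qed

lemma finite_nbhd: "finite (nbhd k w)"
  unfolding nbhd_eq by (rule finite_lattice_PiE) simp

lemma site_mono_scale:
  assumes "site (2 ^ k) y = site (2 ^ k) z" "k \<le> k'"
  shows "site (2 ^ k') y = site (2 ^ k') z"
proof (rule lattice_eqI)
  obtain j where j: "k' = k + j" using assms(2) by (auto simp: le_iff_add)
  fix b :: 'a assume b: "b \<in> Basis"
  have "\<lfloor>y \<bullet> b\<rfloor> div 2 ^ k = \<lfloor>z \<bullet> b\<rfloor> div 2 ^ k" using assms(1) floor_site[OF b] by metis
  then show "\<lfloor>site (2 ^ k') y \<bullet> b\<rfloor> = \<lfloor>site (2 ^ k') z \<bullet> b\<rfloor>"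
    unfolding j floor_site[OF b] by (simp add: power_add zdiv_zmult2_eq)
qed auto

text \<open>Integer division by \<open>2 ^ j\<close> keeps indices that differ by at most one within
  one of each other, so neighbourhoods are nested along with the cubes. Deleting a large cube thus
  covers the deletions of its subcubes, as the exploration demands.\<close>

lemma cube_nested:
  assumes "k \<le> k'" "cube k w \<inter> cube k' w' \<noteq> {}" "w \<in> lattice" "w' \<in> lattice"
  shows "cube k w \<subseteq> cube k' w'" "nbhd k w \<subseteq> nbhd k' w'"
proof -
  obtain z where z: "z \<in> lattice" "site (2 ^ k) z = w" "site (2 ^ k') z = w'"
    using assms(2) by (auto simp: cube_def)
  obtain j where j: "k' = k + j" using assms(1) by (auto simp: le_iff_add)
  show "cube k w \<subseteq> cube k' w'"
    using z site_mono_scale[OF _ assms(1)] by (auto simp: cube_def)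
  have *: "\<bar>a div 2 ^ (k + j) - c div 2 ^ (k + j)\<bar> \<le> 1" if "\<bar>a div 2 ^ k - c div 2 ^ k\<bar> \<le> 1" for a c :: int
  proof -
    have "\<bar>p div 2 ^ j - q div 2 ^ j\<bar> \<le> 1" if "\<bar>p - q\<bar> \<le> 1" for p q :: int
    proof -
      have "p div 2 ^ j \<le> (q + 2 ^ j) div 2 ^ j" "q div 2 ^ j \<le> (p + 2 ^ j) div 2 ^ j"
        using that by (intro zdiv_mono1; simp; smt (verit) one_le_power)+
      then show ?thesis by simp
    qed
    from this[OF that] show ?thesis by (simp add: power_add zdiv_zmult2_eq)
  qed
  show "nbhd k w \<subseteq> nbhd k' w'"
    unfolding nbhd_def z(2,3)[symmetric] using * by (auto simp: floor_site j)
qed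

lemma nbhd_sym: "z \<in> lattice \<Longrightarrow> y \<in> lattice \<Longrightarrow> y \<in> nbhd k (site (2 ^ k) z) \<longleftrightarrow> z \<in> nbhd k (site (2 ^ k) y)"
  by (auto simp: nbhd_def abs_minus_commute)

text \<open>Outside of the neighbourhood, the indices differ by at least two in some coordinate, so
  the points are separated by the full side of a cube.\<close>

lemma norm_not_nbhd:
  fixes y z :: "'a::euclidean_space"
  assumes "y \<in> lattice" "y \<notin> nbhd k (site (2 ^ k) z)"
  shows "2 ^ k \<le> norm (y - z)"
proof -
  obtain b :: 'a where b: "b \<in> Basis" "\<bar>\<lfloor>site (2 ^ k) y \<bullet> b\<rfloor> - \<lfloor>site (2 ^ k) z \<bullet> b\<rfloor>\<bar> > 1"
    using assms by (force simp: nbhd_def)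
  have "\<bar>y \<bullet> b / 2 ^ k - z \<bullet> b / 2 ^ k\<bar> \<ge> 1"
    using b by (simp add: site_inner) linarith
  then have "2 ^ k \<le> \<bar>(y - z) \<bullet> b\<bar>"
    by (simp add: inner_diff_left diff_divide_distrib[symmetric] abs_divide field_simps)
  also have "\<dots> \<le> norm (y - z)" by (rule Basis_le_norm[OF b(1)])
  finally show ?thesis .
qed

text \<open>The cubes of level \<open>K\<close> that meet at the origin, one in each orthant. A
  window is a union of dyadic cubes of every level up to \<open>K\<close>, is covered by the
  neighbourhood of each of its cubes of level \<open>K\<close>, and exhausts the lattice as
  \<open>K\<close> grows, which a single growing dyadic cube would not.\<close>

definition window :: "nat \<Rightarrow> 'a::euclidean_space set" where
  "window K = {z \<in> lattice. \<forall>b\<in>Basis. \<lfloor>site (2 ^ K) z \<bullet> b\<rfloor> \<in> {-1, 0}}"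

lemma window_eq: "window K = {z \<in> lattice. \<forall>b\<in>Basis. \<lfloor>z \<bullet> b\<rfloor> \<in> {- (2 ^ K) ..< 2 ^ K}}"
proof -
  have "i div 2 ^ K \<in> {-1, 0} \<longleftrightarrow> i \<in> {- (2 ^ K) ..< 2 ^ K}" for i :: int
  proof -
    have "i div 2 ^ K \<in> {-1, 0} \<longleftrightarrow> -1 \<le> i div 2 ^ K \<and> i div 2 ^ K < 1" by auto
    then show ?thesis by (auto simp: le_div_power2_iff div_power2_less_iff)
  qed
  then show ?thesis unfolding window_def by (auto simp: floor_site)
qed

lemma finite_window: "finite (window K)"
  unfolding window_eq by (rule finite_lattice_PiE) simp

lemma window_subset_lattice: "window K \<subseteq> lattice"
  by (auto simp: window_def)

lemma cube_subset_window: "z \<in> window K \<Longrightarrow> k \<le> K \<Longrightarrow> cube k (site (2 ^ k) z) \<subseteq> window K"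
proof
  fix y assume z: "z \<in> window K" "k \<le> K" and y: "y \<in> cube k (site (2 ^ k) z)"
  from y have "site (2 ^ K) y = site (2 ^ K) z" by (intro site_mono_scale[OF _ z(2)]) (simp add: cube_def)
  then show "y \<in> window K" using y z(1) by (simp add: window_def cube_def)
qed

lemma window_subset_nbhd: "z \<in> window K \<Longrightarrow> window K \<subseteq> nbhd K (site (2 ^ K) (z :: 'a::euclidean_space))"
proof
  fix y :: 'a assume z: "z \<in> window K" and y: "y \<in> window K"
  have *: "\<bar>i - j\<bar> \<le> 1" if "i \<in> {-1, 0}" "j \<in> {-1, 0}" for i j :: int using that by auto
  show "y \<in> nbhd K (site (2 ^ K) z)"
    using y z unfolding nbhd_def window_def by (blast intro: *)
qed

lemma window_mono: "K \<le> K' \<Longrightarrow> window K \<subseteq> window K'"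
proof -
  assume "K \<le> K'"
  then have "(2::int) ^ K \<le> 2 ^ K'" by simp
  moreover have "i \<in> {- a..<a} \<Longrightarrow> a \<le> c \<Longrightarrow> i \<in> {- c..<c}" for i a c :: int by auto
  ultimately show ?thesis unfolding window_eq by blast
qed

lemma cball_subset_window:
  obtains K0 where "\<And>K. K0 \<le> K \<Longrightarrow> lattice \<inter> cball 0 r \<subseteq> window K"
proof -
  obtain K0 :: nat where K0: "r < 2 ^ K0" using real_arch_pow[of 2 r] by auto
  have "lattice \<inter> cball (0::'a) r \<subseteq> window K0"
  proof
    fix z :: 'a assume z: "z \<in> lattice \<inter> cball 0 r"
    have "\<lfloor>z \<bullet> b\<rfloor> \<in> {- (2 ^ K0) ..< 2 ^ K0}" if "b \<in> Basis" for b
    proof -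
      have "\<bar>z \<bullet> b\<bar> < 2 ^ K0" using z Basis_le_norm[OF that, of z] K0 by auto
      then show ?thesis by (auto simp: le_floor_iff floor_less_iff)
    qed
    then show "z \<in> window K0" using z unfolding window_eq by auto
  qed
  then show ?thesis using window_mono that by blast
qed

section \<open>Interference outside of the crowded blocks\<close>

definition list_of :: "'b set \<Rightarrow> 'b list" where
  "list_of S = (SOME xs. set xs = S \<and> distinct xs)"

lemma list_of: "finite S \<Longrightarrow> set (list_of S) = S" "finite S \<Longrightarrow> distinct (list_of S)"
  using someI_ex[OF finite_distinct_list[of S]] by (auto simp: list_of_def)

text \<open>A site lies in the neighbourhoods of at most \<open>3 ^ DIM('a)\<close> cubes of one
  level, so level \<open>k\<close> closes it with total rate at most \<open>s / 2 ^ (k + 1)\<close>,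
  and all levels together with rate at most \<open>s\<close>.\<close>

definition level :: "nat \<Rightarrow> real \<Rightarrow> nat \<Rightarrow> ('a::euclidean_space set \<times> 'a list \<times> real) list" where
  "level K s k = map (\<lambda>w. (cube k w, list_of (nbhd k w \<inter> window K), s / (3 ^ DIM('a) * 2 ^ (k + 1))))
     (list_of (site (2 ^ k) ` window K))"

text \<open>Coarse levels come first, in the order in which the exploration must test them.\<close>

fun levels :: "nat \<Rightarrow> real \<Rightarrow> nat \<Rightarrow> ('a::euclidean_space set \<times> 'a list \<times> real) list" where
  "levels K s 0 = level K s 0"
| "levels K s (Suc k) = level K s (Suc k) @ levels K s k"

lemma set_level:
  "(Q, B, t) \<in> set (level K s k :: ('a::euclidean_space set \<times> _) list) \<longleftrightarrow>
    (\<exists>w\<in>site (2 ^ k) ` window K. Q = cube k w \<and> B = list_of (nbhd k w \<inter> window K)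
      \<and> t = s / (3 ^ DIM('a) * 2 ^ (k + 1)))"
  by (auto simp: level_def list_of finite_window)

lemma set_levels:
  "(Q, B, t) \<in> set (levels K s k :: ('a::euclidean_space set \<times> _) list) \<longleftrightarrow>
    (\<exists>j\<le>k. (Q, B, t) \<in> set (level K s j))"
  by (induction k) (auto simp: le_Suc_eq)

lemma sorted_levels:
  "sorted_wrt (\<lambda>(Q, B, t) (Q', B', t'). Q \<inter> Q' = {} \<or> Q' \<subseteq> Q \<and> set B' \<subseteq> set B)
     (levels K s k :: ('a::euclidean_space set \<times> _) list)"
proof -
  let ?P = "\<lambda>(Q, B, t) (Q', B', t'). Q \<inter> Q' = {} \<or> Q' \<subseteq> Q \<and> set B' \<subseteq> set B"
  have P: "?P x y" if x: "x \<in> set (level K s i :: ('a set \<times> _) list)" and y: "y \<in> set (level K s j)" and "j \<le> i" for x y i j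
  proof -
    obtain Q B t Q' B' t' where xy: "x = (Q, B, t)" "y = (Q', B', t')" by (cases x, cases y) auto
    obtain w w' where w: "w \<in> site (2 ^ i) ` window K" "Q = cube i w" "B = list_of (nbhd i w \<inter> window K)"
      and w': "w' \<in> site (2 ^ j) ` window K" "Q' = cube j w'" "B' = list_of (nbhd j w' \<inter> window K)"
      using x y unfolding xy set_level by blast
    have wl: "w \<in> lattice" "w' \<in> lattice" using w w' by auto
    have B: "set B = nbhd i w \<inter> window K" "set B' = nbhd j w' \<inter> window K"
      using w w' by (auto simp: list_of finite_window)
    show ?thesis
    proof (cases "Q \<inter> Q' = {}")
      case False
      then have "cube j w' \<inter> cube i w \<noteq> {}" using w w' by auto
      from cube_nested[OF \<open>j \<le> i\<close> this wl(2,1)] show ?thesis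
        unfolding xy prod.case B w(2) w'(2) by blast
    qed (simp add: xy)
  qed
  have all: "sorted_wrt ?P xs" if "\<And>x y. x \<in> set xs \<Longrightarrow> y \<in> set xs \<Longrightarrow> ?P x y" for xs :: "('a set \<times> 'a list \<times> real) list"
    using that by (induction xs) auto
  show ?thesis
  proof (induction k)
    case (Suc k)
    have "?P x y" if x: "x \<in> set (level K s (Suc k))" and y': "y \<in> set (levels K s k)" for x y :: "'a set \<times> 'a list \<times> real"
    proof -
      obtain Q B t where y: "y = (Q, B, t)" by (cases y)
      obtain j where "j \<le> k" "y \<in> set (level K s j)" using y' unfolding y set_levels by blast
      then show ?thesis using P[OF x, of y j] by auto
    qed
    then show ?case using Suc all[of "level K s (Suc k)"] P[of _ "Suc k" _ "Suc k"]
      unfolding levels.simps sorted_wrt_append by blast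
  qed (unfold levels.simps, rule all, rule P, auto)
qed

text \<open>The union bound for independent closings, kept together with the bounds \<open>0\<close>
  and \<open>1\<close> for the sake of the induction.\<close>

lemma open_prob_block_sites:
  assumes "\<And>Q B t. (Q, B, t) \<in> set l \<Longrightarrow> distinct B \<and> 0 \<le> t \<and> t \<le> 1"
  shows "1 - (\<Sum>(Q, B, t)\<leftarrow>l. if x \<in> set B then t else 0) \<le> open_prob (block_sites l) x
    \<and> 0 \<le> open_prob (block_sites l) x \<and> open_prob (block_sites l) x \<le> 1"
  using assms
proof (induction l)
  case (Cons z l)
  obtain Q B t where z: "z = (Q, B, t)" by (cases z)
  let ?a = "open_prob (block_sites l) x"
  have IH: "1 - (\<Sum>(Q, B, t)\<leftarrow>l. if x \<in> set B then t else 0) \<le> ?a" "0 \<le> ?a" "?a \<le> 1"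
    using Cons by auto
  have B: "distinct B" "0 \<le> t" "t \<le> 1" using Cons.prems[of Q B t] z by auto
  have eq: "open_prob (block_sites (z # l)) x = (if x \<in> set B then 1 - t else 1) * ?a"
    using B by (simp add: z block_sites_def open_prob_append open_prob_map)
  have "t * ?a \<le> t" using IH B by (intro mult_left_le) auto
  moreover have "(1 - t) * ?a \<le> 1" "0 \<le> (1 - t) * ?a" using IH B by (auto intro!: mult_le_one)
  ultimately show ?case unfolding eq using IH by (auto simp: z algebra_simps)
qed (auto simp: block_sites_def open_prob_def)

lemma open_prob_levels:
  fixes x :: "'a::euclidean_space"
  assumes s: "0 \<le> s" "s \<le> 1"
  shows "1 - s \<le> open_prob (block_sites (levels K s k)) x"
proof -
  let ?l = "\<lambda>k. levels K s k :: ('a set \<times> 'a list \<times> real) list"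
  define t where "t k = s / (3 ^ DIM('a) * 2 ^ (k + 1))" for k :: nat
  have t: "0 \<le> t k" "t k \<le> 1" for k
  proof -
    have "(1::real) \<le> 3 ^ DIM('a) * 2 ^ (k + 1)"
      using mult_mono[of 1 "3 ^ DIM('a)" 1 "2 ^ (k + 1) :: real"] one_le_power[of "3::real" "DIM('a)"]
        one_le_power[of "2::real" "k + 1"] by simp
    then show "0 \<le> t k" "t k \<le> 1" using s unfolding t_def by (auto simp: divide_le_eq)
  qed
  have lev: "(\<Sum>(Q, B, t)\<leftarrow>level K s k. if x \<in> set B then t else 0) \<le> s / 2 ^ (k + 1)" for k
  proof -
    let ?S = "site (2 ^ k) ` window K :: 'a set"
    let ?N = "{w \<in> ?S. x \<in> nbhd k w}"
    have "(\<Sum>(Q, B, t)\<leftarrow>level K s k. if x \<in> set B then t else 0)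
        = (\<Sum>w\<leftarrow>list_of ?S. if x \<in> nbhd k w \<inter> window K then t k else 0)"
      unfolding level_def t_def by (simp add: o_def list_of finite_window cong: if_cong)
    also have "\<dots> = (\<Sum>w\<in>?S. if x \<in> nbhd k w \<inter> window K then t k else 0)"
      by (subst sum_list_distinct_conv_sum_set) (simp_all add: list_of finite_window)
    also have "\<dots> \<le> (\<Sum>w\<in>?S. if x \<in> nbhd k w then t k else 0)"
      using t by (intro sum_mono) auto
    also have "\<dots> = card ?N * t k"
      by (subst sum.inter_filter[symmetric]) (simp_all add: finite_window)
    also have "\<dots> \<le> 3 ^ DIM('a) * t k"
    proof (intro mult_right_mono t)
      let ?N' = "{w \<in> lattice. \<forall>b\<in>(Basis :: 'a set). \<lfloor>w \<bullet> b\<rfloor> \<in> {\<lfloor>site (2 ^ k) x \<bullet> b\<rfloor> - 1 .. \<lfloor>site (2 ^ k) x \<bullet> b\<rfloor> + 1}}"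
      have "card ?N \<le> card ?N'"
        by (rule card_mono[OF finite_lattice_PiE]) (auto simp: nbhd_def abs_le_iff)
      also have "card ?N' = 3 ^ DIM('a)" unfolding card_lattice_PiE by simp
      finally show "real (card ?N) \<le> 3 ^ DIM('a)" by (metis of_nat_le_iff of_nat_numeral of_nat_power)
    qed
    also have "\<dots> = s / 2 ^ (k + 1)" by (simp add: t_def)
    finally show ?thesis .
  qed
  have dist: "distinct B \<and> 0 \<le> t' \<and> t' \<le> 1" if "(Q, B, t') \<in> set (level K s k)" for Q :: "'a set" and B t' k
    using that t[of k] by (auto simp: set_level list_of finite_window t_def)
  have lev': "1 - s / 2 ^ (k + 1) \<le> open_prob (block_sites (level K s k)) x"
      "0 \<le> open_prob (block_sites (level K s k)) x" "open_prob (block_sites (level K s k)) x \<le> 1" for k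
    using open_prob_block_sites[of "level K s k" x] dist lev[of k] by fastforce+
  have "1 - s * (1 - 1 / 2 ^ (k + 1)) \<le> open_prob (block_sites (?l k)) x
     \<and> 0 \<le> open_prob (block_sites (?l k)) x \<and> open_prob (block_sites (?l k)) x \<le> 1"
  proof (induction k)
    case 0
    show ?case using lev'[of 0] by simp
  next
    case (Suc k)
    let ?a = "open_prob (block_sites (level K s (Suc k))) x" and ?b = "open_prob (block_sites (?l k)) x"
    have eq: "open_prob (block_sites (?l (Suc k))) x = ?a * ?b"
      by (simp add: block_sites_def open_prob_append)
    have "0 \<le> (1 - ?a) * (1 - ?b)" using Suc lev'[of "Suc k"] by (intro mult_nonneg_nonneg) auto
    then have "?a * ?b \<ge> ?a + ?b - 1" by (simp add: algebra_simps)
    moreover have "s / 2 ^ (Suc k + 1) + s * (1 - 1 / 2 ^ (k + 1)) = s * (1 - 1 / 2 ^ (Suc k + 1))"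
      by (simp add: field_simps)
    ultimately show ?case unfolding eq using Suc lev'[of "Suc k"] by (auto intro!: mult_le_one)
  qed
  moreover have "s * (1 - 1 / 2 ^ (k + 1)) \<le> s" using s by (intro mult_left_le) auto
  ultimately show ?thesis by linarith
qed

text \<open>No cube whose neighbourhood contains a surviving site is crowded, so the neighbourhood
  of level \<open>k\<close> around that site holds at most a constant times
  \<open>2 ^ (k * DIM('a))\<close> points, and the points entering at level \<open>k + 1\<close> are
  at distance at least \<open>2 ^ k\<close>. Summing over these shells, summability of
  \<open>A\<close> makes the bound independent of \<open>K\<close>.\<close>

lemma interference_bound:
  fixes z :: "'a::euclidean_space" and N :: "'a \<Rightarrow> nat" and M :: nat and A :: "real \<Rightarrow> real"
  assumes A: "\<And>r r'. 0 \<le> r \<Longrightarrow> r \<le> r' \<Longrightarrow> A r' \<le> A r" "\<And>r. 0 \<le> A r"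
    and sm: "summable (\<lambda>k. 2 ^ (k * DIM('a)) * A (2 ^ k))"
    and z: "z \<in> window K" "z \<notin> deleted (levels K s K) (\<lambda>y. N y - M)"
  shows "(\<Sum>y\<in>window K. N y * A (norm (y - z)))
    \<le> (M + 1) * 3 ^ DIM('a) * (A 0 + 2 ^ DIM('a) * (\<Sum>k. 2 ^ (k * DIM('a)) * A (2 ^ k)))"
proof -
  let ?d = "DIM('a)"
  define S where "S k = nbhd k (site (2 ^ k) z) \<inter> window K" for k
  have zl: "z \<in> lattice" using z window_subset_lattice by blast
  have finS: "finite (S k)" for k by (simp add: S_def finite_nbhd)
  have nc: "sum (\<lambda>y. N y - M) (cube k w) < 2 ^ (k * ?d)"
    if w: "k \<le> K" "w \<in> site (2 ^ k) ` window K" "z \<in> nbhd k w" for k w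
  proof -
    have "(cube k w, list_of (nbhd k w \<inter> window K), s / (3 ^ ?d * 2 ^ (k + 1))) \<in> set (levels K s K)"
      unfolding set_levels set_level using w by blast
    moreover have "z \<in> set (list_of (nbhd k w \<inter> window K))"
      using w z by (simp add: list_of finite_window)
    ultimately have "\<not> crowded (cube k w) (\<lambda>y. N y - M)"
      using z(2) unfolding deleted_def by blast
    moreover have "w \<in> lattice" using w by auto
    ultimately show ?thesis by (simp add: crowded_def card_cube not_le)
  qed
  \<comment> \<open>By symmetry of neighbourhoods, the cubes that cover \<open>S k\<close> are among
    the at most \<open>3 ^ ?d\<close> cubes having \<open>z\<close> in their neighbourhood. Each has
    excess below its volume, and the part below the threshold adds at most \<open>M\<close> per
    site.\<close>
  have SN: "(\<Sum>y\<in>S k. N y) \<le> (M + 1) * (3 ^ ?d * 2 ^ (k * ?d))" if k: "k \<le> K" for k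
  proof -
    let ?W = "{w \<in> site (2 ^ k) ` window K. z \<in> nbhd k w}"
    have finW: "finite ?W" by (simp add: finite_window)
    have cW: "card ?W \<le> 3 ^ ?d"
    proof -
      let ?N' = "{w \<in> lattice. \<forall>b\<in>(Basis :: 'a set). \<lfloor>w \<bullet> b\<rfloor> \<in> {\<lfloor>site (2 ^ k) z \<bullet> b\<rfloor> - 1 .. \<lfloor>site (2 ^ k) z \<bullet> b\<rfloor> + 1}}"
      have "card ?W \<le> card ?N'"
        by (rule card_mono[OF finite_lattice_PiE]) (auto simp: nbhd_def abs_le_iff)
      also have "card ?N' = 3 ^ ?d" unfolding card_lattice_PiE by simp
      finally show ?thesis .
    qed
    have "(\<Sum>y\<in>S k. N y - M) \<le> (\<Sum>y\<in>(\<Union>w\<in>?W. cube k w). N y - M)"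
    proof (rule sum_mono2)
      show "finite (\<Union>w\<in>?W. cube k w)" using finW by (auto intro!: finite_cube)
      show "S k \<subseteq> (\<Union>w\<in>?W. cube k w)"
      proof
        fix y assume y: "y \<in> S k"
        then have yl: "y \<in> lattice" "y \<in> window K" using window_subset_lattice by (auto simp: S_def)
        have "y \<in> cube k (site (2 ^ k) y)" using yl by (simp add: cube_def)
        moreover have "z \<in> nbhd k (site (2 ^ k) y)" using y nbhd_sym[OF zl yl(1)] by (simp add: S_def)
        ultimately show "y \<in> (\<Union>w\<in>?W. cube k w)" using yl(2) by blast
      qed
    qed simp
    also have "\<dots> \<le> (\<Sum>w\<in>?W. \<Sum>y\<in>cube k w. N y - M)"
      by (subst sum.UNION_disjoint[OF finW]) (auto intro!: finite_cube, auto simp: cube_def)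
    also have "\<dots> \<le> (\<Sum>w\<in>?W. 2 ^ (k * ?d))"
      by (intro sum_mono less_imp_le nc k) auto
    also have "\<dots> \<le> 3 ^ ?d * 2 ^ (k * ?d)" using cW by simp
    finally have 1: "(\<Sum>y\<in>S k. N y - M) \<le> 3 ^ ?d * 2 ^ (k * ?d)" .
    have cS: "card (S k) \<le> 3 ^ ?d * 2 ^ (k * ?d)"
      unfolding card_nbhd[of k "site (2 ^ k) z", symmetric] S_def by (intro card_mono finite_nbhd) auto
    have "(\<Sum>y\<in>S k. N y) \<le> (\<Sum>y\<in>S k. M + (N y - M))" by (intro sum_mono) auto
    also have "\<dots> = card (S k) * M + (\<Sum>y\<in>S k. N y - M)" by (simp add: sum.distrib)
    also have "\<dots> \<le> (3 ^ ?d * 2 ^ (k * ?d)) * M + 3 ^ ?d * 2 ^ (k * ?d)"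
      using 1 cS by (intro add_mono mult_right_mono) auto
    finally show ?thesis by (simp add: algebra_simps)
  qed
  have SN': "real (\<Sum>y\<in>S k. N y) \<le> (M + 1) * 3 ^ ?d * 2 ^ (k * ?d)" if "k \<le> K" for k
    using of_nat_mono[OF SN[OF that], where ?'a = real] by (simp add: algebra_simps)
  have sub: "S k \<subseteq> S (Suc k)" for k
    unfolding S_def using cube_nested(2)[of k "Suc k" "site (2 ^ k) z" "site (2 ^ Suc k) z"] zl
    by (auto simp: cube_def)
  have "(\<Sum>y\<in>S k. N y * A (norm (y - z)))
      \<le> (M + 1) * 3 ^ ?d * (A 0 + 2 ^ ?d * (\<Sum>j<k. 2 ^ (j * ?d) * A (2 ^ j)))" if "k \<le> K" for k
    using that
  proof (induction k)
    case 0
    have "(\<Sum>y\<in>S 0. N y * A (norm (y - z))) \<le> (\<Sum>y\<in>S 0. real (N y) * A 0)"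
      by (intro sum_mono mult_left_mono A) auto
    also have "\<dots> = real (\<Sum>y\<in>S 0. N y) * A 0" by (simp add: sum_distrib_right)
    also have "\<dots> \<le> (M + 1) * 3 ^ ?d * A 0"
      using SN'[of 0] A(2)[of 0] by (intro mult_right_mono) auto
    finally show ?case by simp
  next
    case (Suc k)
    have "(\<Sum>y\<in>S (Suc k). N y * A (norm (y - z)))
        = (\<Sum>y\<in>S (Suc k) - S k. N y * A (norm (y - z))) + (\<Sum>y\<in>S k. N y * A (norm (y - z)))"
      by (rule sum.subset_diff[OF sub finS])
    also have "(\<Sum>y\<in>S (Suc k) - S k. N y * A (norm (y - z))) \<le> (\<Sum>y\<in>S (Suc k) - S k. real (N y) * A (2 ^ k))"
    proof (intro sum_mono mult_left_mono A(1))
      fix y assume y: "y \<in> S (Suc k) - S k"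
      then show "2 ^ k \<le> norm (y - z)"
        using window_subset_lattice by (intro norm_not_nbhd) (auto simp: S_def)
    qed auto
    also have "\<dots> = real (\<Sum>y\<in>S (Suc k) - S k. N y) * A (2 ^ k)" by (simp add: sum_distrib_right)
    also have "\<dots> \<le> (M + 1) * 3 ^ ?d * 2 ^ (Suc k * ?d) * A (2 ^ k)"
    proof (intro mult_right_mono A(2))
      have "(\<Sum>y\<in>S (Suc k) - S k. N y) \<le> (\<Sum>y\<in>S (Suc k). N y)"
        using finS by (intro sum_mono2) auto
      then show "real (\<Sum>y\<in>S (Suc k) - S k. N y) \<le> (M + 1) * 3 ^ ?d * 2 ^ (Suc k * ?d)"
        using SN'[OF Suc.prems] by linarith
    qed
    also have "\<dots> = (M + 1) * 3 ^ ?d * (2 ^ ?d * (2 ^ (k * ?d) * A (2 ^ k)))"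
      by (simp add: power_add)
    also have "(\<Sum>y\<in>S k. N y * A (norm (y - z)))
        \<le> (M + 1) * 3 ^ ?d * (A 0 + 2 ^ ?d * (\<Sum>j<k. 2 ^ (j * ?d) * A (2 ^ j)))"
      using Suc by simp
    finally show ?case by (simp add: algebra_simps)
  qed
  from this[OF order_refl] have "(\<Sum>y\<in>S K. N y * A (norm (y - z)))
      \<le> (M + 1) * 3 ^ ?d * (A 0 + 2 ^ ?d * (\<Sum>j<K. 2 ^ (j * ?d) * A (2 ^ j)))" .
  \<comment> \<open>The neighbourhood of level \<open>K\<close> already covers the window, so no
    shell is missing.\<close>
  also have "S K = window K" using window_subset_nbhd[OF z(1)] by (auto simp: S_def)
  also have "(M + 1) * 3 ^ ?d * (A 0 + 2 ^ ?d * (\<Sum>j<K. 2 ^ (j * ?d) * A (2 ^ j)))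
      \<le> (M + 1) * 3 ^ ?d * (A 0 + 2 ^ ?d * (\<Sum>j. 2 ^ (j * ?d) * A (2 ^ j)))"
    by (intro mult_left_mono add_left_mono sum_le_suminf sm) (auto intro!: A(2) mult_nonneg_nonneg)
  finally show ?thesis .
qed

section \<open>Domination by cells of low interference\<close>

lemma integrable_poisson_exp:
  fixes \<mu> \<beta> :: real
  assumes "\<mu> > 0"
  shows "integrable (measure_pmf (poisson_pmf \<mu>)) (\<lambda>k. exp (\<beta> * real k))"
proof -
  have "summable (\<lambda>k. exp (-\<mu>) * ((\<mu> * exp \<beta>) ^ k /\<^sub>R fact k))"
    by (intro summable_mult summable_exp_generic)
  then have "summable (\<lambda>k. norm (pmf (poisson_pmf \<mu>) k *\<^sub>R exp (\<beta> * real k)))"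
    by (rule summable_cong[THEN iffD1, rotated])
      (use assms in \<open>auto simp: field_simps power_mult_distrib exp_of_nat_mult[symmetric] abs_mult\<close>)
  then have "integrable (count_space UNIV) (\<lambda>k. pmf (poisson_pmf \<mu>) k *\<^sub>R exp (\<beta> * real k))"
    by (simp add: integrable_count_space_nat_iff)
  then show ?thesis
    unfolding measure_pmf_eq_density by (subst integrable_density) auto
qed

text \<open>Chernoff's bound: the indicator is at most
  \<open>exp (\<beta> * (sum e Q - card Q))\<close>, whose expectation factorizes over the
  sites.\<close>

lemma prob_crowded_le:
  fixes \<beta> :: real
  assumes Q: "finite Q" and \<beta>: "0 \<le> \<beta>" and int: "integrable (measure_pmf p) (\<lambda>k. exp (\<beta> * real k))"
    and E: "measure_pmf.expectation p (\<lambda>k. exp (\<beta> * real k)) \<le> 2"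
  shows "measure_pmf.prob (Pi_pmf Q 0 (\<lambda>_. p)) {e. crowded Q e} \<le> (2 * exp (-\<beta>)) ^ card Q"
proof -
  let ?f = "\<lambda>_ k. exp (-\<beta>) * exp (\<beta> * real k)"
  have int': "integrable (measure_pmf p) (?f y)" for y using int by simp
  have le: "indicator {e. crowded Q e} e \<le> (\<Prod>y\<in>Q. ?f y (e y))" for e
  proof -
    have eq: "(\<Prod>y\<in>Q. ?f y (e y)) = exp (\<beta> * (real (sum e Q) - card Q))"
      using Q by (simp add: prod.distrib exp_sum[symmetric] sum_distrib_left[symmetric] exp_of_nat_mult[symmetric]
          exp_add[symmetric] sum_subtractf algebra_simps)
    show ?thesis unfolding eq
      using \<beta> by (auto simp: indicator_def crowded_def simp del: of_nat_sum)
  qed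
  have "measure_pmf.prob (Pi_pmf Q 0 (\<lambda>_. p)) {e. crowded Q e}
      = measure_pmf.expectation (Pi_pmf Q 0 (\<lambda>_. p)) (indicator {e. crowded Q e})" by simp
  also have "\<dots> \<le> measure_pmf.expectation (Pi_pmf Q 0 (\<lambda>_. p)) (\<lambda>e. \<Prod>y\<in>Q. ?f y (e y))"
    by (intro integral_mono integrable_unit_pmf integrable_prod_Pi_pmf Q int' le) (auto simp: indicator_def)
  also have "\<dots> = (\<Prod>y\<in>Q. measure_pmf.expectation p (?f y))"
    by (rule expectation_prod_Pi_pmf[OF Q int']) auto
  also have "\<dots> = (exp (-\<beta>) * measure_pmf.expectation p (\<lambda>k. exp (\<beta> * real k))) ^ card Q"
    by simp
  also have "\<dots> \<le> (2 * exp (-\<beta>)) ^ card Q"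
    using E by (intro power_mono) (auto intro!: mult_nonneg_nonneg integral_nonneg_AE)
  finally show ?thesis .
qed

text \<open>Dominated convergence as \<open>M\<close> grows: the truncated difference
  \<open>k - M\<close> is eventually \<open>0\<close> for each \<open>k\<close>, so the exponential
  moment tends to \<open>1\<close>, however large \<open>\<beta>\<close> is.\<close>

lemma excess_threshold:
  fixes \<mu> \<beta> \<epsilon> :: real
  assumes "\<mu> > 0" "\<epsilon> > 0" "0 \<le> \<beta>"
  shows "\<exists>M. measure_pmf.expectation (poisson_pmf \<mu>) (\<lambda>k. exp (\<beta> * real (k - M))) \<le> 2
    \<and> 1 - \<epsilon> \<le> measure_pmf.prob (poisson_pmf \<mu>) {k. k - M = 0}"
proof -
  have ev: "\<forall>\<^sub>F M in sequentially. k - M = 0" for k :: nat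
    using eventually_ge_at_top[of k] by eventually_elim simp
  have "(\<lambda>M. measure_pmf.expectation (poisson_pmf \<mu>) (\<lambda>k. exp (\<beta> * real (k - M))))
      \<longlonglongrightarrow> measure_pmf.expectation (poisson_pmf \<mu>) (\<lambda>k. 1)"
  proof (rule integral_dominated_convergence[where w = "\<lambda>k. exp (\<beta> * real k)"])
    show "AE k in poisson_pmf \<mu>. (\<lambda>M. exp (\<beta> * real (k - M))) \<longlonglongrightarrow> 1"
      by (intro AE_I2 tendsto_eventually eventually_mono[OF ev]) auto
    show "AE k in poisson_pmf \<mu>. norm (exp (\<beta> * real (k - M))) \<le> exp (\<beta> * real k)" for M
      using assms by (intro AE_I2) (auto intro!: mult_left_mono)
  qed (use integrable_poisson_exp[OF assms(1)] in auto)
  then have "\<forall>\<^sub>F M in sequentially. measure_pmf.expectation (poisson_pmf \<mu>) (\<lambda>k. exp (\<beta> * real (k - M))) < 2"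
    by (rule order_tendstoD) simp
  moreover have "(\<lambda>M. measure_pmf.expectation (poisson_pmf \<mu>) (indicator {k. k - M = 0} :: nat \<Rightarrow> real))
      \<longlonglongrightarrow> measure_pmf.expectation (poisson_pmf \<mu>) (\<lambda>k. 1)"
  proof (rule integral_dominated_convergence[where w = "\<lambda>k. 1"])
    show "AE k in poisson_pmf \<mu>. (\<lambda>M. indicator {k. k - M = 0} k :: real) \<longlonglongrightarrow> 1"
    proof (intro AE_I2 tendsto_eventually)
      fix k :: nat
      show "\<forall>\<^sub>F M in sequentially. indicator {k. k - M = 0} k = (1::real)"
        using ev[of k] by eventually_elim (simp add: indicator_def)
    qed
  qed (auto simp: indicator_def)
  then have "\<forall>\<^sub>F M in sequentially. 1 - \<epsilon> < measure_pmf.expectation (poisson_pmf \<mu>) (indicator {k. k - M = 0} :: nat \<Rightarrow> real)"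
    by (rule order_tendstoD) (use assms in simp)
  ultimately have "\<forall>\<^sub>F M in sequentially. measure_pmf.expectation (poisson_pmf \<mu>) (\<lambda>k. exp (\<beta> * real (k - M))) < 2
    \<and> 1 - \<epsilon> < measure_pmf.prob (poisson_pmf \<mu>) {k. k - M = 0}"
    by eventually_elim simp
  then obtain M where "measure_pmf.expectation (poisson_pmf \<mu>) (\<lambda>k. exp (\<beta> * real (k - M))) < 2
    \<and> 1 - \<epsilon> < measure_pmf.prob (poisson_pmf \<mu>) {k. k - M = 0}"
    using eventually_happens'[OF sequentially_bot] by blast
  then show ?thesis by (intro exI[of _ M]) auto
qed

text \<open>The surplus \<open>\<delta>\<close> of density pays for three losses, each about a
  quarter of it: the block closings, the background closings and the gap between \<open>c\<close>
  and \<open>exp (-\<mu>)\<close>. The constants are fixed in the order \<open>s\<close>,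
  \<open>b\<close>, \<open>\<beta>\<close>, \<open>M\<close>, \<open>C\<close>, so that
  \<open>C\<close> serves all windows at once.\<close>

theorem low_interference_dominates:
  fixes A :: "real \<Rightarrow> real" and \<nu>' :: "nat pmf"
  assumes A: "\<And>r r'. 0 \<le> r \<Longrightarrow> r \<le> r' \<Longrightarrow> A r' \<le> A r" "\<And>r. 0 \<le> A r"
    and sm: "summable (\<lambda>k. 2 ^ (k * DIM('a::euclidean_space)) * A (2 ^ k))"
    and mu: "\<mu> > 0" and nu': "exp (-\<mu>) < pmf \<nu>' 0"
  shows "\<exists>C. \<forall>K (\<phi> :: 'a set \<Rightarrow> real). antimono \<phi> \<longrightarrow> (\<forall>F. 0 \<le> \<phi> F \<and> \<phi> F \<le> 1) \<longrightarrow>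
    measure_pmf.expectation (Pi_pmf (window K) 0 (\<lambda>_. \<nu>')) (\<lambda>N. \<phi> {y\<in>window K. N y = 0})
    \<le> measure_pmf.expectation (Pi_pmf (window K) 0 (\<lambda>_. poisson_pmf \<mu>))
        (\<lambda>N. \<phi> {z\<in>window K. N z = 0 \<or> C < (\<Sum>y\<in>window K. N y * A (norm (y - z)))})"
proof -
  let ?d = "DIM('a)" and ?\<nu> = "poisson_pmf \<mu>"
  define p0 where "p0 = 1 - pmf \<nu>' 0"
  define \<delta> where "\<delta> = 1 - exp (-\<mu>) - p0"
  have p0: "0 \<le> p0" "p0 < 1 - exp (-\<mu>)" using nu' by (auto simp: p0_def pmf_le_1)
  have \<delta>: "\<delta> > 0" "\<delta> < 1" using p0 exp_gt_zero[of "-\<mu>"] unfolding \<delta>_def by linarith+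
  define s where "s = \<delta> / 4"
  have s: "0 < s" "s \<le> 1 / 4" using \<delta> by (auto simp: s_def)
  define t where "t k = s / (3 ^ ?d * 2 ^ (k + 1))" for k :: nat
  \<comment> \<open>Made so that the \<open>n\<close>-th power of
    \<open>b = c0 * s ^ (3 ^ ?d)\<close>, with \<open>n = 2 ^ (k * ?d)\<close>, is at most
    \<open>t k * s ^ length B\<close> at every level: \<open>s ^ (3 ^ ?d)\<close> pays for the at
    most \<open>3 ^ ?d * n\<close> sites of \<open>B\<close>, and \<open>c0 ^ n\<close> is at most
    \<open>t k\<close> because \<open>n\<close> is at least \<open>1\<close> and at least
    \<open>k\<close>.\<close>
  define c0 where "c0 = s / (4 * 3 ^ ?d)"
  have c0: "0 < c0" "c0 \<le> s / (2 * 3 ^ ?d) * (1 / 2)" using s by (auto simp: c0_def)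
  have "c0 \<le> 1"
  proof -
    have "s \<le> 4 * 3 ^ ?d" using s one_le_power[of "3::real" ?d] by linarith
    then show ?thesis unfolding c0_def by simp
  qed
  define b where "b = c0 * s ^ (3 ^ ?d)"
  have b: "0 < b" "b \<le> 1"
    using c0 s \<open>c0 \<le> 1\<close> by (auto simp: b_def intro!: mult_le_one power_le_one)
  define \<beta> where "\<beta> = ln (2 / b)"
  have \<beta>: "0 \<le> \<beta>" "2 * exp (-\<beta>) = b"
    using b by (auto simp: \<beta>_def exp_minus)
  obtain M where M: "measure_pmf.expectation ?\<nu> (\<lambda>k. exp (\<beta> * real (k - M))) \<le> 2"
    "1 - \<delta> / 4 \<le> measure_pmf.prob ?\<nu> {k. k - M = 0}"
    using excess_threshold[OF mu _ \<beta>(1), of "\<delta> / 4"] \<delta> by auto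
  let ?P = "measure_pmf.prob ?\<nu> {k. k - M = 0}"
  define c where "c = pmf ?\<nu> 0 / ?P"
  have P: "0 < ?P" "?P \<le> 1" using M \<delta> by auto
  have cP: "c * ?P = pmf ?\<nu> 0" using P by (simp add: c_def)
  have "pmf ?\<nu> 0 = measure_pmf.prob ?\<nu> {0}" by (simp add: pmf.rep_eq)
  also have "\<dots> \<le> ?P" by (rule measure_pmf.finite_measure_mono) auto
  finally have c: "0 \<le> c" "c \<le> 1" using P by (auto simp: c_def)
  have op: "p0 \<le> (1 - s) * ((1 - s) * (1 - c))"
  proof -
    have "c \<le> exp (-\<mu>) + \<delta> / 4"
    proof -
      have "c = c * ?P + c * (1 - ?P)" by (simp add: algebra_simps)
      also have "c * (1 - ?P) \<le> 1 * (1 - ?P)" using c P by (intro mult_right_mono) auto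
      also have "c * ?P = exp (-\<mu>)" unfolding cP using mu by simp
      finally show ?thesis using M by simp
    qed
    moreover have "1 - exp (-\<mu>) = p0 + \<delta>" by (simp add: \<delta>_def)
    ultimately have 1: "p0 + 3 * s \<le> 1 - c" unfolding s_def by linarith
    have 2: "(1 - 2 * s) * (1 - c) \<le> (1 - s) * (1 - s) * (1 - c)"
      using c by (intro mult_right_mono) (auto simp: algebra_simps)
    have 3: "2 * s * (1 - c) \<le> 2 * s" using c s by (intro mult_left_le) auto
    have "p0 \<le> (1 - c) - 2 * s * (1 - c)" using 1 3 s by linarith
    also have "\<dots> = (1 - 2 * s) * (1 - c)" by (simp add: algebra_simps)
    finally show ?thesis using 2 by (simp add: mult.assoc)
  qed
  have int: "integrable (measure_pmf (map_pmf (\<lambda>k. k - M) ?\<nu>)) (\<lambda>k. exp (\<beta> * real k))"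
  proof -
    have "integrable (measure_pmf ?\<nu>) (\<lambda>k. exp (\<beta> * real (k - M)))"
      by (rule Bochner_Integration.integrable_bound[OF integrable_poisson_exp[OF mu, of \<beta>]])
        (use \<beta> in \<open>auto intro!: AE_I2 mult_left_mono\<close>)
    then show ?thesis by simp
  qed
  define C where "C = (M + 1) * 3 ^ ?d * (A 0 + 2 ^ ?d * (\<Sum>k. 2 ^ (k * ?d) * A (2 ^ k)))"
  show ?thesis
  proof (intro exI[of _ C] allI impI)
    fix K and \<phi> :: "'a set \<Rightarrow> real" assume phi: "antimono \<phi>" "\<forall>F. 0 \<le> \<phi> F \<and> \<phi> F \<le> 1"
    let ?xs = "list_of (window K :: 'a set)" and ?l = "levels K s K :: ('a set \<times> _) list"
    have xs: "set ?xs = window K" "distinct ?xs" by (auto simp: list_of finite_window)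
    \<comment> \<open>An occupied site that is not deleted has interference at most
      \<open>C\<close>, so the sites to be avoided are among the empty and the deleted ones.\<close>
    have le: "\<phi> ({y\<in>set ?xs. N y = 0} \<union> deleted ?l (\<lambda>y. N y - M))
          \<le> \<phi> {z\<in>window K. N z = 0 \<or> C < (\<Sum>y\<in>window K. N y * A (norm (y - z)))}" for N :: "'a \<Rightarrow> nat"
    proof (rule antimonoD[OF phi(1)], rule subsetI)
      fix z assume z: "z \<in> {z\<in>window K. N z = 0 \<or> C < (\<Sum>y\<in>window K. N y * A (norm (y - z)))}"
      show "z \<in> {y\<in>set ?xs. N y = 0} \<union> deleted ?l (\<lambda>y. N y - M)"
      proof (rule ccontr)
        assume nz: "\<not> ?thesis"
        then have "(\<Sum>y\<in>window K. N y * A (norm (y - z))) \<le> C"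
          unfolding C_def using z by (intro interference_bound[OF A sm]) auto
        then show False using z nz xs by auto
      qed
    qed
    have "measure_pmf.expectation (Pi_pmf (set ?xs) 0 (\<lambda>_. \<nu>')) (\<lambda>N. \<phi> {y\<in>set ?xs. N y = 0})
      \<le> measure_pmf.expectation (Pi_pmf (set ?xs) 0 (\<lambda>_. ?\<nu>))
          (\<lambda>N. \<phi> ({y\<in>set ?xs. N y = 0} \<union> deleted ?l (\<lambda>y. N y - M)))"
    proof (rule closed_dominated[where xs = ?xs and \<phi> = \<phi> and s = s and c = c and ex = "\<lambda>k. k - M"
        and \<nu> = ?\<nu> and \<nu>' = \<nu>' and l = ?l])
      show "1 - pmf \<nu>' 0 \<le> open_prob (block_sites ?l) x * ((1 - s) * (1 - c))" for x
      proof -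
        have "(1 - s) * ((1 - s) * (1 - c)) \<le> open_prob (block_sites ?l) x * ((1 - s) * (1 - c))"
          using open_prob_levels[of s K K x] s c by (intro mult_right_mono) auto
        then show ?thesis using op by (simp add: p0_def)
      qed
      show "sorted_wrt (\<lambda>(Q, B, t) (Q', B', t'). Q \<inter> Q' = {} \<or> Q' \<subseteq> Q \<and> set B' \<subseteq> set B) ?l"
        by (rule sorted_levels)
      show "\<exists>B t. ({y}, B, t) \<in> set ?l \<and> y \<in> set B" if "y \<in> set ?xs" for y
      proof -
        have y: "y \<in> window K" "y \<in> lattice" using that xs window_subset_lattice by auto
        have "site 1 z = z" if "z \<in> lattice" for z :: 'a
          using that by (intro lattice_eqI) (auto simp: site_inner)
        then have 1: "{y} = cube 0 (site (2 ^ 0) y)" using y by (auto simp: cube_def)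
        have 2: "site (2 ^ 0) y \<in> site (2 ^ 0) ` window K" using y(1) by (rule imageI)
        have "({y}, list_of (nbhd 0 (site (2 ^ 0) y) \<inter> window K), t 0) \<in> set (level K s 0)"
          unfolding set_level t_def using 1 2 by blast
        moreover have "y \<in> nbhd 0 (site (2 ^ 0) y)" using y by (simp add: nbhd_def)
        then have "y \<in> set (list_of (nbhd 0 (site (2 ^ 0) y) \<inter> window K))"
          using y by (simp add: list_of finite_window)
        ultimately have "({y}, list_of (nbhd 0 (site (2 ^ 0) y) \<inter> window K), t 0) \<in> set (level K s 0)"
          "y \<in> set (list_of (nbhd 0 (site (2 ^ 0) y) \<inter> window K))" by simp_all
        then show ?thesis unfolding set_levels by blast
      qed
      fix Q B t' assume l: "(Q, B, t') \<in> set ?l"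
      then obtain k w where k: "k \<le> K" and w: "w \<in> site (2 ^ k) ` window K" and
        QB: "Q = cube k w" "B = list_of (nbhd k w \<inter> window K)" "t' = t k"
        unfolding set_levels set_level t_def by blast
      have wl: "w \<in> lattice" using w by auto
      let ?n = "2 ^ (k * ?d) :: nat"
      have n: "1 \<le> ?n" "k \<le> ?n"
      proof -
        have "k * 1 \<le> k * ?d" by (intro mult_le_mono2) (simp add: Suc_leI)
        then have "k \<le> k * ?d" by simp
        also have "\<dots> < 2 ^ (k * ?d)" by (rule less_exp)
        finally show "k \<le> ?n" by simp
      qed simp
      have lenB: "length B \<le> 3 ^ ?d * ?n"
      proof -
        have "length B = card (nbhd k w \<inter> window K)"
          unfolding QB using distinct_card[OF list_of(2), of "nbhd k w \<inter> window K"]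
          by (simp add: list_of finite_window)
        also have "\<dots> \<le> card (nbhd k w)" by (intro card_mono finite_nbhd) auto
        finally show ?thesis by (simp add: card_nbhd)
      qed
      have t: "0 \<le> t k" "t k \<le> 1 - s"
      proof -
        have "(1::real) \<le> 3 ^ ?d * 2 ^ (k + 1)"
          using mult_mono[of 1 "3 ^ ?d" 1 "2 ^ (k + 1) :: real"] one_le_power[of "3::real" ?d]
            one_le_power[of "2::real" "k + 1"] by simp
        then have "t k \<le> s" using s unfolding t_def by (auto simp: divide_le_eq)
        then show "t k \<le> 1 - s" using s by simp
        show "0 \<le> t k" using s by (simp add: t_def)
      qed
      have "measure_pmf.prob (Pi_pmf Q 0 (\<lambda>_. map_pmf (\<lambda>k. k - M) ?\<nu>)) {e. crowded Q e} \<le> (2 * exp (-\<beta>)) ^ card Q"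
        by (rule prob_crowded_le) (use \<beta> int M wl in \<open>auto simp: QB finite_cube\<close>)
      also have "\<dots> = c0 ^ ?n * (s ^ (3 ^ ?d)) ^ ?n"
        using \<beta> wl by (simp add: QB card_cube b_def power_mult_distrib)
      also have "\<dots> \<le> t k * s ^ length B"
      proof (intro mult_mono)
        have "c0 ^ ?n \<le> (s / (2 * 3 ^ ?d) * (1 / 2)) ^ ?n"
          using c0 by (intro power_mono) auto
        also have "\<dots> = (s / (2 * 3 ^ ?d)) ^ ?n * (1 / 2) ^ ?n" by (rule power_mult_distrib)
        also have "\<dots> \<le> (s / (2 * 3 ^ ?d)) ^ 1 * (1 / 2) ^ k"
        proof (intro mult_mono power_decreasing n)
          have "s \<le> 2 * 3 ^ ?d" using s one_le_power[of "3::real" ?d] by linarith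
          then show "s / (2 * 3 ^ ?d) \<le> 1" by simp
        qed (use s in auto)
        also have "\<dots> = t k" by (simp add: t_def power_one_over field_simps)
        finally show "c0 ^ ?n \<le> t k" .
        show "(s ^ (3 ^ ?d)) ^ ?n \<le> s ^ length B"
          unfolding power_mult[symmetric] using lenB s by (intro power_decreasing) auto
      qed (use s t in auto)
      finally have pr: "measure_pmf.prob (Pi_pmf Q 0 (\<lambda>_. map_pmf (\<lambda>k. k - M) ?\<nu>)) {e. crowded Q e} \<le> t k * s ^ length B" .
      have "Q \<subseteq> set ?xs" using w k cube_subset_window unfolding QB xs by blast
      moreover have "Q \<noteq> {}"
        using card_cube[OF wl, of k] unfolding QB by force
      ultimately show "Q \<noteq> {} \<and> Q \<subseteq> set ?xs \<and> set B \<subseteq> set ?xs \<and> 0 \<le> t' \<and> t' \<le> 1 - s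
        \<and> measure_pmf.prob (Pi_pmf Q 0 (\<lambda>_. map_pmf (\<lambda>k. k - M) ?\<nu>)) {e. crowded Q e} \<le> t' * s ^ length B"
        using t pr unfolding QB(3) by (auto simp: QB(2) list_of finite_window xs)
    qed (use xs phi s c cP in auto)
    also have "\<dots> \<le> measure_pmf.expectation (Pi_pmf (set ?xs) 0 (\<lambda>_. ?\<nu>))
        (\<lambda>N. \<phi> {z\<in>window K. N z = 0 \<or> C < (\<Sum>y\<in>window K. N y * A (norm (y - z)))})"
      using phi(2) le by (intro expectation_mono_unit) auto
    finally show "measure_pmf.expectation (Pi_pmf (window K) 0 (\<lambda>_. \<nu>')) (\<lambda>N. \<phi> {y\<in>window K. N y = 0})
      \<le> measure_pmf.expectation (Pi_pmf (window K) 0 (\<lambda>_. poisson_pmf \<mu>))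
        (\<lambda>N. \<phi> {z\<in>window K. N z = 0 \<or> C < (\<Sum>y\<in>window K. N y * A (norm (y - z)))})"
      unfolding xs .
  qed
qed

section \<open>Poisson processes on a lattice\<close>

lemma infinite_lattice: "infinite (lattice :: 'a::euclidean_space set)"
proof -
  obtain b :: 'a where b: "b \<in> Basis" by (meson nonempty_Basis ex_in_conv)
  have "inj (\<lambda>n::nat. real n *\<^sub>R b)"
    using b nonzero_Basis[of b] by (auto simp: inj_def)
  moreover have "range (\<lambda>n::nat. real n *\<^sub>R b) \<subseteq> lattice"
    using b by (auto simp: lattice_def inner_Basis)
  ultimately show ?thesis using infinite_iff_countable_subset by blast
qed

lemma sets_Collect_finite_section:
  assumes "finite L" "\<And>z. z \<in> L \<Longrightarrow> {w \<in> space N. z \<in> occ w} \<in> sets N"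
  shows "{w \<in> space N. Q (occ w \<inter> L)} \<in> sets N"
proof -
  have "{w \<in> space N. Q (occ w \<inter> L)} = (\<Union>T\<in>{T\<in>Pow L. Q T}. {w \<in> space N. \<forall>z\<in>L. z \<in> occ w \<longleftrightarrow> z \<in> T})"
  proof (intro equalityI subsetI)
    fix w assume "w \<in> {w \<in> space N. Q (occ w \<inter> L)}"
    then show "w \<in> (\<Union>T\<in>{T\<in>Pow L. Q T}. {w \<in> space N. \<forall>z\<in>L. z \<in> occ w \<longleftrightarrow> z \<in> T})"
      by (intro UN_I[of "occ w \<inter> L"]) auto
  next
    fix w assume "w \<in> (\<Union>T\<in>{T\<in>Pow L. Q T}. {w \<in> space N. \<forall>z\<in>L. z \<in> occ w \<longleftrightarrow> z \<in> T})"
    then obtain T where T: "T \<subseteq> L" "Q T" "w \<in> space N" "\<forall>z\<in>L. z \<in> occ w \<longleftrightarrow> z \<in> T" by blast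
    then have "occ w \<inter> L = T" by blast
    then show "w \<in> {w \<in> space N. Q (occ w \<inter> L)}" using T by simp
  qed
  also have "\<dots> \<in> sets N"
  proof (intro sets.finite_UN)
    fix T
    show "{w \<in> space N. \<forall>z\<in>L. z \<in> occ w \<longleftrightarrow> z \<in> T} \<in> sets N"
    proof (intro sets.sets_Collect_finite_All assms(1))
      show "{w \<in> space N. z \<in> occ w \<longleftrightarrow> z \<in> T} \<in> sets N" if "z \<in> L" for z
        using assms(2)[OF that] sets.sets_Collect_neg[OF assms(2)[OF that]] by (cases "z \<in> T") auto
    qed
  qed (use assms in auto)
  finally show ?thesis .
qed

definition occupied :: "real \<Rightarrow> 'a::euclidean_space set \<Rightarrow> 'a set" where
  "occupied s V = {z \<in> lattice. V \<inter> cell s z \<noteq> {}}"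

lemma occupied_eq: "occupied s V = site s ` V"
  by (auto simp: occupied_def cell_def)

lemma occupied_subset: "occupied s V \<subseteq> lattice"
  by (auto simp: occupied_def)

lemma finite_occupied_cball: "finite (occupied s V \<inter> cball 0 r)"
  by (rule finite_subset[OF _ finite_lattice_cball[of r]]) (auto simp: occupied_def)

locale poisson_process = prob_space M for M :: "'w measure" +
  fixes lam :: real and X :: "'w \<Rightarrow> 'a::euclidean_space set"
  assumes proc: "homogeneous_poisson_process M lam X" and lam: "lam > 0"
begin

lemma finite_points: "w \<in> space M \<Longrightarrow> bounded B \<Longrightarrow> finite (X w \<inter> B)"
  using proc by (auto simp: homogeneous_poisson_process_def)

lemma measurable_card:
  "B \<in> sets borel \<Longrightarrow> bounded B \<Longrightarrow> (\<lambda>w. card (X w \<inter> B)) \<in> measurable M (count_space UNIV)"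
  using proc by (auto simp: homogeneous_poisson_process_def)

definition cnt :: "real \<Rightarrow> 'a \<Rightarrow> 'w \<Rightarrow> nat" where
  "cnt s z w = card (X w \<inter> cell s z)"

context
  fixes s :: real
  assumes s: "s > 0"
begin

lemma measurable_cnt [measurable]: "z \<in> lattice \<Longrightarrow> cnt s z \<in> measurable M (count_space UNIV)"
  unfolding cnt_def using s by (intro measurable_card borel_cell bounded_cell)

lemma cnt_eq_0: "w \<in> space M \<Longrightarrow> z \<in> lattice \<Longrightarrow> cnt s z w = 0 \<longleftrightarrow> z \<notin> occupied s (X w)"
  using finite_points[OF _ bounded_cell[OF s]] by (auto simp: cnt_def occupied_def)

lemma occupied_vimage:
  assumes "z \<in> lattice"
  shows "{w \<in> space M. z \<in> occupied s (X w)} = cnt s z -` {k. k \<noteq> 0} \<inter> space M"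
proof (rule set_eqI)
  fix w
  show "w \<in> {w \<in> space M. z \<in> occupied s (X w)} \<longleftrightarrow> w \<in> cnt s z -` {k. k \<noteq> 0} \<inter> space M"
    using cnt_eq_0[OF _ assms, of w] by (simp del: neq0_conv) argo
qed

lemma prob_cnt:
  assumes z: "z \<in> lattice"
  shows "prob (cnt s z -` {k} \<inter> space M) = pmf (poisson_pmf (lam * s ^ DIM('a))) k"
proof -
  have "cnt s z -` {k} \<inter> space M = {w \<in> space M. card (X w \<inter> cell s z) = k}"
    by (auto simp: cnt_def)
  moreover have "\<forall>B\<in>sets borel. bounded B \<longrightarrow> (\<forall>k. prob {w \<in> space M. card (X w \<inter> B) = k}
      = (lam * measure lborel B) ^ k / fact k * exp (- (lam * measure lborel B)))"
    using proc unfolding homogeneous_poisson_process_def by blast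
  then have "prob {w \<in> space M. card (X w \<inter> cell s z) = k}
      = (lam * s ^ DIM('a)) ^ k / fact k * exp (- (lam * s ^ DIM('a)))"
    using borel_cell[OF s z] bounded_cell[OF s z] unfolding measure_cell[OF s z, symmetric] by blast
  ultimately show ?thesis using s lam by simp
qed

lemma indep_vars_cnt:
  assumes "inj_on h {..<n::nat}" "h ` {..<n} \<subseteq> lattice"
  shows "indep_vars (\<lambda>_. count_space UNIV) (\<lambda>i. cnt s (h i)) {..<n}"
proof -
  have "\<forall>i<n. cell s (h i) \<in> sets borel \<and> bounded (cell s (h i))"
    using assms s by (auto intro!: borel_cell bounded_cell)
  moreover have "disjoint_family_on (\<lambda>i. cell s (h i)) {..<n}"
    using assms(1) by (auto simp: disjoint_family_on_def cell_def inj_on_def)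
  ultimately have "(\<forall>i<n. cell s (h i) \<in> sets borel \<and> bounded (cell s (h i))) \<and> disjoint_family_on (\<lambda>i. cell s (h i)) {..<n}" by blast
  moreover have "\<forall>n (B :: nat \<Rightarrow> 'a set).
      (\<forall>i<n. B i \<in> sets borel \<and> bounded (B i)) \<and> disjoint_family_on B {..<n} \<longrightarrow>
      indep_vars (\<lambda>_. count_space UNIV) (\<lambda>i w. card (X w \<inter> B i)) {..<n}"
    using proc unfolding homogeneous_poisson_process_def by (elim conjE)
  from this[THEN spec[of _ n], THEN spec[of _ "\<lambda>i. cell s (h i)"], THEN mp]
    calculation have "indep_vars (\<lambda>_. count_space UNIV) (\<lambda>i w. card (X w \<inter> cell s (h i))) {..<n}"
    by blast
  then show ?thesis by (simp add: cnt_def[abs_def])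
qed

lemma prob_cnt_in:
  assumes L: "finite L" "L \<subseteq> lattice"
  shows "prob {w \<in> space M. \<forall>z\<in>L. cnt s z w \<in> B z}
    = (\<Prod>z\<in>L. prob (cnt s z -` B z \<inter> space M))"
proof (cases "L = {}")
  case False
  obtain h where h: "bij_betw h {0..<card L} L" using ex_bij_betw_nat_finite[OF L(1)] by blast
  then have h': "bij_betw h {..<card L} L" by (simp add: lessThan_atLeast0)
  have "indep_vars (\<lambda>_. count_space UNIV) (\<lambda>i. cnt s (h i)) {..<card L}"
    using h' L by (intro indep_vars_cnt) (auto simp: bij_betw_def)
  then have "prob (\<Inter>i\<in>{..<card L}. cnt s (h i) -` B (h i) \<inter> space M)
      = (\<Prod>i\<in>{..<card L}. prob (cnt s (h i) -` B (h i) \<inter> space M))"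
  proof (rule indep_varsD)
    have "0 \<in> {..<card L}" using False L by (simp add: card_gt_0_iff)
    then show "{..<card L} \<noteq> {}" by blast
  qed auto
  also have "\<dots> = (\<Prod>z\<in>L. prob (cnt s z -` B z \<inter> space M))"
    by (rule prod.reindex_bij_betw[OF h'])
  also have "(\<Inter>i\<in>{..<card L}. cnt s (h i) -` B (h i) \<inter> space M)
      = (\<Inter>z\<in>h ` {..<card L}. cnt s z -` B z \<inter> space M)"
    by simp
  also have "h ` {..<card L} = L" using h' by (simp add: bij_betw_def)
  also have "(\<Inter>z\<in>L. cnt s z -` B z \<inter> space M) = {w \<in> space M. \<forall>z\<in>L. cnt s z w \<in> B z}" using False by auto
  finally show ?thesis .
qed (simp add: prob_space)

text \<open>The vector of counts takes countably many values, so its law is found atom by atom from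
  independence. This moves window events from the abstract probability space to
  \<open>Pi_pmf\<close>, where the exploration takes place.\<close>

lemma
  assumes L: "finite L" "L \<subseteq> lattice"
  shows prob_cnt_Pi_pmf: "prob {w \<in> space M. (\<lambda>z. if z \<in> L then cnt s z w else 0) \<in> S}
      = measure_pmf.prob (Pi_pmf L 0 (\<lambda>_. poisson_pmf (lam * s ^ DIM('a)))) S" (is "_ = measure_pmf.prob ?P S")
    and sets_cnt: "{w \<in> space M. (\<lambda>z. if z \<in> L then cnt s z w else 0) \<in> S} \<in> events"
proof -
  let ?f = "\<lambda>w z. if z \<in> L then cnt s z w else 0"
  let ?E = "\<lambda>g. {w \<in> space M. \<forall>z\<in>L. cnt s z w \<in> {g z}}"
  let ?C = "PiE_dflt L 0 (\<lambda>_. UNIV) :: ('a \<Rightarrow> nat) set"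
  have mu: "lam * s ^ DIM('a) > 0" using lam s by simp
  have C: "set_pmf ?P = ?C" using L(1) mu by (simp add: set_Pi_pmf o_def)
  have countable: "countable (S \<inter> ?C)" using countable_set_pmf[of ?P] unfolding C by (rule countable_subset[rotated]) auto
  have E: "?E g \<in> events" for g
  proof (intro sets.sets_Collect_finite_All L(1))
    fix z assume "z \<in> L"
    then have "cnt s z -` {g z} \<inter> space M \<in> events"
      using L by (intro measurable_sets[OF measurable_cnt]) auto
    also have "cnt s z -` {g z} \<inter> space M = {w \<in> space M. cnt s z w \<in> {g z}}" by auto
    finally show "{w \<in> space M. cnt s z w \<in> {g z}} \<in> events" .
  qed
  have E': "?f w = g \<longleftrightarrow> w \<in> ?E g" if "g \<in> ?C" "w \<in> space M" for g w
    using that by (auto simp: PiE_dflt_def fun_eq_iff)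
  have fC: "?f w \<in> ?C" for w by (auto simp: PiE_dflt_def)
  have eq: "{w \<in> space M. ?f w \<in> S} = (\<Union>g\<in>S \<inter> ?C. ?E g)"
    using E' fC by blast
  show "{w \<in> space M. ?f w \<in> S} \<in> events"
    unfolding eq using countable E by (intro sets.countable_UN') auto
  have "emeasure M {w \<in> space M. ?f w \<in> S} = (\<integral>\<^sup>+g. emeasure M (?E g) \<partial>count_space (S \<inter> ?C))"
    unfolding eq using countable E
    by (intro emeasure_UN_countable) (auto simp: disjoint_family_on_def PiE_dflt_def fun_eq_iff, metis)
  also have "\<dots> = (\<integral>\<^sup>+g. ennreal (pmf ?P g) \<partial>count_space (S \<inter> ?C))"
  proof (rule nn_integral_cong)
    fix g assume g: "g \<in> space (count_space (S \<inter> ?C))"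
    have "prob (?E g) = (\<Prod>z\<in>L. pmf (poisson_pmf (lam * s ^ DIM('a))) (g z))"
      unfolding prob_cnt_in[OF L] using L by (intro prod.cong prob_cnt) auto
    also have "\<dots> = pmf ?P g"
      using g L(1) by (subst pmf_Pi') (auto simp: PiE_dflt_def)
    finally show "emeasure M (?E g) = ennreal (pmf ?P g)" by (simp add: emeasure_eq_measure)
  qed
  also have "\<dots> = emeasure ?P (S \<inter> ?C)" by (rule nn_integral_pmf)
  also have "\<dots> = emeasure ?P S" unfolding C[symmetric] by (rule emeasure_Int_set_pmf)
  finally show "prob {w \<in> space M. ?f w \<in> S} = measure_pmf.prob ?P S"
    by (simp add: measure_def)
qed

lemma sets_Collect_occupied:
  assumes "finite L" "L \<subseteq> lattice"
  shows "{w \<in> space M. Q (occupied s (X w) \<inter> L)} \<in> events"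
proof (rule sets_Collect_finite_section[OF assms(1)])
  fix z assume "z \<in> L"
  then have z: "z \<in> lattice" using assms by auto
  have "{w \<in> space M. z \<in> occupied s (X w)} = cnt s z -` {k. k \<noteq> 0} \<inter> space M"
    by (rule occupied_vimage[OF z])
  also have "\<dots> \<in> events" by (rule measurable_sets[OF measurable_cnt[OF z]]) simp
  finally show "{w \<in> space M. z \<in> occupied s (X w)} \<in> events" .
qed

lemma sets_reach_occupied:
  assumes "0 \<le> r"
  shows "{w \<in> space M. reach (occupied s (X w)) (gilbert_edges r (occupied s (X w))) m n} \<in> events"
proof -
  let ?L = "lattice \<inter> cball 0 (max m n + r)"
  have "occupied s V \<inter> ?L = occupied s V \<inter> cball 0 (max m n + r)" for V :: "'a set"
    using occupied_subset by blast
  then show ?thesis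
    using sets_Collect_occupied[of ?L "\<lambda>A. reach A (gilbert_edges r A) m n"]
      finite_lattice_cball[of "max m n + r", where ?'a = 'a]
    by (subst reach_gilbert_restrict[OF assms]) simp
qed

abbreviation lattice_percolation :: "real \<Rightarrow> 'w set" where
  "lattice_percolation r \<equiv> {w \<in> space M. percolates (occupied s (X w)) (gilbert_edges r (occupied s (X w)))}"

lemma sets_lattice_percolation: "0 \<le> r \<Longrightarrow> lattice_percolation r \<in> events"
  unfolding percolates_iff_reach[OF finite_occupied_cball]
  by (intro sets.sets_Collect_countable_Ex sets.sets_Collect_countable_All sets_reach_occupied)

text \<open>Kolmogorov's 0-1 law for the counts along an enumeration of the cells: deleting the
  finitely many cells of index below \<open>k\<close> does not affect percolation, so the event is
  determined by the remaining counts.\<close>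

lemma prob_lattice_percolation:
  assumes r: "0 \<le> r"
  shows "prob (lattice_percolation r) = 0 \<or> prob (lattice_percolation r) = 1"
proof -
  define h :: "nat \<Rightarrow> 'a" where "h = from_nat_into lattice"
  have h: "bij_betw h UNIV lattice"
    unfolding h_def by (intro bij_betw_from_nat_into countable_lattice infinite_lattice)
  have hl: "h i \<in> lattice" for i using h by (auto simp: bij_betw_def)
  define A where "A i = {cnt s (h i) -` S \<inter> space M | S. S \<in> sets (count_space UNIV)}" for i
  show ?thesis
  proof (rule kolmogorov_0_1_law[of A])
    show "sigma_algebra (space M) (A i)" for i
    proof -
      have "A i = sets (vimage_algebra (space M) (cnt s (h i)) (count_space UNIV))"
        unfolding A_def by (rule sets_vimage_algebra2[symmetric]) auto
      then show ?thesis
        using sets.sigma_algebra_axioms[of "vimage_algebra (space M) (cnt s (h i)) (count_space UNIV)"] by simp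
    qed
    show "indep_sets A UNIV"
    proof (subst indep_sets_finite_index_sets, intro allI impI)
      fix J :: "nat set" assume J: "finite J"
      then obtain n where n: "J \<subseteq> {..<n}" using finite_nat_iff_bounded by blast
      have "indep_vars (\<lambda>_. count_space UNIV) (\<lambda>i. cnt s (h i)) {..<n}"
        using h hl by (intro indep_vars_cnt) (auto simp: bij_betw_def inj_on_def)
      then have "indep_sets A {..<n}" by (simp add: indep_vars_def2 A_def[abs_def])
      then show "indep_sets A J" by (rule indep_sets_mono_index[OF n])
    qed
    show "lattice_percolation r \<in> tail_events A"
      unfolding tail_events_def
    proof
      fix k :: nat
      let ?G = "\<Union> (A ` {k..})"
      define N where "N = sigma (space M) ?G"
      have "?G \<subseteq> Pow (space M)" by (auto simp: A_def)
      then have N: "space N = space M" "sets N = sigma_sets (space M) ?G" by (auto simp: N_def)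
      define F where "F = h ` {..<k}"
      have occ: "{w \<in> space N. z \<in> occupied s (X w)} \<in> sets N" if "z \<in> lattice - F" for z
      proof -
        have "z \<in> range h" using that h by (auto simp: bij_betw_def)
        then obtain i where "z = h i" by blast
        moreover have "k \<le> i" using that \<open>z = h i\<close> unfolding F_def by (intro leI) auto
        ultimately have i: "z = h i" "k \<le> i" .
        have "{w \<in> space N. z \<in> occupied s (X w)} = cnt s z -` {k. k \<noteq> 0} \<inter> space M"
          unfolding N by (rule occupied_vimage) (use that in simp)
        moreover have "cnt s z -` {k. k \<noteq> 0} \<inter> space M \<in> A i"
          unfolding A_def i(1) by (rule CollectI, rule exI[of _ "{k. k \<noteq> 0}"]) simp
        then have "cnt s z -` {k. k \<noteq> 0} \<inter> space M \<in> \<Union> (A ` {k..})"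
          by (rule UN_I[rotated]) (simp add: i(2))
        ultimately show ?thesis unfolding N by (simp only: sigma_sets.Basic)
      qed
      have perc: "percolates (occupied s V) (gilbert_edges r (occupied s V)) \<longleftrightarrow>
          (\<exists>m::nat. \<forall>n::nat. reach (occupied s V - F) (gilbert_edges r (occupied s V - F)) m n)" for V :: "'a set"
      proof -
        have "finite F" by (simp add: F_def)
        show ?thesis
          unfolding percolates_iff_reach[OF finite_occupied_cball]
        proof
          assume "\<exists>m::nat. \<forall>n::nat. reach (occupied s V) (gilbert_edges r (occupied s V)) m n"
          then obtain m :: nat where "\<And>n::nat. reach (occupied s V) (gilbert_edges r (occupied s V)) m n"
            by auto
          then show "\<exists>m::nat. \<forall>n::nat. reach (occupied s V - F) (gilbert_edges r (occupied s V - F)) m n"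
            by (rule reach_gilbert_delete_finite[OF r \<open>finite F\<close>])
        next
          assume "\<exists>m::nat. \<forall>n::nat. reach (occupied s V - F) (gilbert_edges r (occupied s V - F)) m n"
          then obtain m :: nat where "\<And>n::nat. reach (occupied s V - F) (gilbert_edges r (occupied s V - F)) m n"
            by auto
          then have "reach (occupied s V) (gilbert_edges r (occupied s V)) m n" for n :: nat
            by (rule reach_gilbert_mono) simp
          then show "\<exists>m::nat. \<forall>n::nat. reach (occupied s V) (gilbert_edges r (occupied s V)) m n"
            by auto
        qed
      qed
      have "{w \<in> space N. reach (occupied s (X w) - F) (gilbert_edges r (occupied s (X w) - F)) m n} \<in> sets N" for m n
      proof -
        let ?L = "(lattice - F) \<inter> cball 0 (max m n + r)"
        have "(occupied s V - F) \<inter> cball 0 (max m n + r) = occupied s V \<inter> ?L" for V :: "'a set"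
          using occupied_subset by blast
        moreover have "finite ?L" by (rule finite_subset[OF _ finite_lattice_cball]) auto
        ultimately show ?thesis
          using sets_Collect_finite_section[of ?L N "\<lambda>w. occupied s (X w)" "\<lambda>A. reach A (gilbert_edges r A) m n"] occ
          by (subst reach_gilbert_restrict[OF r]) simp
      qed
      then have "{w \<in> space N. \<exists>m::nat. \<forall>n::nat. reach (occupied s (X w) - F) (gilbert_edges r (occupied s (X w) - F)) m n} \<in> sets N"
        by (intro sets.sets_Collect_countable_Ex sets.sets_Collect_countable_All)
      then show "lattice_percolation r \<in> sigma_sets (space M) ?G"
        unfolding perc N .
    qed
  qed
qed

end

end

section \<open>Measurability of SINR percolation\<close>

lemma infsum_ennreal_eq_suminf: "(\<Sum>\<^sub>\<infinity>i. f i) = (\<Sum>i. f i)" for f :: "nat \<Rightarrow> ennreal"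
proof -
  have "(f has_sum infsum f UNIV) UNIV"
    by (intro has_sum_infsum nonneg_summable_on_complete) simp
  then show ?thesis using has_sum_imp_sums sums_unique by blast
qed

lemma infsum_if_ennreal:
  "infsum f {i. P i} = (\<Sum>i. if P i then f i else 0)" for f :: "nat \<Rightarrow> ennreal"
proof -
  have "infsum f {i. P i} = (\<Sum>\<^sub>\<infinity>i. if P i then f i else 0)"
    by (rule infsum_cong_neutral) auto
  then show ?thesis by (simp add: infsum_ennreal_eq_suminf)
qed

section \<open>A measurable enumeration of the points\<close>

context poisson_process
begin

text \<open>Runs through all cells of all meshes \<open>1 / Suc n\<close>. The process is accessible
  only through counts in Borel sets, so its points are recovered as those that are alone in some
  such cell.\<close>

definition iso_cell :: "nat \<Rightarrow> 'a set" where
  "iso_cell i = cell (1 / Suc (fst (prod_decode i))) (from_nat_into lattice (snd (prod_decode i)))"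

definition valid :: "nat \<Rightarrow> 'w \<Rightarrow> bool" where
  "valid i w \<longleftrightarrow> card (X w \<inter> iso_cell i) = 1"

definition pt :: "nat \<Rightarrow> 'w \<Rightarrow> 'a" where
  "pt i w = (if valid i w then the_elem (X w \<inter> iso_cell i) else 0)"

lemma iso_cell_sets: "iso_cell i \<in> sets borel" "bounded (iso_cell i)"
proof -
  have l: "(lattice :: 'a set) \<noteq> {}" by (rule infinite_imp_nonempty[OF infinite_lattice])
  show "iso_cell i \<in> sets borel" "bounded (iso_cell i)"
    unfolding iso_cell_def using from_nat_into[OF l] by (auto intro!: borel_cell bounded_cell)
qed

lemma sets_valid [measurable]: "Measurable.pred M (valid i)"
proof -
  have "(\<lambda>w. card (X w \<inter> iso_cell i)) \<in> measurable M (count_space UNIV)"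
    by (rule measurable_card[OF iso_cell_sets])
  then show ?thesis unfolding valid_def[abs_def] by measurable
qed

lemma pt_valid:
  assumes "valid i w"
  shows "X w \<inter> iso_cell i = {pt i w}" "pt i w \<in> X w"
proof -
  obtain x where x: "X w \<inter> iso_cell i = {x}"
    using assms by (auto simp: valid_def card_1_singleton_iff)
  then show "X w \<inter> iso_cell i = {pt i w}" using assms by (simp add: pt_def)
  then show "pt i w \<in> X w" by blast
qed

text \<open>The only point of the cell lies in \<open>B\<close> if and only if the cell intersected
  with \<open>B\<close> still contains one point, which is an event about counts.\<close>

lemma measurable_pt [measurable]: "pt i \<in> borel_measurable M"
proof (rule borel_measurableI)
  fix B :: "'a set" assume "open B"
  then have B: "iso_cell i \<inter> B \<in> sets borel" "bounded (iso_cell i \<inter> B)"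
    using iso_cell_sets[of i] by (auto intro: bounded_subset)
  have "(\<lambda>w. card (X w \<inter> (iso_cell i \<inter> B))) \<in> measurable M (count_space UNIV)"
    by (rule measurable_card[OF B])
  then have [measurable]: "Measurable.pred M (\<lambda>w. card (X w \<inter> (iso_cell i \<inter> B)) = 1)" by measurable
  have "pt i w \<in> B \<longleftrightarrow> card (X w \<inter> (iso_cell i \<inter> B)) = 1" if "valid i w" for w
  proof -
    have "X w \<inter> (iso_cell i \<inter> B) = {pt i w} \<inter> B" using pt_valid(1)[OF that] by blast
    then show ?thesis by (cases "pt i w \<in> B") auto
  qed
  then have "pt i -` B \<inter> space M = {w \<in> space M. if valid i w then card (X w \<inter> (iso_cell i \<inter> B)) = 1 else 0 \<in> B}"
    by (auto simp: pt_def split: if_splits)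
  also have "\<dots> \<in> events" by measurable
  finally show "pt i -` B \<inter> space M \<in> events" .
qed

text \<open>Local finiteness leaves a positive gap \<open>e\<close> between \<open>x\<close> and the
  other points nearby, and cells of diameter below \<open>e\<close> separate them.\<close>

lemma point_isolated:
  assumes w: "w \<in> space M" and x: "x \<in> X w"
  shows "\<exists>i. valid i w \<and> pt i w = x"
proof -
  \<comment> \<open>Two points of one cell of side at most \<open>1\<close> are within this
    distance.\<close>
  let ?S = "X w \<inter> cball x (2 * DIM('a))"
  have fin: "finite ?S" by (rule finite_points[OF w]) simp
  obtain e where e: "e > 0" "\<And>y. y \<in> ?S - {x} \<Longrightarrow> e \<le> dist x y"
    using finite_set_avoid[OF fin, of x] by blast
  obtain n :: nat where n: "2 * DIM('a) / e < real (Suc n)"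
    using reals_Archimedean2 less_trans by (metis of_nat_Suc lessI of_nat_less_iff)
  define s where "s = 1 / real (Suc n)"
  have s: "s > 0" "s \<le> 1" by (auto simp: s_def)
  obtain j where j: "from_nat_into lattice j = site s x"
    using from_nat_into_surj[OF countable_lattice site_in_lattice] by blast
  define i where "i = prod_encode (n, j)"
  have Q: "iso_cell i = cell s (site s x)" by (simp add: iso_cell_def i_def s_def j)
  have "y = x" if y: "y \<in> X w" "y \<in> cell s (site s x)" for y
  proof (rule ccontr)
    assume "y \<noteq> x"
    have "site s y = site s x" using y by (simp add: mem_cell)
    then have "norm (x - y) \<le> norm (x - s *\<^sub>R site s x) + norm (y - s *\<^sub>R site s y)"
      using norm_triangle_ineq4[of "x - s *\<^sub>R site s x" "y - s *\<^sub>R site s y"] by simp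
    also have "\<dots> \<le> s * DIM('a) + s * DIM('a)" by (intro add_mono norm_site s)
    finally have d: "dist x y \<le> 2 * s * DIM('a)" by (simp add: dist_norm)
    also have "\<dots> \<le> 2 * real DIM('a)" using s by (intro mult_right_mono) auto
    finally have "e \<le> dist x y" using y \<open>y \<noteq> x\<close> by (intro e(2)) auto
    then have "e \<le> 2 * s * DIM('a)" using d by simp
    moreover have "2 * s * DIM('a) < e" using n e(1) by (simp add: s_def field_simps)
    ultimately show False by simp
  qed
  then have "X w \<inter> iso_cell i = {x}" using x unfolding Q by (auto simp: mem_cell)
  then have "valid i w" by (simp add: valid_def)
  then show ?thesis using pt_valid(1)[of i w] \<open>X w \<inter> iso_cell i = {x}\<close> by auto
qed

text \<open>A point is alone in many cells; keeping its first index avoids counting it repeatedly in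
  the interference.\<close>

definition first :: "nat \<Rightarrow> 'w \<Rightarrow> bool" where
  "first i w \<longleftrightarrow> valid i w \<and> (\<forall>j<i. valid j w \<longrightarrow> pt j w \<noteq> pt i w)"

lemma sets_first [measurable]: "Measurable.pred M (first i)"
  unfolding first_def[abs_def] by measurable

lemma bij_betw_pt:
  assumes w: "w \<in> space M"
  shows "bij_betw (\<lambda>i. pt i w) {i. first i w} (X w)"
  unfolding bij_betw_def
proof
  show "inj_on (\<lambda>i. pt i w) {i. first i w}"
  proof (rule inj_onI)
    fix i j assume "i \<in> {i. first i w}" "j \<in> {i. first i w}" "pt i w = pt j w"
    then show "i = j" by (cases i j rule: linorder_cases) (auto simp: first_def)
  qed
  show "(\<lambda>i. pt i w) ` {i. first i w} = X w"
  proof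
    show "(\<lambda>i. pt i w) ` {i. first i w} \<subseteq> X w" by (auto simp: first_def pt_valid)
    show "X w \<subseteq> (\<lambda>i. pt i w) ` {i. first i w}"
    proof
      fix x assume "x \<in> X w"
      then have ex: "\<exists>i. valid i w \<and> pt i w = x" by (rule point_isolated[OF w])
      define i where "i = (LEAST i. valid i w \<and> pt i w = x)"
      have "valid i w \<and> pt i w = x" unfolding i_def using ex by (rule LeastI_ex)
      moreover have "\<not> (valid j w \<and> pt j w = x)" if "j < i" for j
        using that unfolding i_def by (rule not_less_Least)
      ultimately show "x \<in> (\<lambda>i. pt i w) ` {i. first i w}"
        by (intro image_eqI[of _ _ i]) (auto simp: first_def)
    qed
  qed
qed

lemma infsum_points:
  fixes f :: "'a \<Rightarrow> ennreal"
  assumes w: "w \<in> space M"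
  shows "infsum f (X w - B) = (\<Sum>i. if first i w \<and> pt i w \<notin> B then f (pt i w) else 0)"
proof -
  have "bij_betw (\<lambda>i. pt i w) {i. first i w \<and> pt i w \<notin> B} (X w - B)"
    using bij_betw_pt[OF w] by (auto simp: bij_betw_def inj_on_def)
  then have "infsum f (X w - B) = infsum (\<lambda>i. f (pt i w)) {i. first i w \<and> pt i w \<notin> B}"
    by (rule infsum_reindex_bij_betw[symmetric])
  then show ?thesis by (simp add: infsum_if_ennreal)
qed

lemma measurable_interference:
  assumes l: "continuous_on {0..} l"
  shows "(\<lambda>w. interference p l (X w) (pt i w) (pt j w) (pt k w)) \<in> borel_measurable M"
proof -
  have "(\<lambda>r. l (max 0 r)) \<in> borel_measurable borel"
    by (intro borel_measurable_continuous_onI continuous_on_compose2[OF l]) (auto intro!: continuous_intros)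
  then have lm [measurable]: "(\<lambda>w. l (dist (f w) (g w))) \<in> borel_measurable M"
    if [measurable]: "f \<in> borel_measurable M" "g \<in> borel_measurable M" for f g :: "'w \<Rightarrow> 'a"
    using measurable_compose[of "\<lambda>w. dist (f w) (g w)" M borel "\<lambda>r. l (max 0 r)" borel] by simp
  have eq: "interference p l (X w) (pt i w) (pt j w) (pt k w) = (\<Sum>h. if first h w \<and> pt h w \<noteq> pt i w
      \<and> pt h w \<noteq> pt j w then ennreal (p * l (dist (pt h w) (pt k w))) else 0)" if "w \<in> space M" for w
    by (simp add: interference_def infsum_points[OF that])
  have "(\<lambda>w. \<Sum>h. if first h w \<and> pt h w \<noteq> pt i w \<and> pt h w \<noteq> pt j w
      then ennreal (p * l (dist (pt h w) (pt k w))) else 0) \<in> borel_measurable M"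
    by measurable
  then show ?thesis
    by (subst measurable_cong[OF eq])
qed

lemma sets_sinr_edges:
  assumes l: "continuous_on {0..} l"
  shows "{w \<in> space M. valid i w \<and> valid j w \<and> (pt i w, pt j w) \<in> sinr_edges p tau No l gam (X w)} \<in> events"
proof -
  have "(\<lambda>r. l (max 0 r)) \<in> borel_measurable borel"
    by (intro borel_measurable_continuous_onI continuous_on_compose2[OF l]) (auto intro!: continuous_intros)
  then have lm [measurable]: "(\<lambda>w. l (dist (pt i w) (pt j w))) \<in> borel_measurable M"
    using measurable_compose[of "\<lambda>w. dist (pt i w) (pt j w)" M borel "\<lambda>r. l (max 0 r)" borel] by simp
  note [measurable] = measurable_interference[OF l, of p i j i] measurable_interference[OF l, of p i j j]
  have "{w \<in> space M. valid i w \<and> valid j w \<and> (pt i w, pt j w) \<in> sinr_edges p tau No l gam (X w)}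
    = {w \<in> space M. valid i w \<and> valid j w \<and> pt i w \<noteq> pt j w \<and>
       ennreal tau * (ennreal No + ennreal gam * interference p l (X w) (pt i w) (pt j w) (pt j w))
         < ennreal (p * l (dist (pt i w) (pt j w))) \<and>
       ennreal tau * (ennreal No + ennreal gam * interference p l (X w) (pt i w) (pt j w) (pt i w))
         < ennreal (p * l (dist (pt i w) (pt j w)))}"
    by (auto simp: sinr_edges_def pt_valid)
  also have "\<dots> \<in> events" by measurable
  finally show ?thesis .
qed

text \<open>Paths of each length run through points with valid indices, so reachability is a
  countable union over indices, and \<open>percolates_iff_reach\<close> applies.\<close>

lemma sets_percolates:
  assumes sub: "\<And>w. E w \<subseteq> X w \<times> X w"
    and E: "\<And>i j. {w \<in> space M. valid i w \<and> valid j w \<and> (pt i w, pt j w) \<in> E w} \<in> events"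
  shows "{w \<in> space M. percolates (X w) (E w)} \<in> events"
proof -
  have E' [measurable]: "Measurable.pred M (\<lambda>w. valid i w \<and> valid j w \<and> (pt i w, pt j w) \<in> E w)" for i j
    using E[of i j] by (simp add: pred_def)
  have pow: "Measurable.pred M (\<lambda>w. valid i w \<and> valid j w \<and> (pt i w, pt j w) \<in> E w ^^ k)" for i j k
  proof (induction k arbitrary: j)
    case 0
    show ?case by simp
  next
    case (Suc k)
    have eq: "valid i w \<and> valid j w \<and> (pt i w, pt j w) \<in> E w ^^ Suc k \<longleftrightarrow>
       (\<exists>h. (valid i w \<and> valid h w \<and> (pt i w, pt h w) \<in> E w ^^ k) \<and> (valid h w \<and> valid j w \<and> (pt h w, pt j w) \<in> E w))"
      if w: "w \<in> space M" for w
    proof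
      assume a: "valid i w \<and> valid j w \<and> (pt i w, pt j w) \<in> E w ^^ Suc k"
      then obtain y where y: "(pt i w, y) \<in> E w ^^ k" "(y, pt j w) \<in> E w" by auto
      then have "y \<in> X w" using sub by blast
      then obtain h where "valid h w" "pt h w = y" using point_isolated[OF w] by blast
      then show "\<exists>h. (valid i w \<and> valid h w \<and> (pt i w, pt h w) \<in> E w ^^ k) \<and> (valid h w \<and> valid j w \<and> (pt h w, pt j w) \<in> E w)"
        using a y by blast
    qed auto
    have "Measurable.pred M (\<lambda>w. \<exists>h. (valid i w \<and> valid h w \<and> (pt i w, pt h w) \<in> E w ^^ k)
        \<and> (valid h w \<and> valid j w \<and> (pt h w, pt j w) \<in> E w))"
      by (intro pred_intros_countable pred_intros_logic Suc E')
    then show ?case by (subst measurable_cong[OF eq])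
  qed
  have reach: "reach (X w) (E w) m n \<longleftrightarrow>
     (\<exists>i j k. (valid i w \<and> valid j w \<and> (pt i w, pt j w) \<in> E w ^^ k) \<and> norm (pt i w) \<le> m \<and> n \<le> norm (pt j w))"
    if w: "w \<in> space M" for w m n
  proof
    assume "reach (X w) (E w) m n"
    then obtain x y where xy: "x \<in> X w" "(x, y) \<in> (E w)\<^sup>*" "norm x \<le> m" "n \<le> norm y" by (auto simp: reach_def)
    have "y \<in> X w" using xy(2,1) sub by (induction rule: rtrancl_induct) auto
    obtain i j where ij: "valid i w" "pt i w = x" "valid j w" "pt j w = y"
      using point_isolated[OF w xy(1)] point_isolated[OF w \<open>y \<in> X w\<close>] by blast
    obtain k where "(x, y) \<in> E w ^^ k" using xy(2) by (auto simp: rtrancl_power)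
    then show "\<exists>i j k. (valid i w \<and> valid j w \<and> (pt i w, pt j w) \<in> E w ^^ k) \<and> norm (pt i w) \<le> m \<and> n \<le> norm (pt j w)"
      using ij xy by blast
  next
    assume "\<exists>i j k. (valid i w \<and> valid j w \<and> (pt i w, pt j w) \<in> E w ^^ k) \<and> norm (pt i w) \<le> m \<and> n \<le> norm (pt j w)"
    then show "reach (X w) (E w) m n" using pt_valid(2) relpow_imp_rtrancl unfolding reach_def by blast
  qed
  have eq: "percolates (X w) (E w) \<longleftrightarrow> (\<exists>m::nat. \<forall>n::nat. \<exists>i j k. (valid i w \<and> valid j w \<and> (pt i w, pt j w) \<in> E w ^^ k)
      \<and> norm (pt i w) \<le> m \<and> n \<le> norm (pt j w))" if w: "w \<in> space M" for w
    using percolates_iff_reach[OF finite_points[OF w bounded_cball]] reach[OF w] by simp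
  have "Measurable.pred M (\<lambda>w. \<exists>m::nat. \<forall>n::nat. \<exists>i j k. (valid i w \<and> valid j w \<and> (pt i w, pt j w) \<in> E w ^^ k)
      \<and> norm (pt i w) \<le> m \<and> n \<le> norm (pt j w))"
    by (intro pred_intros_countable pred_intros_logic pow) measurable
  then have "Measurable.pred M (\<lambda>w. percolates (X w) (E w))"
    by (subst measurable_cong[OF eq])
  then show ?thesis by (simp add: pred_def)
qed

text \<open>\<open>measure\<close> gives \<open>0\<close> to nonmeasurable sets, so almost sure
  percolation counts in \<open>gamma_crit\<close> only because the event is measurable.\<close>

lemma sets_sinr_percolates:
  assumes "continuous_on {0..} l"
  shows "{w \<in> space M. percolates (X w) (sinr_edges p tau No l gam (X w))} \<in> events"
  by (rule sets_percolates[OF _ sets_sinr_edges[OF assms]]) (auto simp: sinr_edges_def)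

end

section \<open>Absence of percolation at low intensity\<close>

text \<open>Lists of the \<open>k\<close> sites that follow \<open>x\<close> on a path with steps at
  most \<open>r\<close>, without \<open>x\<close> itself; revisits are allowed here and excluded
  later by \<open>distinct\<close>.\<close>

fun paths :: "real \<Rightarrow> nat \<Rightarrow> 'a::euclidean_space \<Rightarrow> 'a list set" where
  "paths r 0 x = {[]}"
| "paths r (Suc k) x = (\<Union>y\<in>lattice \<inter> cball x r. (#) y ` paths r k y)"

lemma card_lattice_cball_le:
  fixes x :: "'a::euclidean_space"
  assumes "x \<in> lattice"
  shows "finite (lattice \<inter> cball x r)" "card (lattice \<inter> cball x r) \<le> card (lattice \<inter> cball (0::'a) r)"
proof -
  have inj: "inj_on (\<lambda>z. z - x) (lattice \<inter> cball x r)" by (auto simp: inj_on_def)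
  have im: "(\<lambda>z. z - x) ` (lattice \<inter> cball x r) \<subseteq> lattice \<inter> cball 0 r"
    using assms by (auto simp: lattice_def inner_diff_left dist_norm norm_minus_commute)
  show "finite (lattice \<inter> cball x r)" by (rule inj_on_finite[OF inj im finite_lattice_cball])
  show "card (lattice \<inter> cball x r) \<le> card (lattice \<inter> cball (0::'a) r)"
    by (rule card_inj_on_le[OF inj im finite_lattice_cball])
qed

lemma card_paths:
  fixes x :: "'a::euclidean_space"
  assumes "x \<in> lattice"
  shows "finite (paths r k x) \<and> card (paths r k x) \<le> card (lattice \<inter> cball (0::'a) r) ^ k"
  using assms
proof (induction k arbitrary: x)
  case (Suc k)
  let ?D = "card (lattice \<inter> cball (0::'a) r)"
  have fin: "finite (lattice \<inter> cball x r)" by (rule card_lattice_cball_le[OF Suc.prems])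
  have "card (paths r (Suc k) x) \<le> (\<Sum>y\<in>lattice \<inter> cball x r. card ((#) y ` paths r k y))"
    unfolding paths.simps by (rule card_UN_le[OF fin])
  also have "\<dots> \<le> (\<Sum>y\<in>lattice \<inter> cball x r. ?D ^ k)"
  proof (rule sum_mono)
    fix y assume "y \<in> lattice \<inter> cball x r"
    then have y: "finite (paths r k y)" "card (paths r k y) \<le> ?D ^ k" using Suc.IH[of y] by auto
    show "card ((#) y ` paths r k y) \<le> ?D ^ k" using card_image_le[OF y(1), of "(#) y"] y(2) by simp
  qed
  also have "\<dots> \<le> ?D * ?D ^ k"
    using card_lattice_cball_le(2)[OF Suc.prems, of r] by simp
  finally have "card (paths r (Suc k) x) \<le> ?D ^ Suc k" by simp
  moreover have "finite (paths r (Suc k) x)"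
    unfolding paths.simps using fin Suc.IH by (intro finite_UN_I finite_imageI) auto
  ultimately show ?case by blast
qed simp

lemma length_paths: "xs \<in> paths r k x \<Longrightarrow> length xs = k \<and> set xs \<subseteq> lattice"
proof (induction k arbitrary: x xs)
  case (Suc k)
  then obtain y ys where "xs = y # ys" "ys \<in> paths r k y" "y \<in> lattice" by auto
  then show ?case using Suc.IH[of ys y] by auto
qed simp

lemma rtrancl_path_gilbert:
  assumes "rtrancl_path (\<lambda>a b. (a, b) \<in> gilbert_edges r A) x xs y" "A \<subseteq> lattice"
  shows "set xs \<subseteq> A \<and> norm y \<le> norm x + r * length xs \<and> (\<forall>k\<le>length xs. take k xs \<in> paths r k x)"
  using assms(1)
proof (induction rule: rtrancl_path.induct)
  case (base x)
  then show ?case by simp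
next
  case (step x y ys z)
  have xy: "x \<in> A" "y \<in> A" "dist x y < r" using step(1) by (auto simp: gilbert_edges_def)
  have "norm y \<le> norm x + dist x y" by (metis dist_commute dist_norm norm_triangle_sub)
  moreover have "take k (y # ys) \<in> paths r k x" if "k \<le> length (y # ys)" for k
  proof (cases k)
    case (Suc j)
    then have "take j ys \<in> paths r j y" using step that by simp
    moreover have "y \<in> lattice \<inter> cball x r" using xy assms(2) by auto
    ultimately show ?thesis unfolding Suc paths.simps take_Suc_Cons by blast
  qed simp
  ultimately show ?case using step xy by (auto simp: algebra_simps)
qed

context poisson_process
begin

lemma prob_all_cells:
  assumes s: "s > 0" and L: "finite L" "L \<subseteq> lattice"
  shows "{w \<in> space M. L \<subseteq> occupied s (X w)} \<in> events"
    "prob {w \<in> space M. L \<subseteq> occupied s (X w)} = (1 - exp (- (lam * s ^ DIM('a)))) ^ card L"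
    "{w \<in> space M. L \<inter> occupied s (X w) = {}} \<in> events"
    "prob {w \<in> space M. L \<inter> occupied s (X w) = {}} = exp (- (lam * s ^ DIM('a))) ^ card L"
proof -
  have mu: "lam * s ^ DIM('a) > 0" using lam s by simp
  have "L \<subseteq> O' \<longleftrightarrow> O' \<inter> L = L" "L \<inter> O' = {} \<longleftrightarrow> O' \<inter> L = {}" for O' by auto
  then show "{w \<in> space M. L \<subseteq> occupied s (X w)} \<in> events" "{w \<in> space M. L \<inter> occupied s (X w) = {}} \<in> events"
    using sets_Collect_occupied[OF s L] by auto
  have 0: "prob (cnt s z -` {0} \<inter> space M) = exp (- (lam * s ^ DIM('a)))" if "z \<in> L" for z
    using prob_cnt[OF s, of z 0] mu that L by auto
  have 1: "prob (cnt s z -` {k. k \<noteq> 0} \<inter> space M) = 1 - exp (- (lam * s ^ DIM('a)))" if "z \<in> L" for z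
  proof -
    have "cnt s z -` {k. k \<noteq> 0} \<inter> space M = space M - (cnt s z -` {0} \<inter> space M)" by auto
    moreover have "cnt s z -` {0} \<inter> space M \<in> events"
      using that L by (intro measurable_sets[OF measurable_cnt[OF s]]) auto
    ultimately show ?thesis using 0[OF that] prob_compl[of "cnt s z -` {0} \<inter> space M"] by simp
  qed
  have eq0: "{w \<in> space M. L \<inter> occupied s (X w) = {}} = {w \<in> space M. \<forall>z\<in>L. cnt s z w \<in> {0}}"
    using cnt_eq_0[OF s] L by (intro Collect_cong) (auto, metis Int_iff empty_iff subsetD)
  show "prob {w \<in> space M. L \<inter> occupied s (X w) = {}} = exp (- (lam * s ^ DIM('a))) ^ card L"
    unfolding eq0 prob_cnt_in[OF s L] by (simp add: 0 cong: prod.cong)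
  have eq1: "{w \<in> space M. L \<subseteq> occupied s (X w)} = {w \<in> space M. \<forall>z\<in>L. cnt s z w \<in> {k. k \<noteq> 0}}"
  proof (intro Collect_cong conj_cong refl)
    fix w assume "w \<in> space M"
    then show "L \<subseteq> occupied s (X w) \<longleftrightarrow> (\<forall>z\<in>L. cnt s z w \<in> {k. k \<noteq> 0})"
      using cnt_eq_0[OF s, of w] L unfolding subset_iff by (metis mem_Collect_eq)
  qed
  show "prob {w \<in> space M. L \<subseteq> occupied s (X w)} = (1 - exp (- (lam * s ^ DIM('a)))) ^ card L"
    unfolding eq1 prob_cnt_in[OF s L] by (subst prod.cong[OF refl 1]) simp_all
qed

text \<open>First moment method: percolation forces, for every \<open>k\<close>, an occupied
  self-avoiding path of \<open>k\<close> steps from a bounded set, and the expected number of such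
  paths is at most a constant times the \<open>k\<close>-th power of a number below
  \<open>1\<close>.\<close>

lemma AE_no_lattice_percolation:
  assumes s: "s > 0" and r: "r > 0"
    and small: "card (lattice \<inter> cball (0::'a) r) * (1 - exp (- (lam * s ^ DIM('a)))) < 1"
  shows "AE w in M. \<not> percolates (occupied s (X w)) (gilbert_edges r (occupied s (X w)))"
proof -
  let ?D = "card (lattice \<inter> cball (0::'a) r)" and ?p = "1 - exp (- (lam * s ^ DIM('a)))"
  let ?R = "\<lambda>w m n. reach (occupied s (X w)) (gilbert_edges r (occupied s (X w))) m n"
  have p: "0 \<le> ?p" using lam s by simp
  have "prob {w \<in> space M. \<forall>n::nat. ?R w m n} = 0" for m :: nat
  proof -
    let ?B = "lattice \<inter> cball (0::'a) m"
    let ?A = "{w \<in> space M. \<forall>n::nat. ?R w m n}"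
    have le: "prob ?A \<le> card ?B * (?D * ?p) ^ k" for k
    proof -
      \<comment> \<open>Distinctness makes the cells of a path independent, so that all of them are
        occupied with probability \<open>?p ^ k\<close>.\<close>
      define I where "I = (SIGMA x:?B. {xs \<in> paths r k x. distinct xs})"
      let ?E = "\<lambda>(x, xs). {w \<in> space M. set xs \<subseteq> occupied s (X w)}"
      have finp: "finite {xs \<in> paths r k x. distinct xs}" if "x \<in> lattice" for x :: 'a
        by (rule finite_subset[OF _ conjunct1[OF card_paths[OF that]]]) auto
      have fin: "finite I"
        unfolding I_def using finite_lattice_cball finp by (intro finite_SigmaI) auto
      have len: "length xs = k" "set xs \<subseteq> lattice" "distinct xs" if "(x, xs) \<in> I" for x xs
        using that length_paths[of xs r k x] by (auto simp: I_def)
      have ev: "?E z \<in> events" if "z \<in> I" for z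
        using len[of "fst z" "snd z"] that prob_all_cells(1)[OF s, of "set (snd z)"] by (cases z) auto
      have "?A \<subseteq> (\<Union>z\<in>I. ?E z)"
      proof
        fix w assume w: "w \<in> ?A"
        \<comment> \<open>A path that reaches this norm has at least \<open>k\<close> steps, each of
          length below \<open>r\<close>.\<close>
        obtain n :: nat where n: "m + r * k \<le> n" using real_arch_simple by blast
        obtain x y where xy: "x \<in> occupied s (X w)" "(x, y) \<in> (gilbert_edges r (occupied s (X w)))\<^sup>*"
          "norm x \<le> m" "n \<le> norm y" using w unfolding reach_def by blast
        from xy(2) have "(\<lambda>a b. (a, b) \<in> gilbert_edges r (occupied s (X w)))\<^sup>*\<^sup>* x y"
          by (induction rule: rtrancl_induct) (auto intro: rtranclp.rtrancl_into_rtrancl)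
        then obtain xs where xs: "rtrancl_path (\<lambda>a b. (a, b) \<in> gilbert_edges r (occupied s (X w))) x xs y"
          unfolding rtranclp_eq_rtrancl_path by blast
        obtain ys where ys: "rtrancl_path (\<lambda>a b. (a, b) \<in> gilbert_edges r (occupied s (X w))) x ys y" "distinct (x # ys)"
          using rtrancl_path_distinct[OF xs] by blast
        note g = rtrancl_path_gilbert[OF ys(1) occupied_subset]
        have "m + r * k \<le> m + r * length ys" using g xy n by linarith
        then have k: "k \<le> length ys" using r by simp
        then have "take k ys \<in> paths r k x" using g by blast
        moreover have "distinct (take k ys)" using ys(2) by simp
        moreover have "x \<in> ?B" using xy occupied_subset by auto
        ultimately have "(x, take k ys) \<in> I" by (simp add: I_def)
        moreover have "set (take k ys) \<subseteq> occupied s (X w)" using g set_take_subset[of k ys] by blast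
        ultimately show "w \<in> (\<Union>z\<in>I. ?E z)" using w by (intro UN_I[of "(x, take k ys)"]) auto
      qed
      then have "prob ?A \<le> prob (\<Union>z\<in>I. ?E z)"
        using ev fin by (intro finite_measure_mono sets.finite_UN) auto
      also have "\<dots> \<le> (\<Sum>z\<in>I. prob (?E z))"
        using ev fin by (intro finite_measure_subadditive_finite) auto
      also have "\<dots> = (\<Sum>z\<in>I. ?p ^ k)"
      proof (rule sum.cong[OF refl])
        fix z assume z: "z \<in> I"
        obtain x xs where zz: "z = (x, xs)" by (cases z)
        have "card (set xs) = k" using len[of x xs] z zz distinct_card by metis
        then show "prob (?E z) = ?p ^ k"
          using prob_all_cells(2)[OF s, of "set xs"] len[of x xs] z zz by simp
      qed
      also have "\<dots> = card I * ?p ^ k" by simp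
      also have "\<dots> \<le> (card ?B * ?D ^ k) * ?p ^ k"
      proof (intro mult_right_mono)
        have "card I = (\<Sum>x\<in>?B. card {xs \<in> paths r k x. distinct xs})"
          unfolding I_def using finite_lattice_cball finp by (intro card_SigmaI) auto
        also have "\<dots> \<le> (\<Sum>x\<in>?B. ?D ^ k)"
        proof (rule sum_mono)
          fix x assume "x \<in> ?B"
          then have "finite (paths r k x)" "card (paths r k x) \<le> ?D ^ k" using card_paths[of x r k] by auto
          then show "card {xs \<in> paths r k x. distinct xs} \<le> ?D ^ k"
            using card_mono[of "paths r k x" "{xs \<in> paths r k x. distinct xs}"] by auto
        qed
        also have "\<dots> = card ?B * ?D ^ k" by simp
        finally show "real (card I) \<le> real (card ?B * ?D ^ k)" by (rule of_nat_mono)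
      qed (use p in simp)
      finally show ?thesis by (simp add: power_mult_distrib)
    qed
    have lim: "(\<lambda>k. card ?B * (?D * ?p) ^ k) \<longlonglongrightarrow> real (card ?B) * 0"
      using small p by (intro tendsto_mult tendsto_const LIMSEQ_power_zero) (auto simp: abs_mult)
    have "prob ?A \<le> real (card ?B) * 0"
      by (rule LIMSEQ_le_const[OF lim]) (use le in blast)
    then show ?thesis using measure_nonneg[of M ?A] by simp
  qed
  moreover have "{w \<in> space M. \<forall>n::nat. ?R w m n} \<in> events" for m :: nat
    using r by (intro sets.sets_Collect_countable_All sets_reach_occupied[OF s]) simp
  ultimately have "{w \<in> space M. \<forall>n::nat. ?R w m n} \<in> null_sets M" for m :: nat
    by (intro null_setsI) (simp_all add: emeasure_eq_measure)
  then have "AE w in M. \<forall>m::nat. w \<notin> {w \<in> space M. \<forall>n::nat. ?R w m n}"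
    by (intro AE_all_countable[THEN iffD2] allI AE_not_in)
  then show ?thesis
    using AE_space by eventually_elim (simp add: percolates_iff_reach[OF finite_occupied_cball])
qed

end

section \<open>Percolation at high intensity\<close>

definition kids :: "nat \<times> nat \<Rightarrow> (nat \<times> nat) set" where
  "kids c = {c'. fst c' div 3 = fst c \<and> snd c' div 3 = snd c}"

text \<open>
  A square of side \<open>3 ^ k\<close> is bad if two of its nine subsquares are bad.  The probability of this
  decays doubly exponentially in \<open>k\<close>, and adjacent squares that are not bad contain a common cluster.
\<close>

fun bad :: "nat \<Rightarrow> (nat \<times> nat) set \<Rightarrow> nat \<times> nat \<Rightarrow> bool" where
  "bad 0 U c \<longleftrightarrow> c \<in> U"
| "bad (Suc k) U c \<longleftrightarrow> (\<exists>c1\<in>kids c. \<exists>c2\<in>kids c. c1 \<noteq> c2 \<and> bad k U c1 \<and> bad k U c2)"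

text \<open>The part of a square that is to lie in one cluster: bad subsquares are dropped at every
  scale.\<close>

fun core :: "nat \<Rightarrow> (nat \<times> nat) set \<Rightarrow> nat \<times> nat \<Rightarrow> (nat \<times> nat) set" where
  "core 0 U c = {c}"
| "core (Suc k) U c = (\<Union>c'\<in>{c'\<in>kids c. \<not> bad k U c'}. core k U c')"

text \<open>Sets of \<open>2 ^ k\<close> closed cells that can make \<open>c\<close> bad. Different
  subsquares are disjoint, so under independent closings with probability \<open>q\<close> such a
  set is closed with probability \<open>q ^ (2 ^ k)\<close>.\<close>

fun witnesses :: "nat \<Rightarrow> nat \<times> nat \<Rightarrow> (nat \<times> nat) set set" where
  "witnesses 0 c = {{c}}"
| "witnesses (Suc k) c = (\<Union>(c1, c2)\<in>{(c1, c2)\<in>kids c \<times> kids c. c1 \<noteq> c2}.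
     (\<lambda>(W1, W2). W1 \<union> W2) ` (witnesses k c1 \<times> witnesses k c2))"

definition bigbox :: "nat \<Rightarrow> nat \<times> nat \<Rightarrow> (nat \<times> nat) set" where
  "bigbox k c = {z. fst z div 3 ^ k = fst c \<and> snd z div 3 ^ k = snd c}"

lemma kids_eq: "kids c = (\<lambda>(a, b). (3 * fst c + a, 3 * snd c + b)) ` ({..<3} \<times> {..<3})"
proof
  show "kids c \<subseteq> (\<lambda>(a, b). (3 * fst c + a, 3 * snd c + b)) ` ({..<3} \<times> {..<3})"
  proof
    fix z assume "z \<in> kids c"
    then have z: "fst z div 3 = fst c" "snd z div 3 = snd c" by (auto simp: kids_def)
    have "z = (3 * fst c + fst z mod 3, 3 * snd c + snd z mod 3)"
      unfolding z[symmetric] by (simp add: prod_eq_iff)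
    then show "z \<in> (\<lambda>(a, b). (3 * fst c + a, 3 * snd c + b)) ` ({..<3} \<times> {..<3})"
      by (intro image_eqI[of _ _ "(fst z mod 3, snd z mod 3)"]) auto
  qed
qed (auto simp: kids_def)

lemma finite_kids: "finite (kids c)" and card_kids: "card (kids c) \<le> 9"
proof -
  show "finite (kids c)" unfolding kids_eq by simp
  show "card (kids c) \<le> 9" unfolding kids_eq by (rule order_trans[OF card_image_le]) auto
qed

lemma bigbox_kids: "c' \<in> kids c \<Longrightarrow> bigbox k c' \<subseteq> bigbox (Suc k) c"
  by (auto simp: kids_def bigbox_def power_Suc2 div_mult2_eq simp del: power_Suc)

lemma bad_witness: "bad k U c \<Longrightarrow> \<exists>W\<in>witnesses k c. W \<subseteq> U"
proof (induction k arbitrary: c)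
  case (Suc k)
  then obtain c1 c2 where c: "c1 \<in> kids c" "c2 \<in> kids c" "c1 \<noteq> c2" "bad k U c1" "bad k U c2"
    unfolding bad.simps by blast
  obtain W1 W2 where W: "W1 \<in> witnesses k c1" "W1 \<subseteq> U" "W2 \<in> witnesses k c2" "W2 \<subseteq> U"
    using Suc.IH[OF c(4)] Suc.IH[OF c(5)] by auto
  have 1: "(c1, c2) \<in> {(c1, c2)\<in>kids c \<times> kids c. c1 \<noteq> c2}" using c by simp
  have 2: "W1 \<union> W2 \<in> (\<lambda>(W1, W2). W1 \<union> W2) ` (witnesses k c1 \<times> witnesses k c2)"
    using W(1,3) by (intro image_eqI[of _ _ "(W1, W2)"]) simp_all
  have "W1 \<union> W2 \<in> witnesses (Suc k) c"
    unfolding witnesses.simps by (rule UN_I[OF 1], unfold prod.case, rule 2)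
  then show ?case using W by (intro bexI[of _ "W1 \<union> W2"]) auto
qed simp

lemma witness_size:
  "W \<in> witnesses k c \<Longrightarrow> finite W \<and> card W = 2 ^ k \<and> W \<subseteq> bigbox k c"
proof (induction k arbitrary: c W)
  case 0
  then show ?case by (auto simp: bigbox_def)
next
  case (Suc k)
  then obtain c1 c2 W1 W2 where c: "c1 \<in> kids c" "c2 \<in> kids c" "c1 \<noteq> c2"
    and W: "W1 \<in> witnesses k c1" "W2 \<in> witnesses k c2" "W = W1 \<union> W2" by auto
  have 1: "finite W1" "card W1 = 2 ^ k" "W1 \<subseteq> bigbox k c1" "finite W2" "card W2 = 2 ^ k" "W2 \<subseteq> bigbox k c2"
    using Suc.IH W(1,2) by auto
  have "bigbox k c1 \<inter> bigbox k c2 = {}" using c(3) by (auto simp: bigbox_def prod_eq_iff)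
  then have "card W = 2 ^ k + 2 ^ k" unfolding W(3) using 1 by (subst card_Un_disjoint) auto
  moreover have "W \<subseteq> bigbox (Suc k) c" unfolding W(3) using 1 bigbox_kids c(1,2) by blast
  ultimately show ?case using 1 W(3) by simp
qed

text \<open>There are at most \<open>9 * 9 = 81\<close> pairs of subsquares, so a bound
  \<open>a\<close> on the number of witnesses passes to \<open>81 * a ^ 2\<close>; the extra factor
  \<open>81\<close> turns this into the squaring of \<open>81 * a\<close>.\<close>

lemma card_witnesses: "finite (witnesses k c) \<and> 81 * card (witnesses k c) \<le> 81 ^ (2 ^ k)"
proof (induction k arbitrary: c)
  case (Suc k)
  let ?I = "{(c1, c2)\<in>kids c \<times> kids c. c1 \<noteq> c2}"
  let ?f = "\<lambda>(c1, c2). (\<lambda>(W1, W2). W1 \<union> W2) ` (witnesses k c1 \<times> witnesses k c2)"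
  have I: "finite ?I" by (rule finite_subset[of _ "kids c \<times> kids c"]) (auto simp: finite_kids)
  have "card ?I \<le> card (kids c \<times> kids c)" by (rule card_mono) (auto simp: finite_kids)
  also have "\<dots> \<le> 9 * 9" unfolding card_cartesian_product by (intro mult_mono card_kids) auto
  finally have cI: "card ?I \<le> 81" by simp
  have *: "81 * 81 * card (?f z) \<le> 81 ^ (2 ^ Suc k)" for z
  proof -
    obtain c1 c2 where z: "z = (c1, c2)" by (cases z)
    have "card (?f z) \<le> card (witnesses k c1 \<times> witnesses k c2)"
      unfolding z prod.case using Suc.IH by (intro card_image_le) auto
    then have "81 * 81 * card (?f z) \<le> (81 * card (witnesses k c1)) * (81 * card (witnesses k c2))"
      by (simp add: card_cartesian_product)
    also have "\<dots> \<le> 81 ^ (2 ^ k) * 81 ^ (2 ^ k)" using Suc.IH by (intro mult_mono) auto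
    finally show ?thesis by (simp add: power_add[symmetric] mult_2)
  qed
  have "81 * card (witnesses (Suc k) c) \<le> 81 * (\<Sum>z\<in>?I. card (?f z))"
    unfolding witnesses.simps by (intro mult_left_mono card_UN_le I) auto
  also have "\<dots> = (\<Sum>z\<in>?I. 81 * card (?f z))" by (rule sum_distrib_left)
  finally have "81 * (81 * card (witnesses (Suc k) c)) \<le> (\<Sum>z\<in>?I. 81 * 81 * card (?f z))"
    by (simp add: sum_distrib_left[symmetric])
  also have "\<dots> \<le> (\<Sum>z\<in>?I. 81 ^ (2 ^ Suc k))" by (intro sum_mono *)
  also have "\<dots> \<le> 81 * 81 ^ (2 ^ Suc k)" using cI by simp
  finally have "81 * card (witnesses (Suc k) c) \<le> 81 ^ (2 ^ Suc k)" by simp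
  moreover have "finite (witnesses (Suc k) c)"
    unfolding witnesses.simps using I Suc.IH by (intro finite_UN_I) auto
  ultimately show ?case by blast
qed simp

lemma core_subset_bigbox: "core k U c \<subseteq> bigbox k c"
proof (induction k arbitrary: c)
  case (Suc k)
  then show ?case using bigbox_kids unfolding core.simps by blast
qed (auto simp: bigbox_def)

definition adjacent :: "nat \<times> nat \<Rightarrow> nat \<times> nat \<Rightarrow> bool" where
  "adjacent c c' \<longleftrightarrow> fst c' = Suc (fst c) \<and> snd c' = snd c \<or> fst c' = fst c \<and> snd c' = Suc (snd c)"

text \<open>As at most one cell is not good, every good cell lies in a row or a column of good cells.\<close>

lemma grid_connected:
  fixes G :: "nat \<Rightarrow> nat \<Rightarrow> bool" and L :: "nat \<times> nat \<Rightarrow> nat \<times> nat \<Rightarrow> bool"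
  assumes one: "\<And>a b a' b'. a < 3 \<Longrightarrow> b < 3 \<Longrightarrow> a' < 3 \<Longrightarrow> b' < 3 \<Longrightarrow> \<not> G a b \<Longrightarrow> \<not> G a' b' \<Longrightarrow> a = a' \<and> b = b'"
    and refl: "\<And>a b. G a b \<Longrightarrow> L (a, b) (a, b)"
    and sym: "\<And>a b a' b'. L (a, b) (a', b') \<Longrightarrow> L (a', b') (a, b)"
    and trans: "\<And>a b a' b' a'' b''. G a' b' \<Longrightarrow> L (a, b) (a', b') \<Longrightarrow> L (a', b') (a'', b'') \<Longrightarrow> L (a, b) (a'', b'')"
    and adj: "\<And>a b. G a b \<Longrightarrow> G (Suc a) b \<Longrightarrow> L (a, b) (Suc a, b)" "\<And>a b. G a b \<Longrightarrow> G a (Suc b) \<Longrightarrow> L (a, b) (a, Suc b)"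
    and ab: "a < 3" "b < 3" "a' < 3" "b' < 3" "G a b" "G a' b'"
  shows "L (a, b) (a', b')"
proof -
  define R where "R a \<longleftrightarrow> (\<forall>b<3. G a b)" for a
  define C where "C b \<longleftrightarrow> (\<forall>a<3. G a b)" for b
  have lt3: "n < 3 \<longleftrightarrow> n = 0 \<or> n = 1 \<or> n = 2" for n :: nat by auto
  have row: "L (a, b) (a, b')" if "R a" "b < 3" "b' < 3" for a b b'
  proof -
    have G: "G a 0" "G a 1" "G a 2" using that(1) by (auto simp: R_def)
    have 1: "L (a, 0) (a, 1)" "L (a, 1) (a, 2)"
      using adj(2)[of a 0] adj(2)[of a 1] G by (simp_all add: numeral_2_eq_2)
    have 2: "L (a, 0) (a, 2)" using trans[OF G(2) 1] .
    show ?thesis using that(2,3) unfolding lt3 using 1 2 1[THEN sym] 2[THEN sym] G[THEN refl] by auto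
  qed
  have col: "L (a, b) (a', b)" if "C b" "a < 3" "a' < 3" for a a' b
  proof -
    have G: "G 0 b" "G 1 b" "G 2 b" using that(1) by (auto simp: C_def)
    have 1: "L (0, b) (1, b)" "L (1, b) (2, b)"
      using adj(1)[of 0 b] adj(1)[of 1 b] G by (simp_all add: numeral_2_eq_2)
    have 2: "L (0, b) (2, b)" using trans[OF G(2) 1] .
    show ?thesis using that(2,3) unfolding lt3 using 1 2 1[THEN sym] 2[THEN sym] G[THEN refl] by auto
  qed
  have RC: "R a \<or> C b" if "a < 3" "b < 3" "G a b" for a b
  proof (rule ccontr)
    assume "\<not> ?thesis"
    then obtain b1 a1 where "b1 < 3" "\<not> G a b1" "a1 < 3" "\<not> G a1 b" by (auto simp: R_def C_def)
    then have "a = a1 \<and> b1 = b" using one[of a b1 a1 b] that by simp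
    then show False using \<open>\<not> G a b1\<close> that by simp
  qed
  have "R 0 \<or> R 1"
  proof (rule ccontr)
    assume "\<not> ?thesis"
    then obtain b1 b2 where "b1 < 3" "\<not> G 0 b1" "b2 < 3" "\<not> G 1 b2" by (auto simp: R_def)
    then show False using one[of 0 b1 1 b2] by simp
  qed
  then have "\<exists>a<3. R a" using lt3 by blast
  then obtain a0 where a0: "a0 < 3" "R a0" by blast
  have "C 0 \<or> C 1"
  proof (rule ccontr)
    assume "\<not> ?thesis"
    then obtain b1 b2 where "b1 < 3" "\<not> G b1 0" "b2 < 3" "\<not> G b2 1" by (auto simp: C_def)
    then show False using one[of b1 0 b2 1] by simp
  qed
  then have "\<exists>b<3. C b" using lt3 by blast
  then obtain b0 where b0: "b0 < 3" "C b0" by blast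
  have G0: "G a0 b0" using a0 b0 by (simp add: R_def)
  have to0: "L (a, b) (a0, b0)" if "a < 3" "b < 3" "G a b" for a b
    using RC[OF that]
  proof
    assume "R a"
    have "G a b0" using b0(2) that(1) by (simp add: C_def)
    then show ?thesis using row[OF \<open>R a\<close> that(2) b0(1)] col[OF b0(2) that(1) a0(1)] by (rule trans)
  next
    assume "C b"
    have "G a0 b" using a0(2) that(2) by (simp add: R_def)
    then show ?thesis using col[OF \<open>C b\<close> that(1) a0(1)] row[OF a0(2) that(2) b0(1)] by (rule trans)
  qed
  show ?thesis using G0 to0[OF ab(1,2,5)] sym[OF to0[OF ab(3,4,6)]] by (rule trans)
qed

text \<open>\<open>Q\<close> stands for lying in one cluster. Both claims need each other in the
  induction: \<open>grid_connected\<close> joins the subsquares of a square that is not bad, and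
  across a common side three pairs of subsquares face each other with at most one bad on either
  side, so that one pair is good.\<close>

lemma core_connected:
  fixes Q :: "nat \<times> nat \<Rightarrow> nat \<times> nat \<Rightarrow> bool" and U :: "(nat \<times> nat) set"
  assumes refl: "\<And>x. Q x x" and sym: "\<And>x y. Q x y \<Longrightarrow> Q y x" and trans: "\<And>x y z. Q x y \<Longrightarrow> Q y z \<Longrightarrow> Q x z"
    and adj: "\<And>c c'. c \<notin> U \<Longrightarrow> c' \<notin> U \<Longrightarrow> adjacent c c' \<Longrightarrow> Q c c'"
  shows "(\<forall>c. \<not> bad k U c \<longrightarrow> core k U c \<noteq> {} \<and> (\<forall>x\<in>core k U c. \<forall>y\<in>core k U c. Q x y))
    \<and> (\<forall>c c'. \<not> bad k U c \<longrightarrow> \<not> bad k U c' \<longrightarrow> adjacent c c' \<longrightarrow> (\<forall>x\<in>core k U c. \<forall>y\<in>core k U c'. Q x y))"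
proof (induction k)
  case 0
  show ?case using refl adj by auto
next
  case (Suc k)
  define L where "L c c' \<longleftrightarrow> (\<forall>x\<in>core k U c. \<forall>y\<in>core k U c'. Q x y)" for c c'
  have ne: "\<exists>x. x \<in> core k U c" and L_refl: "L c c" if "\<not> bad k U c" for c
    using Suc.IH that unfolding L_def by blast+
  have L_adj: "L c c'" if "\<not> bad k U c" "\<not> bad k U c'" "adjacent c c'" for c c'
    using Suc.IH that unfolding L_def by blast
  have L_sym: "L c' c" if "L c c'" for c c' using that sym unfolding L_def by blast
  have L_trans: "L c c''" if "\<not> bad k U c'" "L c c'" "L c' c''" for c c' c''
    using ne[OF that(1)] that(2,3) trans unfolding L_def by blast
  have in_kids: "(3 * fst c + a, 3 * snd c + b) \<in> kids c" if "a < 3" "b < 3" for c :: "nat \<times> nat" and a b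
    unfolding kids_eq using that by force
  have one: "a = a' \<and> b = b'" if "\<not> bad (Suc k) U c" "a < 3" "b < 3" "a' < 3" "b' < 3"
    "bad k U (3 * fst c + a, 3 * snd c + b)" "bad k U (3 * fst c + a', 3 * snd c + b')" for c a b a' b'
  proof (rule ccontr)
    assume "\<not> ?thesis"
    then have "(3 * fst c + a, 3 * snd c + b) \<noteq> (3 * fst c + a', 3 * snd c + b')" by simp
    then have "bad (Suc k) U c"
      unfolding bad.simps using in_kids[OF that(2,3)] in_kids[OF that(4,5)] that(6,7) by blast
    then show False using that(1) by simp
  qed
  have inner: "L c1 c2" if c: "\<not> bad (Suc k) U c" "c1 \<in> kids c" "c2 \<in> kids c" "\<not> bad k U c1" "\<not> bad k U c2" for c c1 c2
  proof -
    let ?k = "\<lambda>a b. (3 * fst c + a, 3 * snd c + b)"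
    obtain a b where 1: "c1 = ?k a b" "a < 3" "b < 3" using c(2) unfolding kids_eq by auto
    obtain a' b' where 2: "c2 = ?k a' b'" "a' < 3" "b' < 3" using c(3) unfolding kids_eq by auto
    define D where "D z z' \<longleftrightarrow> L (?k (fst z) (snd z)) (?k (fst z') (snd z'))" for z z'
    have D: "D (a, b) (a', b') \<longleftrightarrow> L (?k a b) (?k a' b')" for a b a' b' by (simp add: D_def)
    have "D (a, b) (a', b')"
    proof (rule grid_connected[where G = "\<lambda>a b. \<not> bad k U (?k a b)"])
      show "a = a' \<and> b = b'" if "a < 3" "b < 3" "a' < 3" "b' < 3" "\<not> \<not> bad k U (?k a b)" "\<not> \<not> bad k U (?k a' b')" for a b a' b'
        using one[OF c(1) that(1-4)] that(5,6) by simp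
      show "D (a, b) (a, b)" if "\<not> bad k U (?k a b)" for a b
        unfolding D by (rule L_refl[OF that])
      show "D (a', b') (a, b)" if "D (a, b) (a', b')" for a b a' b'
        using that unfolding D by (rule L_sym)
      show "D (a, b) (a'', b'')" if "\<not> bad k U (?k a' b')" "D (a, b) (a', b')" "D (a', b') (a'', b'')" for a b a' b' a'' b''
        using that unfolding D by (rule L_trans)
      show "D (a, b) (Suc a, b)" if "\<not> bad k U (?k a b)" "\<not> bad k U (?k (Suc a) b)" for a b
        unfolding D by (rule L_adj[OF that]) (simp add: adjacent_def)
      show "D (a, b) (a, Suc b)" if "\<not> bad k U (?k a b)" "\<not> bad k U (?k a (Suc b))" for a b
        unfolding D by (rule L_adj[OF that]) (simp add: adjacent_def)
    qed (use 1 2 c in simp_all)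
    then show ?thesis unfolding D 1(1) 2(1) .
  qed
  have A: "core (Suc k) U c \<noteq> {} \<and> (\<forall>x\<in>core (Suc k) U c. \<forall>y\<in>core (Suc k) U c. Q x y)" if c: "\<not> bad (Suc k) U c" for c
  proof
    have "\<exists>c1\<in>kids c. \<not> bad k U c1"
    proof (rule ccontr)
      assume "\<not> ?thesis"
      then have all: "bad k U c1" if "c1 \<in> kids c" for c1 using that by metis
      have "bad k U (3 * fst c + 0, 3 * snd c + 0)" "bad k U (3 * fst c + 1, 3 * snd c + 0)"
        by (rule all, rule in_kids, simp, simp)+
      from one[OF c _ _ _ _ this] show False by simp
    qed
    then obtain c1 x where "c1 \<in> kids c" "\<not> bad k U c1" "x \<in> core k U c1" using ne by metis
    then show "core (Suc k) U c \<noteq> {}" unfolding core.simps by blast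
    show "\<forall>x\<in>core (Suc k) U c. \<forall>y\<in>core (Suc k) U c. Q x y"
    proof (intro ballI)
      fix x y assume "x \<in> core (Suc k) U c" "y \<in> core (Suc k) U c"
      then obtain c1 c2 where "c1 \<in> kids c" "\<not> bad k U c1" "x \<in> core k U c1"
        "c2 \<in> kids c" "\<not> bad k U c2" "y \<in> core k U c2"
        unfolding core.simps by blast
      then show "Q x y" using inner[OF c, of c1 c2] by (simp add: L_def)
    qed
  qed
  have bridge: "\<forall>x\<in>core (Suc k) U c. \<forall>y\<in>core (Suc k) U c'. Q x y"
    if c: "\<not> bad (Suc k) U c" "\<not> bad (Suc k) U c'" and d: "d \<in> kids c" "d' \<in> kids c'" "\<not> bad k U d" "\<not> bad k U d'" "adjacent d d'"
    for c c' d d'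
  proof (intro ballI)
    fix x y assume "x \<in> core (Suc k) U c" "y \<in> core (Suc k) U c'"
    then obtain e e' where e: "e \<in> kids c" "\<not> bad k U e" "x \<in> core k U e" "e' \<in> kids c'" "\<not> bad k U e'" "y \<in> core k U e'"
      unfolding core.simps by blast
    have "L e d" by (rule inner[OF c(1) e(1) d(1) e(2) d(3)])
    moreover have "L d d'" by (rule L_adj[OF d(3,4,5)])
    moreover have "L d' e'" by (rule inner[OF c(2) d(2) e(4) d(4) e(5)])
    ultimately have "L e e'" using L_trans d(3,4) by blast
    then show "Q x y" using e by (simp add: L_def)
  qed
  have pick: "\<exists>b<3. \<not> P b \<and> \<not> P' b"
    if "\<And>b b'. b < 3 \<Longrightarrow> b' < 3 \<Longrightarrow> P b \<Longrightarrow> P b' \<Longrightarrow> b = b'" "\<And>b b'. b < 3 \<Longrightarrow> b' < 3 \<Longrightarrow> P' b \<Longrightarrow> P' b' \<Longrightarrow> b = b'"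
    for P P' :: "nat \<Rightarrow> bool"
  proof (rule ccontr)
    assume "\<not> ?thesis"
    then have "P 0 \<or> P' 0" "P 1 \<or> P' 1" "P 2 \<or> P' 2" by auto
    then show False
      using that(1)[of 0 1] that(1)[of 0 2] that(1)[of 1 2] that(2)[of 0 1] that(2)[of 0 2] that(2)[of 1 2] by auto
  qed
  have B: "\<forall>x\<in>core (Suc k) U c. \<forall>y\<in>core (Suc k) U c'. Q x y"
    if c: "\<not> bad (Suc k) U c" "\<not> bad (Suc k) U c'" and adj: "adjacent c c'" for c c'
    using adj unfolding adjacent_def
  proof
    assume cc: "fst c' = Suc (fst c) \<and> snd c' = snd c"
    obtain b where b: "b < 3" "\<not> bad k U (3 * fst c + 2, 3 * snd c + b)" "\<not> bad k U (3 * fst c' + 0, 3 * snd c' + b)"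
      using pick[of "\<lambda>b. bad k U (3 * fst c + 2, 3 * snd c + b)" "\<lambda>b. bad k U (3 * fst c' + 0, 3 * snd c' + b)"]
        one[OF c(1), of 2 _ 2] one[OF c(2), of 0 _ 0] by auto
    show ?thesis
      by (rule bridge[OF c in_kids in_kids b(2,3)]) (use b cc in \<open>auto simp: adjacent_def\<close>)
  next
    assume cc: "fst c' = fst c \<and> snd c' = Suc (snd c)"
    obtain b where b: "b < 3" "\<not> bad k U (3 * fst c + b, 3 * snd c + 2)" "\<not> bad k U (3 * fst c' + b, 3 * snd c' + 0)"
      using pick[of "\<lambda>b. bad k U (3 * fst c + b, 3 * snd c + 2)" "\<lambda>b. bad k U (3 * fst c' + b, 3 * snd c' + 0)"]
        one[OF c(1), of _ 2 _ 2] one[OF c(2), of _ 0 _ 0] by auto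
    show ?thesis
      by (rule bridge[OF c in_kids in_kids b(2,3)]) (use b cc in \<open>auto simp: adjacent_def\<close>)
  qed
  show ?case using A B by blast
qed

text \<open>The corner square is among its own subsquares at all scales, so every core at the corner
  contains \<open>(0, 0)\<close>, and the core of level \<open>n + 1\<close> also reaches the third
  column of subsquares, at first coordinate \<open>2 * 3 ^ n\<close> or more.\<close>

lemma good_unbounded:
  fixes Q :: "nat \<times> nat \<Rightarrow> nat \<times> nat \<Rightarrow> bool"
  assumes Q: "\<And>x. Q x x" "\<And>x y. Q x y \<Longrightarrow> Q y x" "\<And>x y z. Q x y \<Longrightarrow> Q y z \<Longrightarrow> Q x z"
    and adj: "\<And>c c'. c \<notin> U \<Longrightarrow> c' \<notin> U \<Longrightarrow> adjacent c c' \<Longrightarrow> Q c c'"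
    and good: "\<And>k. \<not> bad k U (0, 0)"
  shows "\<exists>x. Q (0, 0) x \<and> n \<le> fst x"
proof -
  have conn0: "(\<forall>c. \<not> bad k U c \<longrightarrow> core k U c \<noteq> {} \<and> (\<forall>x\<in>core k U c. \<forall>y\<in>core k U c. Q x y))
    \<and> (\<forall>c c'. \<not> bad k U c \<longrightarrow> \<not> bad k U c' \<longrightarrow> adjacent c c' \<longrightarrow> (\<forall>x\<in>core k U c. \<forall>y\<in>core k U c'. Q x y))" for k
    by (rule core_connected) (fact Q adj)+
  have conn: "core k U c \<noteq> {} \<and> (\<forall>x\<in>core k U c. \<forall>y\<in>core k U c. Q x y)" if "\<not> bad k U c" for k c
    using conn0[THEN conjunct1, rule_format, OF that] by simp
  have k0: "(0, 0) \<in> kids (0, 0)" by (simp add: kids_def)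
  have 0: "(0, 0) \<in> core k U (0, 0)" for k
  proof (induction k)
    case (Suc k)
    then show ?case using good[of k] k0 unfolding core.simps by blast
  qed simp
  have "\<exists>b<3. \<not> bad n U (2, b)"
  proof (rule ccontr)
    assume "\<not> ?thesis"
    then have "bad n U (2, 0)" "bad n U (2, 1)" by auto
    moreover have "(2, 0) \<in> kids (0, 0)" "(2, 1) \<in> kids (0, 0)" "(2::nat, 0::nat) \<noteq> (2, 1)" by (auto simp: kids_def)
    ultimately have "bad (Suc n) U (0, 0)" unfolding bad.simps by blast
    then show False using good by blast
  qed
  then obtain b where b: "b < 3" "\<not> bad n U (2, b)" by blast
  then obtain x where x: "x \<in> core n U (2, b)" using conn[OF b(2)] by auto
  have "(2, b) \<in> kids (0, 0)" using b by (auto simp: kids_def)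
  then have "x \<in> core (Suc n) U (0, 0)" using x b unfolding core.simps by blast
  then have "Q (0, 0) x" by (rule conn[OF good[of "Suc n"], THEN conjunct2, THEN bspec, OF 0, THEN bspec])
  moreover have "n \<le> fst x"
  proof -
    have "fst x div 3 ^ n = 2" using core_subset_bigbox x by (fastforce simp: bigbox_def)
    then have "2 * 3 ^ n \<le> fst x" using div_times_less_eq_dividend[of "fst x" "3 ^ n"] by simp
    moreover have "n < 3 ^ n" by (rule power_gt_expt) simp
    ultimately show ?thesis by linarith
  qed
  ultimately show ?thesis by blast
qed

context poisson_process
begin

text \<open>A plane spanned by two basis vectors carries the percolation, which is where the
  dimension enters. The range \<open>3 / 2\<close> exceeds the distance \<open>1\<close> of
  neighbouring sites, and the union bound over witnesses gives probability at most
  \<open>1 / 3\<close> to a bad corner square at any scale.\<close>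

lemma lattice_percolation_dense:
  assumes s: "s > 0" and d: "DIM('a) \<ge> 2" and dense: "81 * exp (- (lam * s ^ DIM('a))) \<le> 1 / 4"
  shows "prob (lattice_percolation s (3 / 2)) > 0"
proof -
  let ?q = "exp (- (lam * s ^ DIM('a)))"
  obtain b1 b2 :: 'a where b: "b1 \<in> Basis" "b2 \<in> Basis" "b1 \<noteq> b2"
    using d ex_card[of 2 "Basis :: 'a set"] by (metis card_2_iff' insertCI numeral_2_eq_2 subset_iff)
  define g where "g c = real (fst c) *\<^sub>R b1 + real (snd c) *\<^sub>R b2" for c :: "nat \<times> nat"
  have bb: "b1 \<bullet> b1 = 1" "b2 \<bullet> b2 = 1" "b1 \<bullet> b2 = 0" "b2 \<bullet> b1 = 0"
    using b by (auto simp: inner_Basis)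
  have g1: "g c \<bullet> b1 = real (fst c)" "g c \<bullet> b2 = real (snd c)" for c by (simp_all add: g_def inner_add_left bb)
  have g_inj: "inj g" using g1 by (intro injI) (metis of_nat_eq_iff prod_eqI)
  have g_lat: "g c \<in> lattice" for c
    using b by (auto simp: lattice_def g_def inner_add_left inner_Basis)
  have g_norm: "real (fst c) \<le> norm (g c)" for c
    using Basis_le_norm[OF b(1), of "g c"] by (simp add: g1)
  let ?U = "\<lambda>w. {c. g c \<notin> occupied s (X w)}"
  let ?E = "\<lambda>w. gilbert_edges (3 / 2) (occupied s (X w))"
  have perc: "percolates (occupied s (X w)) (?E w)" if good: "\<And>k. \<not> bad k (?U w) (0, 0)" for w
  proof -
    define Q where "Q x y \<longleftrightarrow> (g x, g y) \<in> (?E w)\<^sup>*" for x y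
    have "sym (?E w)" by (auto simp: sym_def gilbert_edges_def dist_commute)
    then have "sym ((?E w)\<^sup>*)" by (rule sym_rtrancl)
    then have Qs: "Q y x" if "Q x y" for x y using that by (auto simp: Q_def sym_def)
    have Qa: "Q c c'" if "c \<notin> ?U w" "c' \<notin> ?U w" "adjacent c c'" for c c'
    proof -
      have "g c' - g c = b1 \<or> g c' - g c = b2"
        using that(3) by (auto simp: adjacent_def g_def algebra_simps)
      then have "norm (g c' - g c) = 1" using b by auto
      then have "dist (g c) (g c') = 1" by (metis dist_commute dist_norm)
      moreover have "c \<noteq> c'" using that(3) by (auto simp: adjacent_def)
      then have "g c \<noteq> g c'" using injD[OF g_inj] by blast
      ultimately have "(g c, g c') \<in> ?E w" using that(1,2) by (simp add: gilbert_edges_def)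
      then show ?thesis by (simp add: Q_def)
    qed
    have "reach (occupied s (X w)) (?E w) (0::nat) n" for n :: nat
    proof -
      have "\<exists>x. Q (0, 0) x \<and> n \<le> fst x"
      proof (rule good_unbounded[of Q "?U w"])
        show "Q x z" if "Q x y" "Q y z" for x y z
          using that unfolding Q_def by (rule rtrancl_trans)
        show "Q x x" for x by (simp add: Q_def)
      qed (fact Qs Qa good)+
      then obtain x where x: "Q (0, 0) x" "n \<le> fst x" by blast
      have "g (0, 0) \<in> occupied s (X w)" using good[of 0] by simp
      moreover have "norm (g (0, 0)) = 0" by (simp add: g_def)
      moreover have "n \<le> norm (g x)" using g_norm[of x] x(2) by linarith
      ultimately show ?thesis using x(1) unfolding reach_def Q_def by (intro bexI[of _ "g (0, 0)"] exI[of _ "g x"]) auto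
    qed
    then show ?thesis using percolates_iff_reach[OF finite_occupied_cball] by blast
  qed
  define B where "B k = (\<Union>W\<in>witnesses k (0, 0). {w \<in> space M. g ` W \<inter> occupied s (X w) = {}})" for k
  have gW: "finite (g ` W)" "g ` W \<subseteq> lattice" "card (g ` W) = 2 ^ k" if "W \<in> witnesses k (0, 0)" for W k
    using witness_size[OF that] g_lat card_image[OF inj_on_subset[OF g_inj]] by auto
  have ev: "{w \<in> space M. g ` W \<inter> occupied s (X w) = {}} \<in> events" if "W \<in> witnesses k (0, 0)" for W k
    by (rule prob_all_cells(3)[OF s gW(1,2)[OF that]])
  have Bev: "B k \<in> events" for k
    unfolding B_def using card_witnesses ev by (intro sets.finite_UN) auto
  have PB: "prob (B k) \<le> (1 / 4) ^ Suc k" for k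
  proof -
    have "prob (B k) \<le> (\<Sum>W\<in>witnesses k (0, 0). prob {w \<in> space M. g ` W \<inter> occupied s (X w) = {}})"
      unfolding B_def using card_witnesses ev by (intro finite_measure_subadditive_finite) auto
    also have "\<dots> = (\<Sum>W\<in>witnesses k (0, 0). ?q ^ 2 ^ k)"
      by (rule sum.cong[OF refl]) (simp add: prob_all_cells(4)[OF s gW(1,2)] gW(3))
    also have "\<dots> = card (witnesses k (0, 0)) * ?q ^ 2 ^ k" by simp
    also have "\<dots> \<le> 81 ^ 2 ^ k * ?q ^ 2 ^ k"
    proof (intro mult_right_mono)
      have "card (witnesses k (0, 0)) \<le> 81 ^ 2 ^ k" using card_witnesses[of k "(0, 0)"] by linarith
      then show "real (card (witnesses k (0, 0))) \<le> 81 ^ 2 ^ k" by (metis of_nat_le_iff of_nat_numeral of_nat_power)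
    qed simp
    also have "\<dots> = (81 * ?q) ^ 2 ^ k" by (simp add: power_mult_distrib)
    also have "\<dots> \<le> (1 / 4) ^ 2 ^ k" using dense by (intro power_mono) auto
    also have "\<dots> \<le> (1 / 4) ^ Suc k" by (intro power_decreasing) (auto simp: Suc_leI)
    finally show ?thesis .
  qed
  have sum: "(\<lambda>k. (1 / 4 :: real) ^ Suc k) sums (1 / 4 * (1 / (1 - 1 / 4)))"
    unfolding power_Suc by (intro sums_mult geometric_sums) simp
  have "prob (\<Union>k. B k) \<le> (\<Sum>k. prob (B k))"
    using Bev PB by (intro finite_measure_subadditive_countably summable_comparison_test'[OF sums_summable[OF sum]]) auto
  also have "\<dots> \<le> (\<Sum>k. (1 / 4) ^ Suc k)"
    using PB by (intro suminf_le summable_comparison_test'[OF sums_summable[OF sum], of 0] sums_summable[OF sum]) auto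
  also have "\<dots> = 1 / 3" using sums_unique[OF sum] by simp
  finally have "prob (\<Union>k. B k) \<le> 1 / 3" .
  then have "2 / 3 \<le> prob (space M - (\<Union>k. B k))" using Bev by (subst prob_compl) auto
  also have "\<dots> \<le> prob (lattice_percolation s (3 / 2))"
  proof (rule finite_measure_mono)
    show "space M - (\<Union>k. B k) \<subseteq> lattice_percolation s (3 / 2)"
    proof
      fix w assume w: "w \<in> space M - (\<Union>k. B k)"
      have "\<not> bad k (?U w) (0, 0)" for k
      proof
        assume "bad k (?U w) (0, 0)"
        then obtain W where "W \<in> witnesses k (0, 0)" "W \<subseteq> ?U w" using bad_witness by blast
        then have "w \<in> B k" using w unfolding B_def by blast
        then show False using w by blast
      qed
      then show "w \<in> lattice_percolation s (3 / 2)" using perc w by blast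
    qed
  qed (use sets_lattice_percolation[OF s] in auto)
  finally show ?thesis by simp
qed

end

section \<open>Path-loss functions\<close>

context
  fixes d :: nat and l :: "real \<Rightarrow> real"
  assumes wb: "well_behaved d l" and d: "d \<ge> 1"
begin

lemma path_loss_nonneg: "0 \<le> r \<Longrightarrow> 0 \<le> l r"
  and path_loss_cont: "continuous_on {0..} l"
  and path_loss_integral: "(\<integral>\<^sup>+r\<in>{0..}. ennreal (r ^ (d - 1) * l r) \<partial>lborel) < \<infinity>"
  using wb by (auto simp: well_behaved_def)

lemma path_loss_strict:
  obtains d0 where "d0 \<ge> 0" "\<And>r. 0 \<le> r \<Longrightarrow> r \<le> d0 \<Longrightarrow> l r = l 0"
    "\<And>x y. d0 \<le> x \<Longrightarrow> x < y \<Longrightarrow> x \<in> path_loss_support l \<Longrightarrow> y \<in> path_loss_support l \<Longrightarrow> l y < l x"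
proof -
  obtain d0 where d0: "d0 \<ge> 0" "l constant_on {0..d0}" "strict_antimono_on ({d0..} \<inter> path_loss_support l) l"
    using wb by (auto simp: well_behaved_def)
  have 1: "l r = l 0" if "0 \<le> r" "r \<le> d0" for r
    using d0(2) that unfolding constant_on_def by (metis atLeastAtMost_iff order_refl order_trans)
  have 2: "l y < l x" if "d0 \<le> x" "x < y" "x \<in> path_loss_support l" "y \<in> path_loss_support l" for x y
    using d0(3) that unfolding monotone_on_def by auto
  show ?thesis using that[OF d0(1) 1 2] by blast
qed

lemma support_nonzero: "0 \<le> r \<Longrightarrow> l r \<noteq> 0 \<Longrightarrow> r \<in> path_loss_support l"
  unfolding path_loss_support_def using closure_subset by fastforce

text \<open>Monotonicity is assumed on the support only. An increase from \<open>x\<close> to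
  \<open>y\<close> would have to start at a last low point, which belongs to the support because the
  support is closed, and strict decrease from there on is a contradiction.\<close>

lemma path_loss_antimono:
  assumes "0 \<le> x" "x \<le> y"
  shows "l y \<le> l x"
proof (rule ccontr)
  assume "\<not> l y \<le> l x"
  then have lt: "l x < l y" by simp
  then have y: "0 < l y" "x < y" using path_loss_nonneg[of x] assms by (cases "x = y"; simp)+
  obtain d0 where d0: "d0 \<ge> 0" "\<And>r. 0 \<le> r \<Longrightarrow> r \<le> d0 \<Longrightarrow> l r = l 0"
    "\<And>x y. d0 \<le> x \<Longrightarrow> x < y \<Longrightarrow> x \<in> path_loss_support l \<Longrightarrow> y \<in> path_loss_support l \<Longrightarrow> l y < l x"
    using path_loss_strict by blast
  have ys: "y \<in> path_loss_support l" using y assms by (intro support_nonzero) auto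
  have "d0 < y"
  proof (rule ccontr)
    assume "\<not> d0 < y"
    then have "l x = l 0" "l y = l 0" using d0(2)[of x] d0(2)[of y] assms by linarith+
    then show False using lt by simp
  qed
  define x' where "x' = max x d0"
  have x': "0 \<le> x'" "d0 \<le> x'" "x' < y" "l x' = l x"
    using \<open>d0 < y\<close> y assms d0(1) d0(2)[of x] d0(2)[of d0] by (auto simp: x'_def max_def)
  \<comment> \<open>the last point where \<open>l\<close> is at most \<open>l x'\<close>; as \<open>l\<close> does not vanish right after it, it lies in the support\<close>
  define S where "S = {u \<in> {x'..y}. l u \<le> l x'}"
  have "continuous_on {x'..y} l"
    by (rule continuous_on_subset[OF path_loss_cont]) (use x' in auto)
  then have "closed S"
    unfolding S_def by (rule continuous_on_closed_Collect_le[OF _ continuous_on_const]) simp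
  have "x' \<in> S" using x' by (simp add: S_def)
  then have bdd: "bdd_above S" "S \<noteq> {}" by (auto simp: S_def intro!: bdd_aboveI[of _ y])
  define u where "u = Sup S"
  have uS: "u \<in> S" unfolding u_def by (rule closed_contains_Sup[OF bdd(2,1) \<open>closed S\<close>])
  then have u: "x' \<le> u" "u \<le> y" "l u < l y" using lt x' by (auto simp: S_def)
  then have "u < y" by (cases "u = y") auto
  note u = u(1) this u(3)
  have above: "l v \<noteq> 0" if "u < v" "v < y" for v
  proof
    assume "l v = 0"
    then have "v \<in> S" using that u path_loss_nonneg[OF x'(1)] by (auto simp: S_def)
    then have "v \<le> u" unfolding u_def by (rule cSup_upper[OF _ bdd(1)])
    then show False using that by simp
  qed
  have "u \<in> closure {u<..<y}" using u by simp
  moreover have "{u<..<y} \<subseteq> {r \<in> {0..}. l r \<noteq> 0}" using above u x' by auto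
  ultimately have "u \<in> path_loss_support l"
    unfolding path_loss_support_def using closure_mono by blast
  then have "l y < l u" using d0(3)[of u y] u x' ys by simp
  then show False using u by simp
qed

text \<open>Condensation: on the dyadic interval after \<open>b k\<close> the integrand is at least
  \<open>b k ^ (d - 1) * l (b (Suc k))\<close>, and the interval has length \<open>b k\<close>, so
  the integral bounds the series.\<close>

lemma summable_path_loss:
  assumes s: "s > 0"
  shows "summable (\<lambda>k. 2 ^ (k * d) * l (s * 2 ^ (k + 1)))"
proof -
  define g where "g r = ennreal (r ^ (d - 1) * l r) * indicator {0..} r" for r
  define b where "b k = s * 2 ^ k" for k :: nat
  have b: "0 < b k" "b k \<le> b (Suc k)" "b (Suc k) - b k = b k" for k using s by (auto simp: b_def)
  have "(\<lambda>r. l (max 0 r)) \<in> borel_measurable borel"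
    by (intro borel_measurable_continuous_onI continuous_on_compose2[OF path_loss_cont]) (auto intro!: continuous_intros)
  then have "(\<lambda>r. ennreal (r ^ (d - 1) * l (max 0 r)) * indicator {0..} r) \<in> borel_measurable borel"
    by measurable
  moreover have "(\<lambda>r. ennreal (r ^ (d - 1) * l (max 0 r)) * indicator {0..} r) = g"
    by (auto simp: g_def fun_eq_iff indicator_def)
  ultimately have g_meas [measurable]: "g \<in> borel_measurable lborel" by simp
  define G where "G = (\<integral>\<^sup>+r. g r \<partial>lborel)"
  have G: "G < \<infinity>" using path_loss_integral unfolding G_def g_def by simp
  have le: "(\<Sum>k<n. ennreal (b k ^ d * l (b (Suc k)))) \<le> (\<integral>\<^sup>+r. g r * indicator {..b n} r \<partial>lborel)" for n
  proof (induction n)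
    case (Suc n)
    let ?c = "ennreal (b n ^ (d - 1) * l (b (Suc n)))"
    have "ennreal (b n ^ d * l (b (Suc n))) = ?c * emeasure lborel {b n<..b (Suc n)}"
    proof -
      have "b n ^ d = b n ^ (d - 1) * b n" using d by (metis Suc_diff_1 less_le_trans power_Suc2 zero_less_one)
      then have eq: "b n ^ d * l (b (Suc n)) = (b n ^ (d - 1) * l (b (Suc n))) * b n" by (simp only: mult_ac)
      have em: "emeasure lborel {b n<..b (Suc n)} = ennreal (b n)" using b(2,3)[of n] by simp
      show ?thesis unfolding eq em
        using b(1)[of n] b(1)[of "Suc n"] by (intro ennreal_mult mult_nonneg_nonneg path_loss_nonneg) auto
    qed
    also have "\<dots> = (\<integral>\<^sup>+r. ?c * indicator {b n<..b (Suc n)} r \<partial>lborel)"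
      by (rule nn_integral_cmult_indicator[symmetric]) simp
    finally have "(\<Sum>k<Suc n. ennreal (b k ^ d * l (b (Suc k))))
        \<le> (\<integral>\<^sup>+r. g r * indicator {..b n} r \<partial>lborel) + (\<integral>\<^sup>+r. ?c * indicator {b n<..b (Suc n)} r \<partial>lborel)"
      using Suc by (simp add: add_mono)
    also have "\<dots> = (\<integral>\<^sup>+r. g r * indicator {..b n} r + ?c * indicator {b n<..b (Suc n)} r \<partial>lborel)"
      by (rule nn_integral_add[symmetric]) measurable
    also have "\<dots> \<le> (\<integral>\<^sup>+r. g r * indicator {..b (Suc n)} r \<partial>lborel)"
    proof (rule nn_integral_mono)
      fix r
      consider "r \<le> b n" | "b n < r" "r \<le> b (Suc n)" | "b (Suc n) < r" by linarith
      then show "g r * indicator {..b n} r + ?c * indicator {b n<..b (Suc n)} r \<le> g r * indicator {..b (Suc n)} r"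
      proof cases
        case 2
        have "b n ^ (d - 1) * l (b (Suc n)) \<le> r ^ (d - 1) * l r"
          using 2 b[of n] b[of "Suc n"] by (intro mult_mono power_mono path_loss_antimono path_loss_nonneg) auto
        then show ?thesis using 2 b[of n] by (simp add: g_def ennreal_leI)
      qed (use b[of n] in auto)
    qed
    finally show ?case .
  qed simp
  have nn: "0 \<le> b k ^ d * l (b (Suc k))" for k
    using b(1)[of k] b(1)[of "Suc k"] by (intro mult_nonneg_nonneg path_loss_nonneg zero_le_power) auto
  have "(\<Sum>k<n. b k ^ d * l (b (Suc k))) \<le> enn2real G" for n
  proof -
    have "ennreal (\<Sum>k<n. b k ^ d * l (b (Suc k))) = (\<Sum>k<n. ennreal (b k ^ d * l (b (Suc k))))"
      using nn by (intro sum_ennreal[symmetric]) auto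
    also have "\<dots> \<le> (\<integral>\<^sup>+r. g r * indicator {..b n} r \<partial>lborel)" by (rule le)
    also have "\<dots> \<le> G" unfolding G_def by (intro nn_integral_mono) (auto simp: indicator_def)
    also have "\<dots> = ennreal (enn2real G)" using G by simp
    finally show ?thesis by (simp add: ennreal_le_iff)
  qed
  from this[of "Suc _"] have "summable (\<lambda>k. b k ^ d * l (b (Suc k)))"
    unfolding lessThan_Suc_atMost by (rule bounded_imp_summable[OF nn])
  then have "summable (\<lambda>k. inverse (s ^ d) * (b k ^ d * l (b (Suc k))))" by (rule summable_mult)
  moreover have "inverse (s ^ d) * (b k ^ d * l (b (Suc k))) = 2 ^ (k * d) * l (s * 2 ^ (k + 1))" for k
  proof -
    have "b k ^ d = s ^ d * 2 ^ (k * d)" by (simp add: b_def power_mult_distrib flip: power_mult)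
    then show ?thesis using s by (simp add: b_def)
  qed
  ultimately show ?thesis by simp
qed

text \<open>Summability drives \<open>l\<close> below \<open>c\<close>, and the intermediate value
  theorem gives a solution. Any solution lies at or beyond the end of the constant stretch and in
  the support, where \<open>l\<close> is injective.\<close>

lemma path_loss_unique:
  assumes c: "0 < c" "c < l 0"
  shows "\<exists>!r. r > 0 \<and> l r = c"
proof -
  obtain d0 where d0: "d0 \<ge> 0" "\<And>r. 0 \<le> r \<Longrightarrow> r \<le> d0 \<Longrightarrow> l r = l 0"
    "\<And>x y. d0 \<le> x \<Longrightarrow> x < y \<Longrightarrow> x \<in> path_loss_support l \<Longrightarrow> y \<in> path_loss_support l \<Longrightarrow> l y < l x"
    using path_loss_strict by blast
  have "(\<lambda>k. 2 ^ (k * d) * l (1 * 2 ^ (k + 1))) \<longlonglongrightarrow> 0"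
    by (rule summable_LIMSEQ_zero[OF summable_path_loss]) simp
  then have "\<forall>\<^sub>F k in sequentially. 2 ^ (k * d) * l (1 * 2 ^ (k + 1)) < c"
    using c by (intro order_tendstoD) auto
  then obtain k where k: "2 ^ (k * d) * l (1 * 2 ^ (k + 1)) < c"
    using eventually_happens'[OF sequentially_bot] by blast
  define R :: real where "R = 2 ^ (k + 1)"
  have R: "0 \<le> R" "l R < c"
  proof -
    show "0 \<le> R" by (simp add: R_def)
    have "1 * l R \<le> 2 ^ (k * d) * l R" using path_loss_nonneg[OF \<open>0 \<le> R\<close>] by (intro mult_right_mono) auto
    then show "l R < c" using k by (simp add: R_def)
  qed
  obtain r where r: "0 \<le> r" "r \<le> R" "l r = c"
    using IVT2'[of l R c 0] R c continuous_on_subset[OF path_loss_cont, of "{0..R}"] by auto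
  have "r \<noteq> 0" using r c by auto
  moreover have "r1 = r2" if "r1 > 0" "l r1 = c" "r2 > 0" "l r2 = c" for r1 r2
  proof -
    have "d0 \<le> r1" "d0 \<le> r2" using d0(2)[of r1] d0(2)[of r2] that c by force+
    moreover have "r1 \<in> path_loss_support l" "r2 \<in> path_loss_support l"
      using that c by (auto intro!: support_nonzero)
    ultimately show ?thesis using d0(3)[of r1 r2] d0(3)[of r2 r1] that by force
  qed
  ultimately show ?thesis using r by (intro ex1I[of _ r]) auto
qed

lemma path_loss_less_iff:
  assumes c: "0 < c" "c < l 0" and r: "r > 0" "l r = c" and x: "0 \<le> x"
  shows "c < l x \<longleftrightarrow> x < r"
proof
  assume "c < l x"
  then show "x < r" using path_loss_antimono[of r x] r by force
next
  assume "x < r"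
  then have "c \<le> l x" using path_loss_antimono[of x r] r x by simp
  moreover have "l x \<noteq> c"
  proof
    assume "l x = c"
    then have "x > 0" using x c by (cases "x = 0") auto
    then have "x = r" using path_loss_unique[OF c] \<open>l x = c\<close> r by blast
    then show False using \<open>x < r\<close> by simp
  qed
  ultimately show "c < l x" by simp
qed

text \<open>Bounds the path loss between points of two cells in terms of the distance of the cells.\<close>

definition cell_loss :: "real \<Rightarrow> real \<Rightarrow> real" where
  "cell_loss s r = l (max 0 (s * (r - 2 * d)))"

lemma cell_loss_nonneg: "0 \<le> cell_loss s r"
  by (simp add: cell_loss_def path_loss_nonneg)

lemma cell_loss_antimono: "s > 0 \<Longrightarrow> r \<le> r' \<Longrightarrow> cell_loss s r' \<le> cell_loss s r"
  unfolding cell_loss_def by (intro path_loss_antimono max.mono mult_left_mono) auto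

lemma summable_cell_loss:
  assumes s: "s > 0"
  shows "summable (\<lambda>k. 2 ^ (k * d) * cell_loss s (2 ^ k))"
proof -
  \<comment> \<open>Shifting the index by \<open>m\<close> absorbs the loss of \<open>2 * d\<close>
    in the argument: \<open>2 ^ (k + m) - 2 * d\<close> is at least
    \<open>2 ^ (k + 1)\<close>.\<close>
  obtain m :: nat where m: "2 + 2 * real d < 2 ^ m" using real_arch_pow[of 2 "2 + 2 * real d"] by auto
  have "summable (\<lambda>k. 2 ^ ((k + m) * d) * cell_loss s (2 ^ (k + m)))"
  proof (rule summable_comparison_test'[OF summable_mult[OF summable_path_loss[OF s], of "2 ^ (m * d)"]])
    fix k :: nat
    have "s * 2 ^ (k + 1) \<le> s * (2 ^ (k + m) - 2 * real d)"
    proof (rule mult_left_mono)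
      have "2 ^ k * (2 + 2 * real d) \<le> 2 ^ k * 2 ^ m" using m by (intro mult_left_mono) auto
      moreover have "2 * real d * 1 \<le> 2 * real d * 2 ^ k" by (intro mult_left_mono) auto
      ultimately show "2 ^ (k + 1) \<le> 2 ^ (k + m) - 2 * real d" by (simp add: power_add algebra_simps)
    qed (use s in simp)
    then have "cell_loss s (2 ^ (k + m)) \<le> l (s * 2 ^ (k + 1))"
      unfolding cell_loss_def using s by (intro path_loss_antimono) (auto simp: le_max_iff_disj)
    then have "2 ^ ((k + m) * d) * cell_loss s (2 ^ (k + m)) \<le> 2 ^ ((k + m) * d) * l (s * 2 ^ (k + 1))"
      by (intro mult_left_mono) auto
    also have "\<dots> = 2 ^ (m * d) * (2 ^ (k * d) * l (s * 2 ^ (k + 1)))"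
      by (simp add: power_add add_mult_distrib)
    finally show "norm (2 ^ ((k + m) * d) * cell_loss s (2 ^ (k + m))) \<le> 2 ^ (m * d) * (2 ^ (k * d) * l (s * 2 ^ (k + 1)))"
      using cell_loss_nonneg by (simp add: abs_mult)
  qed
  then show ?thesis by (subst (asm) summable_iff_shift)
qed

end

section \<open>Discretization\<close>

lemma dist_sites:
  fixes x y :: "'a::euclidean_space" and s :: real
  assumes s: "s > 0"
  shows "dist x y \<le> s * dist (site s x) (site s y) + 2 * s * DIM('a)"
    "s * dist (site s x) (site s y) \<le> dist x y + 2 * s * DIM('a)"
proof -
  let ?x = "s *\<^sub>R site s x" and ?y = "s *\<^sub>R site s y"
  have "dist ?x ?y = s * dist (site s x) (site s y)"
    using s by (simp add: dist_norm scaleR_diff_right[symmetric])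
  moreover have "dist x ?x \<le> s * DIM('a)" "dist y ?y \<le> s * DIM('a)"
    using norm_site[OF s, of x] norm_site[OF s, of y] by (simp_all add: dist_norm)
  moreover have "dist x y \<le> dist x ?x + dist ?x ?y + dist y ?y"
    using dist_triangle[of x y ?x] dist_triangle[of ?x y ?y] dist_commute[of y ?y] by linarith
  moreover have "dist ?x ?y \<le> dist x ?x + dist x y + dist y ?y"
    using dist_triangle[of ?x ?y x] dist_triangle[of x ?y y] dist_commute[of x ?x] by linarith
  ultimately show "dist x y \<le> s * dist (site s x) (site s y) + 2 * s * DIM('a)"
    "s * dist (site s x) (site s y) \<le> dist x y + 2 * s * DIM('a)" by linarith+
qed

text \<open>From points to cells: the enlarged range \<open>rho\<close> makes up for the unknown
  positions of the points in their cells.\<close>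

lemma occupied_percolates:
  fixes V :: "'a::euclidean_space set" and s r rho :: real
  assumes fin: "\<And>r. finite (V \<inter> cball 0 r)" and s: "s > 0" and r: "r + 2 * s * DIM('a) \<le> s * rho"
    and perc: "percolates V (gilbert_edges r V)"
  shows "percolates (occupied s V) (gilbert_edges rho (occupied s V))"
proof -
  obtain m :: nat where m: "\<And>n::nat. reach V (gilbert_edges r V) m n"
    using perc unfolding percolates_iff_reach[OF fin] by auto
  show ?thesis
  proof (rule percolates_transfer[where f = "site s" and a = "1 / s" and b = "DIM('a)"])
    show "finite (occupied s V \<inter> cball 0 r)" for r by (rule finite_occupied_cball)
    show "reach V (gilbert_edges r V) m n" for n :: nat by (rule m)
    show "site s z \<in> occupied s V" if "z \<in> V" for z using that by (simp add: occupied_eq)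
    show "(site s z, site s z') \<in> (gilbert_edges rho (occupied s V))\<^sup>*" if "(z, z') \<in> gilbert_edges r V" for z z'
    proof (cases "site s z = site s z'")
      case False
      have z: "z \<in> V" "z' \<in> V" "dist z z' < r" using that by (auto simp: gilbert_edges_def)
      have "s * dist (site s z) (site s z') < s * rho" using dist_sites(2)[OF s, of z z'] z r by linarith
      then have "dist (site s z) (site s z') < rho" using s by simp
      then have "(site s z, site s z') \<in> gilbert_edges rho (occupied s V)"
        using z False by (simp add: gilbert_edges_def occupied_eq)
      then show ?thesis by (rule r_into_rtrancl)
    qed simp
    show "gilbert_edges r V \<subseteq> V \<times> V" by (auto simp: gilbert_edges_def)
    show "norm (site s z - (1 / s) *\<^sub>R z) \<le> real DIM('a)" for z :: 'a
    proof -
      have "s * norm (site s z - (1 / s) *\<^sub>R z) = norm (s *\<^sub>R (site s z - (1 / s) *\<^sub>R z))" using s by simp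
      also have "\<dots> = norm (z - s *\<^sub>R site s z)" using s by (simp add: scaleR_diff_right norm_minus_commute)
      also have "\<dots> \<le> s * DIM('a)" by (rule norm_site[OF s])
      finally show ?thesis using s by simp
    qed
  qed (use s in simp)
qed

text \<open>The converse passage, choosing one point in each cell of \<open>A\<close>. The edge
  relation is left open, so that Gilbert and SINR graphs are both covered.\<close>

lemma points_percolate:
  fixes V :: "'a::euclidean_space set" and s rho m :: real
  assumes fin: "\<And>r. finite (V \<inter> cball 0 r)" and s: "s > 0" and A: "A \<subseteq> occupied s V"
    and reach: "\<And>n::nat. reach A (gilbert_edges rho A) m n"
    and E: "\<And>x y. x \<in> V \<Longrightarrow> y \<in> V \<Longrightarrow> x \<noteq> y \<Longrightarrow> site s x \<in> A \<Longrightarrow> site s y \<in> A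
        \<Longrightarrow> dist x y < s * rho + 2 * s * DIM('a) \<Longrightarrow> (x, y) \<in> E"
  shows "percolates V E"
proof -
  define f where "f z = (SOME x. x \<in> V \<and> site s x = z)" for z
  have f: "f z \<in> V" "site s (f z) = z" if "z \<in> A" for z
  proof -
    have "\<exists>x. x \<in> V \<and> site s x = z" using that A by (auto simp: occupied_eq)
    then have "f z \<in> V \<and> site s (f z) = z" unfolding f_def by (rule someI_ex)
    then show "f z \<in> V" "site s (f z) = z" by auto
  qed
  show ?thesis
  proof (rule percolates_transfer[OF fin reach, where f = f and a = s and b = "s * DIM('a)"])
    show "f z \<in> V" if "z \<in> A" for z by (rule f(1)[OF that])
    show "(f z, f z') \<in> E\<^sup>*" if "(z, z') \<in> gilbert_edges rho A" for z z'
    proof -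
      have z: "z \<in> A" "z' \<in> A" "z \<noteq> z'" "dist z z' < rho" using that by (auto simp: gilbert_edges_def)
      have "dist (f z) (f z') \<le> s * dist z z' + 2 * s * DIM('a)"
        using dist_sites(1)[OF s, of "f z" "f z'"] f[OF z(1)] f[OF z(2)] by simp
      moreover have "s * dist z z' < s * rho" using z s by simp
      ultimately have "dist (f z) (f z') < s * rho + 2 * s * DIM('a)" by linarith
      moreover have "f z \<noteq> f z'" using f(2)[OF z(1)] f(2)[OF z(2)] z(3) by metis
      ultimately have "(f z, f z') \<in> E" using f[OF z(1)] f[OF z(2)] z by (intro E) auto
      then show ?thesis by (rule r_into_rtrancl)
    qed
    show "gilbert_edges rho A \<subseteq> A \<times> A" by (auto simp: gilbert_edges_def)
    show "norm (f z - s *\<^sub>R z) \<le> s * DIM('a)" if "z \<in> A" for z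
      using norm_site[OF s, of "f z"] f(2)[OF that] by simp
  qed (fact s)
qed

text \<open>Windows exhaust the lattice, so bounding the sum in every window bounds the total
  interference without an infinite sum in the definition.\<close>

definition quiet :: "real \<Rightarrow> (real \<Rightarrow> real) \<Rightarrow> real \<Rightarrow> 'a::euclidean_space set \<Rightarrow> 'a set" where
  "quiet s A C V = {z \<in> occupied s V. \<forall>K. (\<Sum>y\<in>window K. real (card (V \<inter> cell s y)) * A (norm (y - z))) \<le> C}"

text \<open>The comparison holds for reachability events in finite windows and survives the limits
  in the window, in \<open>n\<close> and in \<open>m\<close>. The 0-1 law for the independent
  process \<open>X1\<close> raises positive probability to one, so the conclusion for the dependent
  set \<open>quiet\<close> is almost sure.\<close>

lemma quiet_percolation:
  fixes X1 :: "'v \<Rightarrow> 'a::euclidean_space set" and X2 :: "'w \<Rightarrow> 'a set" and A :: "real \<Rightarrow> real"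
  assumes P1: "poisson_process M1 lam1 X1" and P2: "poisson_process M2 lam2 X2"
    and s: "s1 > 0" "s2 > 0" and lam: "lam1 * s1 ^ DIM('a) < lam2 * s2 ^ DIM('a)" and rho: "0 \<le> rho"
    and A: "\<And>r r'. 0 \<le> r \<Longrightarrow> r \<le> r' \<Longrightarrow> A r' \<le> A r" "\<And>r. 0 \<le> A r"
    and sm: "summable (\<lambda>k. 2 ^ (k * DIM('a)) * A (2 ^ k))"
    and pos: "measure M1 {w \<in> space M1. percolates (occupied s1 (X1 w)) (gilbert_edges rho (occupied s1 (X1 w)))} > 0"
  shows "\<exists>C. AE w in M2. \<exists>m::nat. \<forall>n::nat.
    reach (quiet s2 A C (X2 w)) (gilbert_edges rho (quiet s2 A C (X2 w))) m n"
proof -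
  interpret P1: poisson_process M1 lam1 X1 by fact
  interpret P2: poisson_process M2 lam2 X2 by fact
  let ?\<nu>' = "poisson_pmf (lam1 * s1 ^ DIM('a))" and ?\<mu> = "lam2 * s2 ^ DIM('a)"
  have mu: "lam1 * s1 ^ DIM('a) > 0" "?\<mu> > 0" using P1.lam P2.lam s by auto
  obtain C where C: "\<And>K (\<phi> :: 'a set \<Rightarrow> real). antimono \<phi> \<Longrightarrow> (\<And>F. 0 \<le> \<phi> F \<and> \<phi> F \<le> 1) \<Longrightarrow>
    measure_pmf.expectation (Pi_pmf (window K) 0 (\<lambda>_. ?\<nu>')) (\<lambda>N. \<phi> {y\<in>window K. N y = 0})
    \<le> measure_pmf.expectation (Pi_pmf (window K) 0 (\<lambda>_. poisson_pmf ?\<mu>))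
        (\<lambda>N. \<phi> {z\<in>window K. N z = 0 \<or> C < (\<Sum>y\<in>window K. N y * A (norm (y - z)))})"
    using low_interference_dominates[of A ?\<mu> ?\<nu>', OF A sm mu(2)] mu lam by auto
  define R1 where "R1 m n w \<longleftrightarrow> reach (occupied s1 (X1 w)) (gilbert_edges rho (occupied s1 (X1 w))) m n" for m n :: nat and w
  define S where "S w = quiet s2 A C (X2 w)" for w
  define R2 where "R2 m n w \<longleftrightarrow> reach (S w) (gilbert_edges rho (S w)) m n" for m n :: nat and w
  have R1_sets: "{w \<in> space M1. R1 m n w} \<in> P1.events" for m n
    unfolding R1_def by (rule P1.sets_reach_occupied[OF s(1) rho])
  have R2_prob: "{w \<in> space M2. R2 m n w} \<in> P2.events \<and>
      P1.prob {w \<in> space M1. R1 m n w} \<le> P2.prob {w \<in> space M2. R2 m n w}" for m n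
  proof -
    define L where "L = lattice \<inter> cball (0::'a) (max (real m) (real n) + rho)"
    obtain K0 where K0: "\<And>K. K0 \<le> K \<Longrightarrow> L \<subseteq> window K" unfolding L_def
      using cball_subset_window[of "max (real m) (real n) + rho", where ?'a = 'a] by metis
    let ?reach = "\<lambda>B. reach B (gilbert_edges rho B) (real m) (real n)"
    have restr: "?reach B \<longleftrightarrow> ?reach (B \<inter> L)" if "B \<subseteq> lattice" for B
    proof -
      have "B \<inter> L = B \<inter> cball 0 (max (real m) (real n) + rho)" using that by (auto simp: L_def)
      then show ?thesis using reach_gilbert_restrict[OF rho, of B "real m" "real n"] by simp
    qed
    \<comment> \<open>Decreasing in the closed set and dependent only on the fixed finite set
      \<open>L\<close>, so that the window can grow while the event stays the same.\<close>
    define \<phi> where "\<phi> F = (if ?reach (L - F) then 1 else 0 :: real)" for F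
    have phi: "antimono \<phi>" "0 \<le> \<phi> F \<and> \<phi> F \<le> 1" for F
    proof -
      show "antimono \<phi>"
        unfolding \<phi>_def by (intro antimonoI) (auto elim!: reach_gilbert_mono)
    qed (simp add: \<phi>_def)
    have E_phi: "measure_pmf.expectation p (\<lambda>N. \<phi> (g N)) = measure_pmf.prob p {N. ?reach (L - g N)}"
      for p :: "('a \<Rightarrow> nat) pmf" and g
    proof -
      have "(\<lambda>N. \<phi> (g N)) = indicator {N. ?reach (L - g N)}" by (auto simp: \<phi>_def indicator_def fun_eq_iff)
      then show ?thesis by simp
    qed
    define T where "T K w = {z \<in> L. P2.cnt s2 z w \<noteq> 0
      \<and> (\<Sum>y\<in>window K. P2.cnt s2 y w * A (norm (y - z))) \<le> C}" for K w
    define ev where "ev i = {w \<in> space M2. ?reach (T (K0 + i) w)}" for i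
    have win: "finite (window K :: 'a set)" "(window K :: 'a set) \<subseteq> lattice" for K
      by (rule finite_window, rule window_subset_lattice)
    have step: "ev i \<in> P2.events \<and> P1.prob {w \<in> space M1. R1 m n w} \<le> P2.prob (ev i)" for i
    proof -
      let ?K = "K0 + i"
      have LK: "L \<subseteq> window ?K" using K0 by simp
      let ?S1 = "{N. ?reach (L - {y\<in>window ?K. N y = (0::nat)})}"
      let ?S2 = "{N. ?reach (L - {z\<in>window ?K. N z = (0::nat) \<or> C < (\<Sum>y\<in>window ?K. N y * A (norm (y - z)))})}"
      have 1: "R1 m n w \<longleftrightarrow> (\<lambda>z. if z \<in> window ?K then P1.cnt s1 z w else 0) \<in> ?S1" if "w \<in> space M1" for w
      proof -
        have "L - {y\<in>window ?K. (if y \<in> window ?K then P1.cnt s1 y w else 0) = 0} = occupied s1 (X1 w) \<inter> L"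
          using LK P1.cnt_eq_0[OF s(1) that] occupied_subset[of s1 "X1 w"] win(2)[of ?K] by auto
        then show ?thesis unfolding R1_def using restr[OF occupied_subset, of s1 "X1 w"] by simp
      qed
      have 2: "?reach (T ?K w) \<longleftrightarrow> (\<lambda>z. if z \<in> window ?K then P2.cnt s2 z w else 0) \<in> ?S2" for w
      proof -
        have "(\<Sum>y\<in>window ?K. (if y \<in> window ?K then P2.cnt s2 y w else 0) * A (norm (y - z)))
            = (\<Sum>y\<in>window ?K. P2.cnt s2 y w * A (norm (y - z)))" for z
          by (rule sum.cong) auto
        then have "L - {z\<in>window ?K. (if z \<in> window ?K then P2.cnt s2 z w else 0) = 0
            \<or> C < (\<Sum>y\<in>window ?K. (if y \<in> window ?K then P2.cnt s2 y w else 0) * A (norm (y - z)))} = T ?K w"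
          unfolding T_def using LK by (auto simp: not_less)
        then show ?thesis by simp
      qed
      have ev: "ev i = {w \<in> space M2. (\<lambda>z. if z \<in> window ?K then P2.cnt s2 z w else 0) \<in> ?S2}"
        unfolding ev_def using 2 by blast
      have "P1.prob {w \<in> space M1. R1 m n w}
          = P1.prob {w \<in> space M1. (\<lambda>z. if z \<in> window ?K then P1.cnt s1 z w else 0) \<in> ?S1}"
        by (rule arg_cong[of _ _ P1.prob], rule Collect_cong) (use 1 in blast)
      also have "\<dots> = measure_pmf.prob (Pi_pmf (window ?K) 0 (\<lambda>_. ?\<nu>')) ?S1"
        by (rule P1.prob_cnt_Pi_pmf[OF s(1) win])
      also have "\<dots> = measure_pmf.expectation (Pi_pmf (window ?K) 0 (\<lambda>_. ?\<nu>')) (\<lambda>N. \<phi> {y\<in>window ?K. N y = 0})"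
        by (simp only: E_phi of_nat_eq_0_iff)
      also have "\<dots> \<le> measure_pmf.expectation (Pi_pmf (window ?K) 0 (\<lambda>_. poisson_pmf ?\<mu>))
        (\<lambda>N. \<phi> {z\<in>window ?K. N z = 0 \<or> C < (\<Sum>y\<in>window ?K. N y * A (norm (y - z)))})"
        by (rule C[OF phi])
      also have "\<dots> = measure_pmf.prob (Pi_pmf (window ?K) 0 (\<lambda>_. poisson_pmf ?\<mu>)) ?S2"
        by (simp only: E_phi of_nat_eq_0_iff)
      also have "\<dots> = P2.prob (ev i)"
        unfolding ev by (rule P2.prob_cnt_Pi_pmf[OF s(2) win, symmetric])
      finally show ?thesis using P2.sets_cnt[OF s(2) win, of ?K ?S2] unfolding ev by simp
    qed
    have T_anti: "T K' w \<subseteq> T K w" if "K \<le> K'" for K K' w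
    proof -
      have "(\<Sum>y\<in>window K. P2.cnt s2 y w * A (norm (y - z))) \<le> (\<Sum>y\<in>window K'. P2.cnt s2 y w * A (norm (y - z)))" for z
        using win window_mono[OF that] A(2) by (intro sum_mono2) auto
      then show ?thesis unfolding T_def by (auto intro: order_trans)
    qed
    have S_eq: "S w \<inter> L = {z \<in> L. P2.cnt s2 z w \<noteq> 0
      \<and> (\<forall>K. (\<Sum>y\<in>window K. P2.cnt s2 y w * A (norm (y - z))) \<le> C)}" if w: "w \<in> space M2" for w
    proof -
      have "z \<in> occupied s2 (X2 w) \<longleftrightarrow> P2.cnt s2 z w \<noteq> 0" if "z \<in> L" for z
      proof -
        have "z \<in> lattice" using that by (simp add: L_def)
        then show ?thesis by (subst P2.cnt_eq_0[OF s(2) w]) simp_all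
      qed
      then show ?thesis unfolding S_def quiet_def P2.cnt_def[symmetric] by blast
    qed
    \<comment> \<open>\<open>T\<close> decreases as the window grows, and since \<open>L\<close> is
      finite the limit is attained in some window.\<close>
    have T_lim: "\<exists>i. T (K0 + i) w = S w \<inter> L" if w: "w \<in> space M2" for w
    proof -
      have L: "finite L" unfolding L_def by (rule finite_lattice_cball)
      have "\<exists>k. \<forall>i\<ge>k. z \<in> T (K0 + i) w \<longrightarrow> z \<in> S w" if "z \<in> L" for z
      proof (cases "z \<in> S w")
        case False
        have "\<exists>K. z \<notin> T K w"
        proof (rule ccontr)
          assume "\<not> ?thesis"
          then have "\<And>K. z \<in> T K w" by blast
          then have "z \<in> S w \<inter> L" unfolding S_eq[OF w] T_def by blast
          then show False using False by simp
        qed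
        then obtain K where "z \<notin> T K w" by blast
        then have "z \<notin> T (K0 + i) w" if "i \<ge> K" for i using T_anti[of K "K0 + i" w] that by auto
        then show ?thesis by blast
      qed auto
      then obtain k where k: "\<And>z i. z \<in> L \<Longrightarrow> i \<ge> k z \<Longrightarrow> z \<in> T (K0 + i) w \<Longrightarrow> z \<in> S w" by metis
      define i where "i = (\<Sum>z\<in>L. k z)"
      have ki: "k z \<le> i" if "z \<in> L" for z unfolding i_def using that L by (intro member_le_sum) auto
      have "T (K0 + i) w \<subseteq> S w \<inter> L" using k ki unfolding T_def by blast
      moreover have "S w \<inter> L \<subseteq> T (K0 + i) w" unfolding S_eq[OF w] T_def by blast
      ultimately show ?thesis by blast
    qed
    have S_sub: "S w \<inter> L \<subseteq> T K w" if "w \<in> space M2" for w K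
      unfolding S_eq[OF that] T_def by blast
    have lat: "S w \<subseteq> lattice" for w unfolding S_def quiet_def using occupied_subset by auto
    have eq: "{w \<in> space M2. R2 m n w} = (\<Inter>i. ev i)"
    proof (intro equalityI subsetI)
      fix w assume w: "w \<in> {w \<in> space M2. R2 m n w}"
      then have "?reach (S w \<inter> L)" using restr[OF lat] by (simp add: R2_def)
      then have "?reach (T K w)" for K using S_sub[of w K] w by (auto elim: reach_gilbert_mono)
      then show "w \<in> (\<Inter>i. ev i)" using w by (simp add: ev_def)
    next
      fix w assume w: "w \<in> (\<Inter>i. ev i)"
      then have ws: "w \<in> space M2" by (auto simp: ev_def)
      obtain i where "T (K0 + i) w = S w \<inter> L" using T_lim[OF ws] by blast
      moreover have "?reach (T (K0 + i) w)" using w by (auto simp: ev_def)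
      ultimately show "w \<in> {w \<in> space M2. R2 m n w}" using restr[OF lat] ws by (simp add: R2_def)
    qed
    have "decseq ev"
      unfolding decseq_def
    proof (intro allI impI subsetI)
      fix i j w assume "i \<le> j" and w: "w \<in> ev j"
      then have "T (K0 + j) w \<subseteq> T (K0 + i) w" by (intro T_anti) simp
      moreover have "?reach (T (K0 + j) w)" using w by (simp add: ev_def)
      ultimately have "?reach (T (K0 + i) w)" using reach_gilbert_mono by metis
      then show "w \<in> ev i" using w by (simp add: ev_def)
    qed
    then have "(\<lambda>i. P2.prob (ev i)) \<longlonglongrightarrow> P2.prob (\<Inter>i. ev i)"
      using step by (intro P2.finite_Lim_measure_decseq) auto
    then have "P1.prob {w \<in> space M1. R1 m n w} \<le> P2.prob (\<Inter>i. ev i)"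
      by (rule LIMSEQ_le_const) (use step in blast)
    then show ?thesis unfolding eq using step by auto
  qed
  have R_anti: "reach B E m n \<Longrightarrow> n' \<le> n \<Longrightarrow> reach B E m n'" for B :: "'a set" and E m n n'
    by (auto elim: reach_mono)
  have all: "P1.prob {w \<in> space M1. \<forall>n. R1 m n w} \<le> P2.prob {w \<in> space M2. \<forall>n. R2 m n w}" for m
  proof -
    have "decseq (\<lambda>n. {w \<in> space M2. R2 m n w})"
      unfolding decseq_def R2_def by (auto elim: R_anti)
    then have "(\<lambda>n. P2.prob {w \<in> space M2. R2 m n w}) \<longlonglongrightarrow> P2.prob (\<Inter>n. {w \<in> space M2. R2 m n w})"
      using R2_prob by (intro P2.finite_Lim_measure_decseq) auto
    moreover have "P1.prob {w \<in> space M1. \<forall>n. R1 m n w} \<le> P2.prob {w \<in> space M2. R2 m n w}" for n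
    proof -
      have "P1.prob {w \<in> space M1. \<forall>n. R1 m n w} \<le> P1.prob {w \<in> space M1. R1 m n w}"
        using R1_sets by (intro P1.finite_measure_mono) auto
      then show ?thesis using R2_prob[of m n] by linarith
    qed
    ultimately have "P1.prob {w \<in> space M1. \<forall>n. R1 m n w} \<le> P2.prob (\<Inter>n. {w \<in> space M2. R2 m n w})"
      by (intro LIMSEQ_le_const) auto
    also have "(\<Inter>n. {w \<in> space M2. R2 m n w}) = {w \<in> space M2. \<forall>n. R2 m n w}" by auto
    finally show ?thesis .
  qed
  have R2_all: "{w \<in> space M2. \<exists>m. \<forall>n. R2 m n w} \<in> P2.events"
    using R2_prob by (intro sets.sets_Collect_countable_Ex sets.sets_Collect_countable_All) auto
  have R1_all: "{w \<in> space M1. \<forall>n. R1 m n w} \<in> P1.events" for m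
    using R1_sets by (intro sets.sets_Collect_countable_All) auto
  have "P1.prob (\<Union>m. {w \<in> space M1. \<forall>n. R1 m n w}) \<le> P2.prob {w \<in> space M2. \<exists>m. \<forall>n. R2 m n w}"
  proof -
    have "incseq (\<lambda>m. {w \<in> space M1. \<forall>n. R1 m n w})"
      unfolding incseq_def R1_def by (force elim: reach_mono)
    then have "(\<lambda>m. P1.prob {w \<in> space M1. \<forall>n. R1 m n w}) \<longlonglongrightarrow> P1.prob (\<Union>m. {w \<in> space M1. \<forall>n. R1 m n w})"
      using R1_all by (intro P1.finite_Lim_measure_incseq) auto
    moreover have "P1.prob {w \<in> space M1. \<forall>n. R1 m n w} \<le> P2.prob {w \<in> space M2. \<exists>m. \<forall>n. R2 m n w}" for m
      using all[of m] P2.finite_measure_mono[OF _ R2_all, of "{w \<in> space M2. \<forall>n. R2 m n w}"] by force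
    ultimately show ?thesis by (intro LIMSEQ_le_const2) auto
  qed
  also have "(\<Union>m. {w \<in> space M1. \<forall>n. R1 m n w})
      = {w \<in> space M1. percolates (occupied s1 (X1 w)) (gilbert_edges rho (occupied s1 (X1 w)))}"
    unfolding percolates_iff_reach[OF finite_occupied_cball] R1_def by auto
  also have "P1.prob \<dots> = 1"
    using P1.prob_lattice_percolation[OF s(1) rho] pos by auto
  finally have "P2.prob {w \<in> space M2. \<exists>m. \<forall>n. R2 m n w} = 1"
    using P2.prob_le_1 by (intro antisym) auto
  then have "AE w in M2. w \<in> {w \<in> space M2. \<exists>m. \<forall>n. R2 m n w}"
    using P2.prob_eq_1[OF R2_all] by simp
  then have "AE w in M2. \<exists>m. \<forall>n. R2 m n w" by eventually_elim simp
  then show ?thesis unfolding R2_def S_def by blast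
qed

section \<open>Supercritical intensities\<close>

lemma poisson_processI:
  assumes "homogeneous_poisson_process M lam X" "lam > 0"
  shows "poisson_process M lam X"
proof -
  have "prob_space M" using assms(1) by (simp only: homogeneous_poisson_process_def)
  then show ?thesis using assms by (intro poisson_process.intro poisson_process_axioms.intro)
qed

lemma percolates_mono_edges:
  fixes V :: "'a::real_normed_vector set"
  assumes "percolates V E" "E \<subseteq> E'"
  shows "percolates V E'"
proof -
  obtain x where x: "x \<in> V" "\<not> bounded (E\<^sup>* `` {x})"
    using assms(1) unfolding percolates_def graph_components_def by blast
  have "E\<^sup>* `` {x} \<subseteq> E'\<^sup>* `` {x}" using rtrancl_mono[OF assms(2)] by blast
  then have "\<not> bounded (E'\<^sup>* `` {x})" using x(2) bounded_subset by blast
  then show ?thesis using x(1) unfolding percolates_def graph_components_def by blast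
qed

text \<open>Grouping the interferers by cells replaces distances of points by distances of cells, at
  the price built into \<open>cell_loss\<close>. Each finite partial sum fits into one
  window.\<close>

lemma quiet_interference:
  fixes V :: "'a::euclidean_space set" and p s C :: real
  assumes wb: "well_behaved DIM('a) l" and fin: "\<And>B. bounded B \<Longrightarrow> finite (V \<inter> B)"
    and s: "s > 0" and p: "0 \<le> p" and z: "site s z \<in> quiet s (cell_loss DIM('a) l s) C V"
  shows "interference p l V x y z \<le> ennreal (p * C)"
  unfolding interference_def
proof (rule infsum_le_finite_sums)
  let ?A = "cell_loss DIM('a) l s"
  have d: "DIM('a) \<ge> 1" by (simp add: Suc_leI)
  show "(\<lambda>v. ennreal (p * l (dist v z))) summable_on V - {x, y}"
    by (rule nonneg_summable_on_complete) simp
  fix F assume F: "finite F" "F \<subseteq> V - {x, y}"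
  have l0: "0 \<le> l (dist v z)" for v by (rule path_loss_nonneg[OF wb d]) simp
  obtain R where R: "\<And>u. u \<in> site s ` F \<Longrightarrow> norm u \<le> R"
    using finite_imp_bounded[OF finite_imageI[OF F(1)], of "site s"] by (auto simp: bounded_iff)
  obtain K where K: "lattice \<inter> cball (0::'a) R \<subseteq> window K"
    using cball_subset_window[of R, where ?'a = 'a] by (metis order_refl)
  have im: "site s ` F \<subseteq> window K" using K R by auto
  have "(\<Sum>v\<in>F. l (dist v z)) \<le> (\<Sum>v\<in>F. ?A (norm (site s v - site s z)))"
  proof (rule sum_mono)
    fix v
    have "max 0 (s * (norm (site s v - site s z) - 2 * DIM('a))) \<le> dist v z"
      using dist_sites(2)[OF s, of v z] by (auto simp: dist_norm algebra_simps)
    then show "l (dist v z) \<le> ?A (norm (site s v - site s z))"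
      unfolding cell_loss_def[OF wb d] by (intro path_loss_antimono[OF wb d]) auto
  qed
  also have "\<dots> = (\<Sum>u\<in>window K. \<Sum>v\<in>{v\<in>F. site s v = u}. ?A (norm (site s v - site s z)))"
    by (rule sum.group[OF F(1) finite_window im, symmetric])
  also have "\<dots> \<le> (\<Sum>u\<in>window K. real (card (V \<inter> cell s u)) * ?A (norm (u - site s z)))"
  proof (rule sum_mono)
    fix u :: 'a assume "u \<in> window K"
    then have u: "u \<in> lattice" using window_subset_lattice by blast
    have "(\<Sum>v\<in>{v\<in>F. site s v = u}. ?A (norm (site s v - site s z)))
        = card {v\<in>F. site s v = u} * ?A (norm (u - site s z))" by simp
    also have "\<dots> \<le> real (card (V \<inter> cell s u)) * ?A (norm (u - site s z))"
    proof (intro mult_right_mono cell_loss_nonneg[OF wb d] of_nat_mono card_mono fin bounded_cell s u)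
      show "{v\<in>F. site s v = u} \<subseteq> V \<inter> cell s u" using F(2) by (auto simp: cell_def)
    qed
    finally show "(\<Sum>v\<in>{v\<in>F. site s v = u}. ?A (norm (site s v - site s z)))
        \<le> real (card (V \<inter> cell s u)) * ?A (norm (u - site s z))" .
  qed
  also have "\<dots> \<le> C" using z unfolding quiet_def by blast
  finally have le: "(\<Sum>v\<in>F. l (dist v z)) \<le> C" .
  have "(\<Sum>v\<in>F. ennreal (p * l (dist v z))) = ennreal (\<Sum>v\<in>F. p * l (dist v z))"
    using l0 p by (intro sum_ennreal) auto
  also have "\<dots> \<le> ennreal (p * C)"
    unfolding sum_distrib_left[symmetric] using le p by (intro ennreal_leI mult_left_mono)
  finally show "(\<Sum>v\<in>F. ennreal (p * l (dist v z))) \<le> ennreal (p * C)" .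
qed

context
  fixes l :: "real \<Rightarrow> real" and p tau No r :: real
  assumes No: "No > 0" and tau: "tau > 0" and p: "p > 0"
    and wb: "well_behaved DIM('a::euclidean_space) l" and l0: "l 0 > tau * No / p"
    and r_def: "r = r_B p tau No l"
begin

private lemma d1: "DIM('a) \<ge> 1" by (simp add: Suc_leI)

private lemma c: "0 < tau * No / p" using No tau p by simp

private lemma r: "r > 0" "l r = tau * No / p"
  using theI'[OF path_loss_unique[OF wb d1 c l0]] unfolding r_def r_B_def by auto

text \<open>The noise alone forces this: dropping the interference leaves
  \<open>tau * No < p * l (dist x y)\<close>.\<close>

lemma sinr_subset_gilbert: "sinr_edges p tau No l gam V \<subseteq> gilbert_edges r (V :: 'a set)"
proof
  fix e assume e: "e \<in> sinr_edges p tau No l gam V"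
  obtain x y where xy: "e = (x, y)" by (cases e)
  have V: "x \<in> V" "y \<in> V" "x \<noteq> y" and
    lt: "ennreal tau * (ennreal No + ennreal gam * interference p l V x y y) < ennreal (p * l (dist x y))"
    using e unfolding xy by (auto simp: sinr_edges_def)
  have "ennreal (tau * No) = ennreal tau * ennreal No" using tau No by (simp add: ennreal_mult)
  also have "\<dots> \<le> ennreal tau * (ennreal No + ennreal gam * interference p l V x y y)"
    by (intro mult_left_mono) auto
  also note lt
  finally have "tau * No < p * l (dist x y)" using tau No by (simp add: ennreal_less_iff)
  then have "tau * No / p < l (dist x y)" using p by (simp add: field_simps)
  then have "dist x y < r" using path_loss_less_iff[OF wb d1 c l0 r] by simp
  then show "e \<in> gilbert_edges r V" using V unfolding xy by (simp add: gilbert_edges_def)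
qed

text \<open>Passing from cells of side \<open>s1\<close> to the smaller side
  \<open>s2 = t * s1\<close> shrinks all distances by \<open>t\<close>, while the higher intensity
  compensates for the smaller volume. The gain \<open>r - r1\<close> leaves a margin above the
  noise, of which a small \<open>gam\<close> lets the interference use at most half.\<close>

lemma supercritical_sinr:
  fixes X1 :: "'v \<Rightarrow> 'a set" and X2 :: "'w \<Rightarrow> 'a set"
  assumes P1: "poisson_process M1 lam1 X1" and P2: "poisson_process M2 lam2 X2" and lam: "lam1 < lam2"
    and perc: "\<not> (AE w in M1. \<not> percolates (X1 w) (gilbert_edges r (X1 w)))"
  shows "\<exists>gam>0. AE w in M2. percolates (X2 w) (sinr_edges p tau No l gam (X2 w))"
proof -
  interpret P1: poisson_process M1 lam1 X1 by fact
  interpret P2: poisson_process M2 lam2 X2 by fact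
  let ?d = "real DIM('a)"
  have d: "?d \<ge> 1" using d1 by simp
  \<comment> \<open>By Bernoulli's inequality, the power \<open>DIM('a)\<close> of
    \<open>1 - e\<close> is then at least \<open>(1 + lam1 / lam2) / 2\<close>, hence above
    \<open>lam1 / lam2\<close>.\<close>
  define e where "e = (1 - lam1 / lam2) / (2 * ?d)"
  have q: "0 < lam1 / lam2" "lam1 / lam2 < 1" using P1.lam lam by auto
  have e: "0 < e" "e \<le> 1 / 2"
  proof -
    show "0 < e" unfolding e_def using q d by (intro divide_pos_pos) auto
    have "e \<le> 1 / (2 * 1)" unfolding e_def using q d by (intro frac_le) auto
    then show "e \<le> 1 / 2" by simp
  qed
  define t where "t = 1 - e"
  have t: "0 < t" "t < 1" using e by (auto simp: t_def)
  have td: "lam1 / lam2 < t ^ DIM('a)"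
  proof -
    have "1 - ?d * e \<le> (1 - e) ^ DIM('a)" using Bernoulli_inequality[of "- e" "DIM('a)"] e by simp
    moreover have "?d * e = (1 - lam1 / lam2) / 2" using d by (simp add: e_def)
    moreover have "q < y" if "1 - x \<le> y" "x = (1 - q) / 2" "q < 1" for q x y :: real
    proof -
      have "2 * x = 1 - q" using that(2) by simp
      then show ?thesis using that(1,3) by linarith
    qed
    ultimately show ?thesis using q(2) unfolding t_def by blast
  qed
  \<comment> \<open>Fine enough that the roundings, \<open>4 * s1 * ?d = r * e / 2\<close> in total,
    use up only half of the gain \<open>r * e\<close> from the scaling.\<close>
  define s1 where "s1 = r * e / (8 * ?d)"
  define s2 where "s2 = t * s1"
  define rho where "rho = (r + 2 * s1 * ?d) / s1"
  have s1: "s1 > 0" using r e d by (simp add: s1_def)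
  have s2: "s2 > 0" using s1 t by (simp add: s2_def)
  have s1rho: "s1 * rho = r + 2 * s1 * ?d" using s1 by (simp add: rho_def)
  have rho: "0 \<le> rho" using r s1 d by (simp add: rho_def)
  have lam': "lam1 * s1 ^ DIM('a) < lam2 * s2 ^ DIM('a)"
  proof -
    have "lam1 < lam2 * t ^ DIM('a)" using td P2.lam by (simp add: field_simps)
    then have "lam1 * s1 ^ DIM('a) < lam2 * t ^ DIM('a) * s1 ^ DIM('a)" using s1 by (intro mult_strict_right_mono) auto
    then show ?thesis by (simp add: s2_def power_mult_distrib mult.assoc)
  qed
  define r1 where "r1 = s2 * rho + 2 * s2 * ?d"
  have r1: "0 \<le> r1" "r1 < r"
  proof -
    show "0 \<le> r1" unfolding r1_def using s2 rho d by (intro add_nonneg_nonneg mult_nonneg_nonneg) auto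
    have "r1 = t * (s1 * rho + 2 * s1 * ?d)" by (simp add: r1_def s2_def algebra_simps)
    also have "\<dots> = t * r + t * (4 * s1 * ?d)" unfolding s1rho by (simp add: algebra_simps)
    also have "4 * s1 * ?d = r * e / 2" using d by (simp add: s1_def)
    also have "t * (r * e / 2) < 1 * (r * e)" using t r e by (intro mult_strict_mono) auto
    finally show "r1 < r" by (simp add: t_def algebra_simps)
  qed
  let ?lp = "{w \<in> space M1. percolates (occupied s1 (X1 w)) (gilbert_edges rho (occupied s1 (X1 w)))}"
  have lp: "?lp \<in> P1.events" by (rule P1.sets_lattice_percolation[OF s1 rho])
  have pos: "P1.prob ?lp > 0"
  proof (rule ccontr)
    assume "\<not> ?thesis"
    then have "P1.prob ?lp = 0" by (simp add: zero_less_measure_iff)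
    then have "AE w in M1. w \<notin> ?lp" using P1.prob_eq_0[OF lp] by simp
    then have "AE w in M1. \<not> percolates (X1 w) (gilbert_edges r (X1 w))"
      using AE_space
    proof eventually_elim
      case (elim w)
      show ?case
      proof
        assume "percolates (X1 w) (gilbert_edges r (X1 w))"
        then have "percolates (occupied s1 (X1 w)) (gilbert_edges rho (occupied s1 (X1 w)))"
          using P1.finite_points[OF elim(2)] s1 s1rho by (intro occupied_percolates[of "X1 w" s1 r rho]) auto
        then show False using elim by simp
      qed
    qed
    then show False using perc by simp
  qed
  obtain C where C: "AE w in M2. \<exists>m::nat. \<forall>n::nat. reach (quiet s2 (cell_loss DIM('a) l s2) C (X2 w))
      (gilbert_edges rho (quiet s2 (cell_loss DIM('a) l s2) C (X2 w))) m n"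
    using quiet_percolation[OF P1 P2 s1 s2 lam' rho cell_loss_antimono[OF wb d1 s2]
        cell_loss_nonneg[OF wb d1] summable_cell_loss[OF wb d1 s2] pos] by auto
  define D where "D = \<bar>C\<bar> + 1"
  have D: "D > 0" "C \<le> D" by (auto simp: D_def)
  define \<delta> where "\<delta> = p * l r1 - tau * No"
  have "tau * No / p < l r1" using path_loss_less_iff[OF wb d1 c l0 r r1(1)] r1 by simp
  then have \<delta>: "\<delta> > 0" using p by (simp add: \<delta>_def field_simps)
  define gam where "gam = \<delta> / (2 * tau * p * D)"
  have gam: "gam > 0" using \<delta> tau p D by (simp add: gam_def)
  have bound: "tau * (No + gam * (p * D)) < p * l r1"
  proof -
    have "tau * (gam * (p * D)) = \<delta> / 2" using tau p D by (simp add: gam_def field_simps)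
    then show ?thesis using \<delta> by (simp add: \<delta>_def algebra_simps)
  qed
  have "AE w in M2. percolates (X2 w) (sinr_edges p tau No l gam (X2 w))"
    using C AE_space
  proof eventually_elim
    case (elim w)
    let ?S = "quiet s2 (cell_loss DIM('a) l s2) C (X2 w)"
    obtain m :: nat where m: "\<And>n::nat. reach ?S (gilbert_edges rho ?S) m n" using elim(1) by auto
    note fin = P2.finite_points[OF elim(2)]
    show ?case
    proof (rule points_percolate[OF fin s2 _ m])
      show "?S \<subseteq> occupied s2 (X2 w)" by (auto simp: quiet_def)
      fix x y assume xy: "x \<in> X2 w" "y \<in> X2 w" "x \<noteq> y" "site s2 x \<in> ?S" "site s2 y \<in> ?S"
        "dist x y < s2 * rho + 2 * s2 * real DIM('a)"
      have "l r1 \<le> l (dist x y)" using xy(6) by (intro path_loss_antimono[OF wb d1]) (auto simp: r1_def)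
      then have "p * l r1 \<le> p * l (dist x y)" using p by simp
      then have lt: "tau * (No + gam * (p * D)) < p * l (dist x y)" using bound by linarith
      have "ennreal tau * (ennreal No + ennreal gam * interference p l (X2 w) x y z) < ennreal (p * l (dist x y))"
        if z: "site s2 z \<in> ?S" for z
      proof -
        have "interference p l (X2 w) x y z \<le> ennreal (p * C)"
          using quiet_interference[OF wb fin s2 _ z] p by simp
        also have "\<dots> \<le> ennreal (p * D)" using D p by (intro ennreal_leI mult_left_mono) auto
        finally have "ennreal tau * (ennreal No + ennreal gam * interference p l (X2 w) x y z)
            \<le> ennreal tau * (ennreal No + ennreal gam * ennreal (p * D))"
          by (intro mult_left_mono add_left_mono) auto
        also have "\<dots> = ennreal (tau * (No + gam * (p * D)))"
          using tau No gam p D by (simp add: ennreal_mult ennreal_plus)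
        also have "\<dots> < ennreal (p * l (dist x y))"
        proof (rule ennreal_lessI[OF _ lt])
          have "0 < tau * (No + gam * (p * D))"
            using tau No gam p D by (intro mult_pos_pos add_pos_pos) auto
          then show "0 < p * l (dist x y)" using lt by linarith
        qed
        finally show ?thesis .
      qed
      then show "(x, y) \<in> sinr_edges p tau No l gam (X2 w)" using xy by (simp add: sinr_edges_def)
    qed simp
  qed
  then show ?thesis using gam by blast
qed

end

text \<open>Points at distance below \<open>r\<close> lie in cells of side \<open>r\<close> at index
  distance below \<open>1 + 2 * DIM('a)\<close>, and a cell is occupied with probability at most
  \<open>lam * r ^ DIM('a)\<close>, so path counting applies. The bound \<open>lam0\<close> is
  uniform over all processes.\<close>

lemma AE_no_gilbert_percolation:
  fixes r :: real
  assumes r: "r > 0"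
  shows "\<exists>lam0>0. \<forall>M lam (X :: 'w \<Rightarrow> 'a::euclidean_space set). poisson_process M lam X \<longrightarrow> lam < lam0 \<longrightarrow>
    (AE w in M. \<not> percolates (X w) (gilbert_edges r (X w)))"
proof -
  define rho where "rho = 1 + 2 * real DIM('a)"
  define D where "D = real (card (lattice \<inter> cball (0::'a) rho)) + 1"
  define lam0 where "lam0 = 1 / (D * r ^ DIM('a))"
  have D: "D > 0" by (simp add: D_def)
  have lam0: "lam0 > 0" using D r by (simp add: lam0_def)
  have "AE w in M. \<not> percolates (X w) (gilbert_edges r (X w))"
    if P: "poisson_process M lam X" and lt: "lam < lam0" for M lam and X :: "'w \<Rightarrow> 'a set"
  proof -
    interpret poisson_process M lam X by fact
    have "D * (lam * r ^ DIM('a)) < 1" using lt D r by (simp add: lam0_def field_simps)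
    moreover have "1 - exp (- (lam * r ^ DIM('a))) \<le> lam * r ^ DIM('a)"
      using exp_ge_add_one_self[of "- (lam * r ^ DIM('a))"] by linarith
    then have "(D - 1) * (1 - exp (- (lam * r ^ DIM('a)))) \<le> D * (lam * r ^ DIM('a))"
      using lam r D by (intro mult_mono) (auto simp: D_def)
    ultimately have "real (card (lattice \<inter> cball (0::'a) rho)) * (1 - exp (- (lam * r ^ DIM('a)))) < 1"
      by (simp add: D_def)
    then have "AE w in M. \<not> percolates (occupied r (X w)) (gilbert_edges rho (occupied r (X w)))"
      by (intro AE_no_lattice_percolation r) (simp add: rho_def)
    then show ?thesis using AE_space
    proof eventually_elim
      case (elim w)
      show ?case
        using elim(1) occupied_percolates[of "X w" r r rho] finite_points[OF elim(2)] r
        by (auto simp: rho_def algebra_simps)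
    qed
  qed
  then show ?thesis using lam0 by blast
qed

lemma gilbert_percolation_dense:
  fixes r :: real
  assumes r: "r > 0" and d: "DIM('a::euclidean_space) \<ge> 2"
  shows "\<exists>lam1>0. \<forall>M lam (X :: 'w \<Rightarrow> 'a set). poisson_process M lam X \<longrightarrow> lam1 \<le> lam \<longrightarrow>
    \<not> (AE w in M. \<not> percolates (X w) (gilbert_edges r (X w)))"
proof -
  define s where "s = r / (3 / 2 + 2 * real DIM('a))"
  have s: "s > 0" using r by (simp add: s_def add_pos_nonneg)
  have rs: "s * (3 / 2) + 2 * s * real DIM('a) = r"
  proof -
    have "s * (3 / 2 + 2 * real DIM('a)) = r" by (simp add: s_def add_pos_nonneg less_imp_neq[symmetric])
    then show ?thesis by (simp add: algebra_simps)
  qed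
  \<comment> \<open>\<open>324 = 4 * 81\<close>: a cell is then empty with probability at most
    \<open>1 / 324\<close>, as \<open>lattice_percolation_dense\<close> asks.\<close>
  define lam1 where "lam1 = ln 324 / s ^ DIM('a)"
  have lam1: "lam1 > 0" using s by (simp add: lam1_def)
  have "\<not> (AE w in M. \<not> percolates (X w) (gilbert_edges r (X w)))"
    if P: "poisson_process M lam X" and le: "lam1 \<le> lam" for M lam and X :: "'w \<Rightarrow> 'a set"
  proof
    interpret poisson_process M lam X by fact
    assume ae: "AE w in M. \<not> percolates (X w) (gilbert_edges r (X w))"
    have "ln 324 \<le> lam * s ^ DIM('a)" using le s by (simp add: lam1_def field_simps)
    then have "exp (- (lam * s ^ DIM('a))) \<le> exp (- ln 324)" by simp
    also have "\<dots> = 1 / 324" by (simp add: exp_minus)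
    finally have "81 * exp (- (lam * s ^ DIM('a))) \<le> 1 / 4" by simp
    then have pos: "prob (lattice_percolation s (3 / 2)) > 0" by (rule lattice_percolation_dense[OF s d])
    have "AE w in M. w \<notin> lattice_percolation s (3 / 2)"
      using ae AE_space
    proof eventually_elim
      case (elim w)
      show ?case
      proof
        assume "w \<in> lattice_percolation s (3 / 2)"
        then have "\<exists>m::nat. \<forall>n::nat. reach (occupied s (X w)) (gilbert_edges (3 / 2) (occupied s (X w))) m n"
          using percolates_iff_reach[OF finite_occupied_cball] by blast
        then obtain m :: nat where m: "\<And>n::nat. reach (occupied s (X w)) (gilbert_edges (3 / 2) (occupied s (X w))) m n"
          by auto
        have "percolates (X w) (gilbert_edges r (X w))"
        proof (rule points_percolate[OF finite_points[OF elim(2)] s order_refl m])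
          show "(x, y) \<in> gilbert_edges r (X w)" if "x \<in> X w" "y \<in> X w" "x \<noteq> y"
            "dist x y < s * (3 / 2) + 2 * s * real DIM('a)" for x y
            using that unfolding rs by (simp add: gilbert_edges_def)
        qed simp
        then show False using elim(1) by simp
      qed
    qed
    then have "prob (lattice_percolation s (3 / 2)) = 0"
      using prob_eq_0[OF sets_lattice_percolation[OF s]] by simp
    then show False using pos by simp
  qed
  then show ?thesis using lam1 by blast
qed

theorem theorem2p3:
  fixes M :: "real \<Rightarrow> 'w measure"
    and X :: "real \<Rightarrow> 'w \<Rightarrow> 'a::euclidean_space set"
    and l :: "real \<Rightarrow> real"
    and p tau No :: real
  assumes dim: "DIM('a) \<ge> 2"
    and No_pos: "No > 0" and tau_pos: "tau > 0" and p_pos: "p > 0"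
    and poisson: "\<And>lam. lam > 0 \<Longrightarrow> homogeneous_poisson_process (M lam) lam (X lam)"
    and path_loss: "well_behaved DIM('a) l"
    and l_0: "l 0 > tau * No / p"
  shows "lambda_c_star p tau No l M X = ennreal (lambda_c M X (r_B p tau No l))"
proof -
  define r where "r = r_B p tau No l"
  have d: "DIM('a) \<ge> 1" using dim by simp
  have "0 < tau * No / p" using No_pos tau_pos p_pos by simp
  from theI'[OF path_loss_unique[OF path_loss d this l_0]] have r: "r > 0"
    unfolding r_def r_B_def by simp
  have P: "poisson_process (M lam) lam (X lam)" if "lam > 0" for lam
    using poisson_processI[OF poisson[OF that] that] .
  let ?G = "\<lambda>lam w. percolates (X lam w) (gilbert_edges r (X lam w))"
  let ?S = "\<lambda>gam lam w. percolates (X lam w) (sinr_edges p tau No l gam (X lam w))"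
  have SG: "?G lam w" if "?S gam lam w" for gam lam w
    using that sinr_subset_gilbert[OF No_pos tau_pos p_pos path_loss l_0 r_def] by (rule percolates_mono_edges)
  \<comment> \<open>The processes \<open>X lam\<close> come without a coupling, so it is not evident
    that \<open>S\<close> is closed upwards; this comes out of \<open>super\<close>.\<close>
  define S where "S = {lam. lam > 0 \<and> \<not> (AE w in M lam. \<not> ?G lam w)}"
  define c where "c = Inf S"
  obtain lam0 where lam0: "lam0 > 0" "\<And>lam. lam > 0 \<Longrightarrow> lam < lam0 \<Longrightarrow> AE w in M lam. \<not> ?G lam w"
    using AE_no_gilbert_percolation[OF r, where ?'a = 'a and ?'w = 'w] P by metis
  obtain lam1 where lam1: "lam1 > 0" "\<And>lam. lam > 0 \<Longrightarrow> lam1 \<le> lam \<Longrightarrow> \<not> (AE w in M lam. \<not> ?G lam w)"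
    using gilbert_percolation_dense[OF r dim, where ?'w = 'w] P by metis
  have S_ne: "S \<noteq> {}" using lam1(1) lam1(2)[of lam1] unfolding S_def by blast
  have S_ge: "lam0 \<le> lam" if "lam \<in> S" for lam
    using that lam0(2)[of lam] unfolding S_def by (intro leI) blast
  have bdd: "bdd_below S" using S_ge by (intro bdd_belowI[of _ lam0])
  have c_pos: "c > 0" using cInf_greatest[OF S_ne S_ge] lam0(1) unfolding c_def by linarith
  have super: "\<exists>gam>0. AE w in M lam. ?S gam lam w" if "c < lam" for lam
  proof -
    obtain lam' where lam': "lam' \<in> S" "lam' < lam" using cInf_lessD[OF S_ne] \<open>c < lam\<close> unfolding c_def by blast
    then have "lam' > 0" "\<not> (AE w in M lam'. \<not> ?G lam' w)" by (simp_all add: S_def)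
    moreover have "lam > 0" using c_pos that by simp
    ultimately show ?thesis
      using supercritical_sinr[OF No_pos tau_pos p_pos path_loss l_0 r_def P P lam'(2)] by simp
  qed
  have sub: "AE w in M lam. \<not> ?G lam w" if "0 < lam" "lam < c" for lam
  proof (rule ccontr)
    assume "\<not> ?thesis"
    then have "lam \<in> S" using that by (simp add: S_def)
    then have "c \<le> lam" unfolding c_def by (rule cInf_lower[OF _ bdd])
    then show False using that by simp
  qed
  \<comment> \<open>SINR edges are Gilbert edges, so percolation with interference also gives the
    almost sure Gilbert percolation above \<open>c\<close> that the description
    \<open>lambda_c\<close> demands.\<close>
  have superG: "AE w in M lam. ?G lam w" if gt: "c < lam" for lam
  proof -
    obtain gam where "AE w in M lam. ?S gam lam w" using super[OF gt] by blast
    then show ?thesis by eventually_elim (rule SG)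
  qed
  have not_both: False if "lam > 0" "AE w in M lam. ?G lam w" "AE w in M lam. \<not> ?G lam w" for lam
  proof -
    interpret poisson_process "M lam" lam "X lam" by (rule P[OF that(1)])
    have "AE w in M lam. False" using that(2,3) by eventually_elim simp
    then show False by simp
  qed
  have lambda_c: "lambda_c M X r = c"
    unfolding lambda_c_def
  proof (rule the_equality)
    show "c > 0 \<and> (\<forall>lam>c. AE w in M lam. ?G lam w) \<and> (\<forall>lam. 0 < lam \<and> lam < c \<longrightarrow> (AE w in M lam. \<not> ?G lam w))"
      using c_pos superG sub by blast
    fix c' assume c': "c' > 0 \<and> (\<forall>lam>c'. AE w in M lam. ?G lam w) \<and> (\<forall>lam. 0 < lam \<and> lam < c' \<longrightarrow> (AE w in M lam. \<not> ?G lam w))"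
    show "c' = c"
    proof (rule ccontr)
      assume "c' \<noteq> c"
      then consider "c' < c" | "c < c'" by linarith
      then show False
      proof cases
        case 1
        then obtain lam where lam: "c' < lam" "lam < c" using dense by blast
        then have "lam > 0" using c' by simp
        then show False using not_both[of lam] sub[of lam] lam c' by blast
      next
        case 2
        then obtain lam where lam: "c < lam" "lam < c'" using dense by blast
        then have "lam > 0" using c_pos by simp
        then show False using not_both[of lam] superG[of lam] lam c' by blast
      qed
    qed
  qed
  have ev: "{w \<in> space (M lam). ?S gam lam w} \<in> sets (M lam)" if "lam > 0" for lam gam
    using poisson_process.sets_sinr_percolates[OF P[OF that] path_loss_cont[OF path_loss d]] .
  have gamma_pos: "gamma_crit p tau No l M X lam > 0" if gt: "c < lam" for lam
  proof -
    have lam: "lam > 0" using gt c_pos by simp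
    interpret poisson_process "M lam" lam "X lam" by (rule P[OF lam])
    obtain gam where gam: "gam > 0" "AE w in M lam. ?S gam lam w" using super[OF gt] by blast
    have "AE w in M lam. w \<in> {w \<in> space (M lam). ?S gam lam w}"
      using gam(2) AE_space by eventually_elim simp
    then have "prob {w \<in> space (M lam). ?S gam lam w} = 1" using prob_eq_1[OF ev[OF lam]] by simp
    then have "ennreal gam \<le> gamma_crit p tau No l M X lam"
      unfolding gamma_crit_def using gam(1) by (intro Sup_upper CollectI exI[of _ gam]) simp
    then show ?thesis using gam(1) by (meson ennreal_less_zero_iff less_le_trans)
  qed
  have gamma_0: "gamma_crit p tau No l M X lam = 0" if "0 < lam" "lam < c" for lam
  proof -
    interpret poisson_process "M lam" lam "X lam" by (rule P[OF that(1)])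
    have "prob {w \<in> space (M lam). ?S gam lam w} = 0" for gam
    proof -
      have "AE w in M lam. w \<notin> {w \<in> space (M lam). ?S gam lam w}"
        using sub[OF that] by eventually_elim (use SG in blast)
      then show ?thesis using prob_eq_0[OF ev[OF that(1)]] by simp
    qed
    then have no: "{ennreal gam | gam. gam > 0 \<and> prob {w \<in> space (M lam). ?S gam lam w} > 0} = {}" by simp
    show ?thesis unfolding gamma_crit_def no by (simp add: bot_ennreal)
  qed
  have "lambda_c_star p tau No l M X = ennreal c"
    unfolding lambda_c_star_def
  proof (rule antisym)
    show "Inf {ennreal lam | lam. lam > 0 \<and> (\<forall>lam'>lam. gamma_crit p tau No l M X lam' > 0)} \<le> ennreal c"
      using c_pos gamma_pos by (intro Inf_lower) blast
    show "ennreal c \<le> Inf {ennreal lam | lam. lam > 0 \<and> (\<forall>lam'>lam. gamma_crit p tau No l M X lam' > 0)}"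
    proof (rule Inf_greatest)
      fix v assume "v \<in> {ennreal lam | lam. lam > 0 \<and> (\<forall>lam'>lam. gamma_crit p tau No l M X lam' > 0)}"
      then obtain lam where lam: "v = ennreal lam" "lam > 0" "\<And>lam'. lam < lam' \<Longrightarrow> gamma_crit p tau No l M X lam' > 0"
        by blast
      have "c \<le> lam"
      proof (rule ccontr)
        assume "\<not> c \<le> lam"
        then obtain lam' where "lam < lam'" "lam' < c" using dense[of lam c] by auto
        then show False using lam(3)[of lam'] gamma_0[of lam'] lam(2) by simp
      qed
      then show "ennreal c \<le> v" unfolding lam(1) by (rule ennreal_leI)
    qed
  qed
  then show ?thesis using lambda_c unfolding r_def by simp
qed

end
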